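(* Let $\boldsymbol e \in \mathbb{L}^2_{\# s}$. Then there exists a unique $v \in H^1_{\# 0}$ such that $\boldsymbol e = \nabla_s v$ in $\mathbb{L}^2_{\# s}$ if and only if $$\int_Y \langle \boldsymbol e, \boldsymbol s\rangle\, dy = 0 \quad \text{for all } \boldsymbol s \in \mathbb{L}^2_{\# s} \text{ such that } \operatorname{div} \boldsymbol s = 0 \text{ in } H^{-1}_\#.$$
   Context: Let $\vec g_1,\vec g_2,\vec g_3$ be linearly independent vectors in $\mathbb{R}^3$, let $\mathcal G$ be the additive group (lattice) they generate, and let $Y=\{s_1\vec g_1+s_2\vec g_2+s_3\vec g_3 : s_1,s_2,s_3\in[0,1]\}$ be the periodicity cell. A function on $\mathbb{R}^3$ is $\mathcal G$-periodic if it is invariant under translations by vectors of $\mathcal G$. $\mathbb{L}^2_{\# s}$ is the space of $\mathcal G$-periodic fields of real symmetric $3\times3$ matrices in $L^2_{\rm loc}(\mathbb{R}^3)$, with the $L^2(Y)$ norm. $H^1_\#$ is the space of $\mathcal G$-periodic vector fields in $H^1_{\rm loc}(\mathbb{R}^3,\mathbb{R}^3)$ with the $H^1(Y,\mathbb{R}^3)$ norm, and $H^{-1}_\#$ is its dual. $H^1_{\#0}=\{v\in H^1_\# : \int_Y v\,dy=0\}$. $\nabla_s v=\frac12(\nabla v+(\nabla v)^T)$ is the symmetric part of the gradient, and $\langle A,B\rangle=\sum_{i,j}A_{ij}B_{ij}$ for $3\times 3$ matrices. For a matrix field $\boldsymbol s$, $\operatorname{div}\boldsymbol s=(\sum_j\partial_j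 s_{ij})_{1\le i\le 3}$ in the sense of distributions; for $\boldsymbol s\in\mathbb{L}^2_{\# s}$ it is regarded as the element of $H^{-1}_\#$ given by $v\mapsto-\int_Y\langle\boldsymbol s,\nabla v\rangle\,dy$. *)

theory Defs
  imports "HOL-Analysis.Analysis"
begin

text \<open>Elements of the function spaces are represented by functions defined everywhere; equality in a
  space is equality almost everywhere. Each set of fields below is closed under modification on
  Lebesgue null sets.\<close>

definition lattice :: "(3 \<Rightarrow> real^3) \<Rightarrow> (real^3) set" where
  "lattice g = {\<Sum>i\<in>UNIV. of_int (n i) *\<^sub>R g i | n :: 3 \<Rightarrow> int. True}"

definition cell :: "(3 \<Rightarrow> real^3) \<Rightarrow> (real^3) set" where
  "cell g = {\<Sum>i\<in>UNIV. s i *\<^sub>R g i | s :: 3 \<Rightarrow> real. \<forall>i. s i \<in> {0..1}}"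

definition periodic :: "(3 \<Rightarrow> real^3) \<Rightarrow> (real^3 \<Rightarrow> 'b) \<Rightarrow> bool" where
  "periodic g f \<longleftrightarrow> (\<forall>t\<in>lattice g. AE x in lebesgue. f (x + t) = f x)"

definition L2_loc :: "(real^3 \<Rightarrow> 'b::euclidean_space) set" where
  "L2_loc = {f \<in> borel_measurable lebesgue.
     \<forall>K. compact K \<longrightarrow> set_integrable lebesgue K (\<lambda>x. (norm (f x))\<^sup>2)}"

definition L2_per_sym :: "(3 \<Rightarrow> real^3) \<Rightarrow> (real^3 \<Rightarrow> real^3^3) set" where
  "L2_per_sym g = {s \<in> L2_loc. periodic g s \<and> (AE x in lebesgue. transpose (s x) = s x)}"

definition partial :: "3 \<Rightarrow> (real^3 \<Rightarrow> real) \<Rightarrow> real^3 \<Rightarrow> real" where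
  "partial j f x = frechet_derivative f (at x) (axis j 1)"

primrec Ck :: "nat \<Rightarrow> (real^3 \<Rightarrow> real) \<Rightarrow> bool" where
  "Ck 0 f \<longleftrightarrow> continuous_on UNIV f"
| "Ck (Suc k) f \<longleftrightarrow> (\<forall>x. f differentiable (at x)) \<and> (\<forall>j. Ck k (partial j f))"

definition test_functions :: "(real^3 \<Rightarrow> real) set" where
  "test_functions = {\<phi>. (\<forall>k. Ck k \<phi>) \<and> compact (closure {x. \<phi> x \<noteq> 0})}"

text \<open>Row \<open>i\<close>, column \<open>j\<close> of a gradient is the distributional derivative of component \<open>i\<close> in
  direction \<open>j\<close>. A weak gradient is unique only almost everywhere, and \<open>weak_grad\<close> picks one
  representative.\<close>

definition has_weak_grad :: "(real^3 \<Rightarrow> real^3) \<Rightarrow> (real^3 \<Rightarrow> real^3^3) \<Rightarrow> bool" where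
  "has_weak_grad v D \<longleftrightarrow> (\<forall>\<phi>\<in>test_functions. \<forall>i j.
     (LINT x|lebesgue. v x $ i * partial j \<phi> x) = - (LINT x|lebesgue. D x $ i $ j * \<phi> x))"

definition H1_loc :: "(real^3 \<Rightarrow> real^3) set" where
  "H1_loc = {v \<in> L2_loc. \<exists>D\<in>L2_loc. has_weak_grad v D}"

definition weak_grad :: "(real^3 \<Rightarrow> real^3) \<Rightarrow> real^3 \<Rightarrow> real^3^3" where
  "weak_grad v = (SOME D. D \<in> L2_loc \<and> has_weak_grad v D)"

definition sym_grad :: "(real^3 \<Rightarrow> real^3) \<Rightarrow> real^3 \<Rightarrow> real^3^3" where
  "sym_grad v x = (1/2) *\<^sub>R (weak_grad v x + transpose (weak_grad v x))"

definition H1_per :: "(3 \<Rightarrow> real^3) \<Rightarrow> (real^3 \<Rightarrow> real^3) set" where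
  "H1_per g = {v \<in> H1_loc. periodic g v}"

definition H1_per0 :: "(3 \<Rightarrow> real^3) \<Rightarrow> (real^3 \<Rightarrow> real^3) set" where
  "H1_per0 g = {v \<in> H1_per g. (LINT y:cell g|lebesgue. v y) = 0}"

text \<open>The divergence of \<open>s\<close> as a functional on \<open>H1_per g\<close>; it vanishes in the dual space iff it
  vanishes at every element of \<open>H1_per g\<close>. On matrices, \<open>\<bullet>\<close> is the entrywise (Frobenius) inner
  product.\<close>

definition div_per :: "(3 \<Rightarrow> real^3) \<Rightarrow> (real^3 \<Rightarrow> real^3^3) \<Rightarrow> (real^3 \<Rightarrow> real^3) \<Rightarrow> real" where
  "div_per g s v = - (LINT y:cell g|lebesgue. s y \<bullet> weak_grad v y)"

end

theory Submission
  imports Defs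
begin

text \<open>The symmetric gradients of periodic Sobolev fields form a subspace of the square-integrable periodic
fields of symmetric matrices, and a symmetric field is orthogonal to that subspace exactly when it is
divergence free. If the subspace is closed, let \<open>p\<close> be the orthogonal projection of \<open>e\<close> on it
(\<open>L2_projection\<close>). The residual \<open>e - p\<close> is divergence free, so the hypothesis makes it orthogonal to \<open>e\<close>;
it is orthogonal to \<open>p\<close> as well, hence to itself, and \<open>e = p\<close> is a symmetric gradient. Conversely a
symmetric gradient is orthogonal to every divergence-free symmetric field by the definition of the divergence.

Closedness (\<open>sym_gradients_complete\<close>) and uniqueness (\<open>H1_inv_unique\<close>) both follow from the bound of
a field of mean zero by its symmetric gradient, which combines the Poincare inequality
(\<open>poincare\<close>) with Korn's inequality \<open>\<parallel>\<nabla>v\<parallel> \<le> \<surd>2 \<parallel>\<nabla>\<^sub>sv\<parallel>\<close> (\<open>korn\<close>). The two inequalities are obtained from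
translations alone, without Fourier series and without convolutions. Two facts are needed. First, the
integral of a periodic function over the cell does not change when the function is translated
(\<open>integral_cell_translate\<close>), because the lattice translates of the cell tile the space. Secondly, a
function with weak gradient \<open>d\<close> satisfies \<open>u (x + z) - u x = \<integral> d (x + t z) \<bullet> z dt\<close> over \<open>0 \<le> t \<le> 1\<close>, for each \<open>z\<close>
and almost every \<open>x\<close> (\<open>weak_gradient_line_integral\<close>); this is the weak formulation integrated along a
segment and read off by the fundamental lemma of the calculus of variations (\<open>fundamental_lemma\<close>).

The Poincare inequality follows by averaging \<open>\<bar>u (x + z) - u x\<bar>\<^sup>2\<close> over \<open>x\<close> and \<open>z\<close> in the cell. For Korn's
inequality the classical proof integrates by parts twice in \<open>\<integral> \<partial>\<^sub>jv\<^sub>i \<partial>\<^sub>iv\<^sub>j = \<integral> \<partial>\<^sub>iv\<^sub>i \<partial>\<^sub>jv\<^sub>j\<close>, and the sum over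
\<open>i\<close> and \<open>j\<close> of the right-hand side is \<open>\<integral> (div v)\<^sup>2 \<ge> 0\<close>. With difference quotients in place of derivatives this
is an exact rearrangement of translates that needs no regularity of \<open>v\<close> (\<open>discrete_korn\<close>). Since
translations act continuously on square-integrable functions (\<open>translate_continuous\<close>), the difference
quotients converge to the weak derivatives in the mean (\<open>difference_quotient_L2\<close>), and the inequality passes
to the limit.

Almost everywhere periodic fields are exchanged for Borel representatives that are periodic at every
point (\<open>L2_inv_representative\<close>, \<open>H1_per_representative\<close>), so that they can be translated without regard to
null sets.\<close>

section \<open>Square-integrable functions\<close>

definition L2 :: "'a measure \<Rightarrow> ('a \<Rightarrow> 'b::euclidean_space) set" where
  "L2 M = {f \<in> borel_measurable M. integrable M (\<lambda>x. (norm (f x))\<^sup>2)}"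

definition norm2 :: "'a measure \<Rightarrow> ('a \<Rightarrow> 'b::euclidean_space) \<Rightarrow> real" where
  "norm2 M f = sqrt (LINT x|M. (norm (f x))\<^sup>2)"

lemma L2_measurable [measurable_dest]: "f \<in> L2 M \<Longrightarrow> f \<in> borel_measurable M"
  by (simp add: L2_def)

lemma L2_integrable: "f \<in> L2 M \<Longrightarrow> integrable M (\<lambda>x. (norm (f x))\<^sup>2)"
  by (simp add: L2_def)

lemma norm2_nonneg [simp]: "0 \<le> norm2 M f"
  by (simp add: norm2_def)

lemma norm2_sq: "(norm2 M f)\<^sup>2 = (LINT x|M. (norm (f x))\<^sup>2)"
  by (simp add: norm2_def)

lemma norm2_uminus: "norm2 M (\<lambda>x. - f x) = norm2 M f"
  by (simp add: norm2_def)

lemma norm2_minus_commute: "norm2 M (\<lambda>x. f x - g x) = norm2 M (\<lambda>x. g x - f x)"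
  by (simp add: norm2_def norm_minus_commute)

lemma L2_scaleR: "f \<in> L2 M \<Longrightarrow> (\<lambda>x. c *\<^sub>R f x) \<in> L2 M"
  by (auto simp add: L2_def power_mult_distrib)

lemma norm2_scaleR: "norm2 M (\<lambda>x. c *\<^sub>R f x) = \<bar>c\<bar> * norm2 M f"
  by (simp add: norm2_def power_mult_distrib real_sqrt_mult)

lemma L2_dominated:
  assumes "f \<in> borel_measurable M" "g \<in> L2 M" "\<And>x. norm (f x) \<le> C * norm (g x)"
  shows "f \<in> L2 M"
proof -
  have "integrable M (\<lambda>x. C\<^sup>2 * (norm (g x))\<^sup>2)" using assms(2) by (simp add: L2_def)
  moreover have "(norm (f x))\<^sup>2 \<le> C\<^sup>2 * (norm (g x))\<^sup>2" for x
    using power_mono[OF assms(3)[of x], of 2] by (simp add: power_mult_distrib)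
  ultimately have "integrable M (\<lambda>x. (norm (f x))\<^sup>2)"
    using assms(1) by (elim Bochner_Integration.integrable_bound) auto
  then show ?thesis using assms by (simp add: L2_def)
qed

lemma norm2_dominated:
  assumes "f \<in> borel_measurable M" "g \<in> L2 M" "\<And>x. norm (f x) \<le> norm (g x)"
  shows "norm2 M f \<le> norm2 M g"
proof -
  have "f \<in> L2 M" using L2_dominated[of f M g 1] assms by simp
  then show ?thesis
    using assms unfolding norm2_def
    by (intro real_sqrt_le_mono integral_mono L2_integrable power_mono) auto
qed

lemma L2_add:
  assumes "f \<in> L2 M" "g \<in> L2 M"
  shows "(\<lambda>x. f x + g x) \<in> L2 M"
proof -
  have [measurable]: "f \<in> borel_measurable M" "g \<in> borel_measurable M" using assms by (auto simp: L2_def)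
  have "integrable M (\<lambda>x. 2 * (norm (f x))\<^sup>2 + 2 * (norm (g x))\<^sup>2)"
    using assms by (simp add: L2_def)
  moreover have "(norm (f x + g x))\<^sup>2 \<le> 2 * (norm (f x))\<^sup>2 + 2 * (norm (g x))\<^sup>2" for x
  proof -
    have "(norm (f x + g x))\<^sup>2 \<le> (norm (f x) + norm (g x))\<^sup>2"
      by (intro power_mono norm_triangle_ineq) auto
    also have "\<dots> \<le> 2 * (norm (f x))\<^sup>2 + 2 * (norm (g x))\<^sup>2"
      using zero_le_power2[of "norm (f x) - norm (g x)"] by (simp add: power2_sum power2_diff)
    finally show ?thesis .
  qed
  ultimately have "integrable M (\<lambda>x. (norm (f x + g x))\<^sup>2)"
    by (elim Bochner_Integration.integrable_bound) (auto)
  then show ?thesis by (simp add: L2_def)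
qed

lemma L2_diff: "f \<in> L2 M \<Longrightarrow> g \<in> L2 M \<Longrightarrow> (\<lambda>x. f x - g x) \<in> L2 M"
  using L2_add[of f M "\<lambda>x. (-1) *\<^sub>R g x"] L2_scaleR[of g M "-1"] by simp

lemma L2_const: "finite_measure M \<Longrightarrow> (\<lambda>x. c) \<in> L2 M"
  by (simp add: L2_def finite_measure.integrable_const)

lemma L2_bounded_linear:
  assumes "bounded_linear T" "f \<in> L2 M" shows "(\<lambda>x. T (f x)) \<in> L2 M"
proof -
  obtain K where K: "\<And>x. norm (T x) \<le> norm x * K" using bounded_linear.bounded[OF assms(1)] by blast
  have "T \<in> borel_measurable borel"
    using assms(1) by (intro borel_measurable_continuous_onI linear_continuous_on)
  then have "(\<lambda>x. T (f x)) \<in> borel_measurable M" using assms(2) by measurable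
  moreover have "norm (T (f x)) \<le> K * norm (f x)" for x using K[of "f x"] by (simp only: mult.commute)
  ultimately show ?thesis by (rule L2_dominated[OF _ assms(2)])
qed

lemma L2_inner_integrable:
  assumes "f \<in> L2 M" "g \<in> L2 M"
  shows "integrable M (\<lambda>x. f x \<bullet> g x)"
proof -
  have [measurable]: "f \<in> borel_measurable M" "g \<in> borel_measurable M" using assms by (auto simp: L2_def)
  have "integrable M (\<lambda>x. (norm (f x))\<^sup>2 + (norm (g x))\<^sup>2)"
    using assms by (simp add: L2_def)
  moreover have "\<bar>f x \<bullet> g x\<bar> \<le> (norm (f x))\<^sup>2 + (norm (g x))\<^sup>2" for x
  proof -
    have "2 * (norm (f x) * norm (g x)) \<le> (norm (f x))\<^sup>2 + (norm (g x))\<^sup>2"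
      using zero_le_power2[of "norm (f x) - norm (g x)"] by (simp add: power2_diff)
    then show ?thesis
      using Cauchy_Schwarz_ineq2[of "f x" "g x"] mult_nonneg_nonneg[of "norm (f x)" "norm (g x)"]
      by simp
  qed
  ultimately show ?thesis by (elim Bochner_Integration.integrable_bound) auto
qed

lemma norm2_sq_add:
  assumes "f \<in> L2 M" "g \<in> L2 M"
  shows "(norm2 M (\<lambda>x. f x + g x))\<^sup>2 = (norm2 M f)\<^sup>2 + 2 * (LINT x|M. f x \<bullet> g x) + (norm2 M g)\<^sup>2"
proof -
  have "(norm (f x + g x))\<^sup>2 = (norm (f x))\<^sup>2 + 2 * (f x \<bullet> g x) + (norm (g x))\<^sup>2" for x
    by (simp add: power2_norm_eq_inner inner_simps inner_commute)
  then show ?thesis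
    using assms L2_inner_integrable[OF assms] by (simp add: norm2_sq L2_def)
qed

lemma norm2_sq_sub:
  assumes "f \<in> L2 M" "g \<in> L2 M"
  shows "(norm2 M (\<lambda>x. f x - t *\<^sub>R g x))\<^sup>2
    = (norm2 M f)\<^sup>2 - 2 * t * (LINT x|M. f x \<bullet> g x) + t\<^sup>2 * (norm2 M g)\<^sup>2"
  using norm2_sq_add[OF assms(1) L2_scaleR[OF assms(2), of "-t"]]
  by (simp add: norm2_uminus norm2_scaleR power_mult_distrib)

text \<open>This gives the Cauchy-Schwarz inequality, and, with \<open>c = 0\<close>, the first-order condition at a minimum of
the distance to a subspace.\<close>

lemma nonneg_quadratic_discriminant:
  fixes a B c :: real
  assumes *: "\<And>t. 2 * t * a \<le> c + t\<^sup>2 * B" and "0 \<le> B"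
  shows "a\<^sup>2 \<le> c * B"
proof (cases "B = 0")
  case True
  have "a = 0"
  proof (rule ccontr)
    assume "a \<noteq> 0"
    then show False using *[of "(c + 1) / (2 * a)"] True by simp
  qed
  then show ?thesis using True by simp
next
  case False
  then have B: "B > 0" using assms(2) by simp
  have "(a / B)\<^sup>2 * B = a\<^sup>2 / B" "2 * (a / B) * a = 2 * (a\<^sup>2 / B)"
    using B by (auto simp: field_simps power2_eq_square)
  then have "a\<^sup>2 / B \<le> c" using *[of "a / B"] by linarith
  then show ?thesis using B by (simp add: field_simps)
qed

lemma L2_Cauchy_Schwarz:
  assumes "f \<in> L2 M" "g \<in> L2 M"
  shows "\<bar>\<integral>x. f x \<bullet> g x \<partial>M\<bar> \<le> norm2 M f * norm2 M g"
proof -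
  let ?a = "\<integral>x. f x \<bullet> g x \<partial>M"
  have "2 * t * ?a \<le> (norm2 M f)\<^sup>2 + t\<^sup>2 * (norm2 M g)\<^sup>2" for t
    using norm2_sq_sub[OF assms, of t] zero_le_power2[of "norm2 M (\<lambda>x. f x - t *\<^sub>R g x)"] by linarith
  then have "?a\<^sup>2 \<le> (norm2 M f)\<^sup>2 * (norm2 M g)\<^sup>2" by (rule nonneg_quadratic_discriminant) simp
  then have "?a\<^sup>2 \<le> (norm2 M f * norm2 M g)\<^sup>2" by (simp add: power_mult_distrib)
  then show ?thesis by (metis abs_le_square_iff abs_of_nonneg mult_nonneg_nonneg norm2_nonneg)
qed

lemma norm2_triangle:
  assumes "f \<in> L2 M" "g \<in> L2 M"
  shows "norm2 M (\<lambda>x. f x + g x) \<le> norm2 M f + norm2 M g"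
proof -
  have "(norm2 M (\<lambda>x. f x + g x))\<^sup>2 \<le> (norm2 M f + norm2 M g)\<^sup>2"
    using norm2_sq_add[OF assms] L2_Cauchy_Schwarz[OF assms] by (simp add: power2_sum)
  then show ?thesis by (rule power2_le_imp_le) simp
qed

lemma norm2_diff_triangle:
  assumes "f \<in> L2 M" "g \<in> L2 M" "h \<in> L2 M"
  shows "norm2 M (\<lambda>x. f x - h x) \<le> norm2 M (\<lambda>x. f x - g x) + norm2 M (\<lambda>x. g x - h x)"
  using norm2_triangle[OF L2_diff[OF assms(1,2)] L2_diff[OF assms(2,3)]] by simp

lemma norm2_eq_0_AE:
  assumes "f \<in> L2 M" "norm2 M f = 0" shows "AE x in M. f x = 0"
proof -
  have "(LINT x|M. (norm (f x))\<^sup>2) = 0" using assms(2) norm2_sq[of M f] by simp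
  then have "AE x in M. (norm (f x))\<^sup>2 = 0"
    using assms(1) by (subst (asm) integral_nonneg_eq_0_iff_AE) (auto simp: L2_def)
  then show ?thesis by simp
qed

lemma norm2_cong_AE:
  assumes "AE x in M. f x = g x" "f \<in> borel_measurable M" "g \<in> borel_measurable M"
  shows "norm2 M f = norm2 M g"
proof -
  have "(LINT x|M. (norm (f x))\<^sup>2) = (LINT x|M. (norm (g x))\<^sup>2)"
    using assms by (intro integral_cong_AE) auto
  then show ?thesis by (simp add: norm2_def)
qed

text \<open>Nonnegative integrals need no integrability, so estimates are derived for them first; they then give
membership and the norm bound at once.\<close>

lemma L2_nn_bound:
  assumes [measurable]: "f \<in> borel_measurable M" and "(\<integral>\<^sup>+x. ennreal ((norm (f x))\<^sup>2) \<partial>M) \<le> ennreal (c\<^sup>2)" "0 \<le> c"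
  shows "f \<in> L2 M" "norm2 M f \<le> c"
proof -
  show L: "f \<in> L2 M"
    unfolding L2_def using assms le_less_trans[OF assms(2), of \<infinity>]
    by (auto simp: integrable_iff_bounded)
  have "ennreal ((norm2 M f)\<^sup>2) = (\<integral>\<^sup>+x. ennreal ((norm (f x))\<^sup>2) \<partial>M)"
    using L by (simp add: norm2_sq L2_def nn_integral_eq_integral)
  then have "ennreal ((norm2 M f)\<^sup>2) \<le> ennreal (c\<^sup>2)" using assms(2) by simp
  then have "(norm2 M f)\<^sup>2 \<le> c\<^sup>2" by (subst (asm) ennreal_le_iff) auto
  then show "norm2 M f \<le> c" using assms(3) by (rule power2_le_imp_le)
qed

lemma norm2_nn:
  assumes "f \<in> L2 M"
  shows "(\<integral>\<^sup>+x. ennreal ((norm (f x))\<^sup>2) \<partial>M) = ennreal ((norm2 M f)\<^sup>2)"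
  using assms by (simp add: norm2_sq L2_def nn_integral_eq_integral)

lemma L2_integrable_norm:
  assumes "finite_measure M" "f \<in> L2 M"
  shows "integrable M (\<lambda>x. norm (f x))" "integrable M f"
    "(LINT x|M. norm (f x)) \<le> sqrt (measure M (space M)) * norm2 M f"
proof -
  have n: "(\<lambda>x. norm (f x)) \<in> L2 M" using assms(2) by (auto simp: L2_def)
  have one: "(\<lambda>x. 1::real) \<in> L2 M" using L2_const[OF assms(1)] .
  show i: "integrable M (\<lambda>x. norm (f x))" using L2_inner_integrable[OF one n] by simp
  then show "integrable M f" using assms(2) by (auto simp: L2_def integrable_norm_iff)
  have "norm2 M (\<lambda>x. norm (f x)) = norm2 M f" by (simp add: norm2_def)
  then show "(LINT x|M. norm (f x)) \<le> sqrt (measure M (space M)) * norm2 M f"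
    using L2_Cauchy_Schwarz[OF one n] by (simp add: norm2_def)
qed

text \<open>The Riesz-Fischer theorem. Along a subsequence whose increments have norm at most \<open>2\<^sup>-\<^sup>k\<close>, the increments are
absolutely summable almost everywhere, and Fatou's lemma turns the pointwise limit into a limit in norm.
The limit is given as a pointwise \<open>lim\<close> so that it inherits invariance properties that hold at every point.\<close>

lemma L2_complete:
  fixes f :: "nat \<Rightarrow> 'a \<Rightarrow> 'b::euclidean_space"
  assumes M: "finite_measure M" and f: "\<And>n. f n \<in> L2 M"
    and C: "\<And>e. e > 0 \<Longrightarrow> \<exists>N. \<forall>m\<ge>N. \<forall>n\<ge>N. norm2 M (\<lambda>x. f m x - f n x) < e"
  obtains r F where "strict_mono r" "F \<in> L2 M" "F = (\<lambda>x. lim (\<lambda>k. f (r k) x))"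
    "(\<lambda>n. norm2 M (\<lambda>x. f n x - F x)) \<longlonglongrightarrow> 0"
proof -
  have [measurable]: "f n \<in> borel_measurable M" for n using f by (auto simp: L2_def)
  have "\<exists>N. \<forall>m\<ge>N. \<forall>n\<ge>N. norm2 M (\<lambda>x. f m x - f n x) < (1/2)^k" for k :: nat by (rule C) simp
  then obtain N where N: "\<And>k m n. m \<ge> N k \<Longrightarrow> n \<ge> N k \<Longrightarrow> norm2 M (\<lambda>x. f m x - f n x) < (1/2)^k" by metis
  define r where "r k = (\<Sum>i\<le>k. N i + 1)" for k
  have r: "strict_mono r" unfolding strict_mono_Suc_iff by (simp add: r_def)
  have rN: "r k \<ge> N k" for k unfolding r_def by (cases k) auto
  have step: "norm2 M (\<lambda>x. f (r (Suc k)) x - f (r k) x) < (1/2)^k" for k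
    by (rule N) (use rN[of k] strict_mono_leD[OF r, of k "Suc k"] in auto)
  let ?d = "\<lambda>k x. f (r (Suc k)) x - f (r k) x"
  have dL: "?d k \<in> L2 M" for k using f by (intro L2_diff)
  define c where "c = sqrt (measure M (space M))"
  have "(\<integral>\<^sup>+x. ennreal (norm (?d k x)) \<partial>M) \<le> ennreal (c * (1/2)^k)" for k
  proof -
    have "(\<integral>\<^sup>+x. ennreal (norm (?d k x)) \<partial>M) = ennreal (LINT x|M. norm (?d k x))"
      using L2_integrable_norm(1)[OF M dL] by (intro nn_integral_eq_integral) auto
    also have "(LINT x|M. norm (?d k x)) \<le> c * norm2 M (?d k)"
      unfolding c_def by (rule L2_integrable_norm[OF M dL])
    also have "\<dots> \<le> c * (1/2)^k" using step[of k] by (intro mult_left_mono) (auto simp: c_def)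
    finally show ?thesis by (simp add: ennreal_leI)
  qed
  then have "(\<Sum>k. \<integral>\<^sup>+x. ennreal (norm (?d k x)) \<partial>M) \<le> (\<Sum>k. ennreal (c * (1/2)^k))"
    by (intro suminf_le) auto
  also have "\<dots> = ennreal (\<Sum>k. c * (1/2)^k)"
    by (intro suminf_ennreal2) (auto intro!: summable_mult simp: c_def)
  finally have "(\<integral>\<^sup>+x. (\<Sum>k. ennreal (norm (?d k x))) \<partial>M) < \<infinity>"
    by (subst nn_integral_suminf) (auto intro: le_less_trans)
  then have "AE x in M. (\<Sum>k. ennreal (norm (?d k x))) \<noteq> \<infinity>"
    by (intro nn_integral_noteq_infinite) auto
  then have conv: "AE x in M. convergent (\<lambda>k. f (r k) x)"
  proof eventually_elim
    case (elim x)
    then have "summable (\<lambda>k. norm (?d k x))" by (intro summable_suminf_not_top) auto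
    then have "summable (\<lambda>k. ?d k x)" by (rule summable_norm_cancel)
    then have "convergent (\<lambda>n. \<Sum>k<n. ?d k x)" by (simp add: summable_iff_convergent)
    then have "convergent (\<lambda>n. f (r n) x - f (r 0) x)" using sum_lessThan_telescope[of "\<lambda>k. f (r k) x"] by simp
    then have "convergent (\<lambda>n. (f (r n) x - f (r 0) x) + f (r 0) x)"
      by (intro convergent_add convergent_const)
    then show ?case by simp
  qed
  define F where "F = (\<lambda>x. lim (\<lambda>k. f (r k) x))"
  have Fm [measurable]: "F \<in> borel_measurable M"
    unfolding F_def by (rule borel_measurable_lim_metric) simp
  have lim: "AE x in M. (\<lambda>k. f (r k) x) \<longlonglongrightarrow> F x"
    using conv by eventually_elim (simp add: F_def convergent_LIMSEQ_iff)
  have key: "(\<integral>\<^sup>+x. ennreal ((norm (f m x - F x))\<^sup>2) \<partial>M) \<le> ennreal (((1/2)^k)\<^sup>2)" if "m \<ge> N k" for m k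
  proof -
    have "(\<integral>\<^sup>+x. ennreal ((norm (f m x - F x))\<^sup>2) \<partial>M)
        = (\<integral>\<^sup>+x. liminf (\<lambda>j. ennreal ((norm (f m x - f (r j) x))\<^sup>2)) \<partial>M)"
    proof (rule nn_integral_cong_AE, use lim in eventually_elim)
      case (elim x)
      have "(\<lambda>j. ennreal ((norm (f m x - f (r j) x))\<^sup>2)) \<longlonglongrightarrow> ennreal ((norm (f m x - F x))\<^sup>2)"
        by (intro tendsto_intros elim)
      then show ?case by (intro lim_imp_Liminf[symmetric]) auto
    qed
    also have "\<dots> \<le> liminf (\<lambda>j. \<integral>\<^sup>+x. ennreal ((norm (f m x - f (r j) x))\<^sup>2) \<partial>M)"
      by (intro nn_integral_liminf) simp
    also have "\<dots> \<le> ennreal (((1/2)^k)\<^sup>2)"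
    proof (rule Liminf_le)
      show "\<forall>\<^sub>F j in sequentially. (\<integral>\<^sup>+x. ennreal ((norm (f m x - f (r j) x))\<^sup>2) \<partial>M) \<le> ennreal (((1/2)^k)\<^sup>2)"
        unfolding eventually_sequentially
      proof (intro exI allI impI)
        fix j assume "k \<le> j"
        then have "r j \<ge> N k" using rN[of k] strict_mono_leD[OF r, of k j] by simp
        then have "norm2 M (\<lambda>x. f m x - f (r j) x) < (1/2)^k" using N that by blast
        then have "(norm2 M (\<lambda>x. f m x - f (r j) x))\<^sup>2 \<le> ((1/2)^k)\<^sup>2" by (intro power_mono) auto
        then show "(\<integral>\<^sup>+x. ennreal ((norm (f m x - f (r j) x))\<^sup>2) \<partial>M) \<le> ennreal (((1/2)^k)\<^sup>2)"
          using f by (subst norm2_nn) (auto intro!: L2_diff ennreal_leI)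
      qed
    qed auto
    finally show ?thesis .
  qed
  have b: "(\<lambda>x. f m x - F x) \<in> L2 M" "norm2 M (\<lambda>x. f m x - F x) \<le> (1/2)^k" if "m \<ge> N k" for m k
    using L2_nn_bound[OF _ key[OF that]] by auto
  have "F \<in> L2 M"
    using L2_diff[OF f[of "N 0"] b(1)[of 0 "N 0"]] by simp
  moreover have "(\<lambda>n. norm2 M (\<lambda>x. f n x - F x)) \<longlonglongrightarrow> 0"
  proof (rule LIMSEQ_I)
    fix e :: real assume "e > 0"
    then obtain k where k: "(1/2::real)^k < e" using real_arch_pow_inv[of e "1/2"] by auto
    have "norm (norm2 M (\<lambda>x. f n x - F x) - 0) < e" if "n \<ge> N k" for n
      using b(2)[OF that] k by simp
    then show "\<exists>no. \<forall>n\<ge>no. norm (norm2 M (\<lambda>x. f n x - F x) - 0) < e" by blast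
  qed
  ultimately show ?thesis using that r F_def by blast
qed

lemma norm2_tendsto_contraction:
  assumes T: "bounded_linear T" "\<And>y. norm (T y) \<le> norm y"
    and f: "\<And>n. f n \<in> L2 M" "F \<in> L2 M"
    and lim: "(\<lambda>n. norm2 M (\<lambda>x. f n x - F x)) \<longlonglongrightarrow> 0"
  shows "(\<lambda>n. norm2 M (\<lambda>x. T (f n x) - T (F x))) \<longlonglongrightarrow> 0"
proof (rule Lim_null_comparison[OF always_eventually lim], rule allI)
  fix n
  have "(\<lambda>x. T (f n x - F x)) \<in> L2 M" by (rule L2_bounded_linear[OF T(1) L2_diff[OF f]])
  from norm2_dominated[OF L2_measurable[OF this] L2_diff[OF f] T(2)]
  show "norm (norm2 M (\<lambda>x. T (f n x) - T (F x))) \<le> norm2 M (\<lambda>x. f n x - F x)"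
    by (simp add: linear_diff[OF bounded_linear.linear[OF T(1)]])
qed

text \<open>A minimizing sequence for the distance from \<open>e\<close> to \<open>W\<close> is a Cauchy sequence by the parallelogram law, and
the residual at the minimum is orthogonal to \<open>W\<close> because the distance cannot decrease to first order.\<close>

lemma L2_projection:
  fixes e :: "'a \<Rightarrow> 'b::euclidean_space"
  assumes e: "e \<in> L2 M" and W: "W \<subseteq> L2 M" and zero: "(\<lambda>x. 0) \<in> W"
    and comb: "\<And>u w a b. u \<in> W \<Longrightarrow> w \<in> W \<Longrightarrow> (\<lambda>x. a *\<^sub>R u x + b *\<^sub>R w x) \<in> W"
    and complete: "\<And>p. (\<And>n. p n \<in> W) \<Longrightarrow>
       (\<And>\<epsilon>. \<epsilon> > 0 \<Longrightarrow> \<exists>N. \<forall>m\<ge>N. \<forall>n\<ge>N. norm2 M (\<lambda>x. p m x - p n x) < \<epsilon>) \<Longrightarrow>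
       \<exists>q\<in>W. (\<lambda>n. norm2 M (\<lambda>x. p n x - q x)) \<longlonglongrightarrow> 0"
  obtains p where "p \<in> W" "\<And>w. w \<in> W \<Longrightarrow> (LINT x|M. (e x - p x) \<bullet> w x) = 0"
proof -
  define D where "D w = (norm2 M (\<lambda>x. e x - w x))\<^sup>2" for w
  define d where "d = Inf (D ` W)"
  have bdd: "bdd_below (D ` W)" by (rule bdd_belowI[of _ 0]) (auto simp: D_def)
  have dle: "d \<le> D w" if "w \<in> W" for w
    unfolding d_def using bdd that by (auto intro: cInf_lower)
  have "\<exists>w\<in>W. D w < d + 1 / Suc n" for n
    using cInf_lessD[of "D ` W" "d + 1 / Suc n"] zero by (auto simp: d_def)
  then obtain p where pW: "\<And>n. p n \<in> W" and pD: "\<And>n. D (p n) < d + 1 / Suc n" by metis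
  have pL: "p n \<in> L2 M" for n using pW W by auto
  have par: "(norm2 M (\<lambda>x. p m x - p n x))\<^sup>2 \<le> 2 * (1 / Suc m + 1 / Suc n)" for m n
  proof -
    let ?q = "\<lambda>x. (1/2) *\<^sub>R p m x + (1/2) *\<^sub>R p n x"
    have q: "?q \<in> W" using pW by (intro comb)
    have qL: "?q \<in> L2 M" using q W by auto
    have pt: "(norm (p m x - p n x))\<^sup>2 =
       2 * (norm (e x - p m x))\<^sup>2 + 2 * (norm (e x - p n x))\<^sup>2 - 4 * (norm (e x - ?q x))\<^sup>2" for x
      by (simp add: power2_norm_eq_inner inner_simps inner_commute algebra_simps)
    have "(norm2 M (\<lambda>x. p m x - p n x))\<^sup>2 = 2 * D (p m) + 2 * D (p n) - 4 * D ?q"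
      unfolding norm2_sq D_def pt
      using L2_integrable[OF L2_diff[OF e pL]] L2_integrable[OF L2_diff[OF e qL]] by simp
    then show ?thesis using dle[OF q] pD[of m] pD[of n] by simp
  qed
  have "\<exists>N. \<forall>m\<ge>N. \<forall>n\<ge>N. norm2 M (\<lambda>x. p m x - p n x) < \<epsilon>" if "\<epsilon> > 0" for \<epsilon>
  proof -
    obtain N where N: "1 / Suc N < \<epsilon>\<^sup>2 / 4"
      using nat_approx_posE[of "\<epsilon>\<^sup>2 / 4"] \<open>\<epsilon> > 0\<close> by auto
    have "norm2 M (\<lambda>x. p m x - p n x) < \<epsilon>" if "m \<ge> N" "n \<ge> N" for m n
    proof -
      have "1 / Suc m \<le> 1 / Suc N" "1 / Suc n \<le> 1 / Suc N" using that by (auto simp: field_simps)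
      then have "(norm2 M (\<lambda>x. p m x - p n x))\<^sup>2 < \<epsilon>\<^sup>2" using par[of m n] N by simp
      then show ?thesis using \<open>\<epsilon> > 0\<close> by (simp add: power2_less_imp_less)
    qed
    then show ?thesis by blast
  qed
  then obtain q where q: "q \<in> W" and lim: "(\<lambda>n. norm2 M (\<lambda>x. p n x - q x)) \<longlonglongrightarrow> 0"
    using complete[of p, OF pW] by metis
  have qL: "q \<in> L2 M" using q W by auto
  have "(LINT x|M. (e x - q x) \<bullet> w x) = 0" if w: "w \<in> W" for w
  proof -
    let ?a = "\<integral>x. (e x - q x) \<bullet> w x \<partial>M" and ?B = "(norm2 M w)\<^sup>2"
    have wL: "w \<in> L2 M" using w W by auto
    have qd: "sqrt (D q) \<le> sqrt (d + 1 / Suc n) + norm2 M (\<lambda>x. p n x - q x)" for n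
    proof -
      have "sqrt (D q) \<le> sqrt (D (p n)) + norm2 M (\<lambda>x. p n x - q x)"
        using norm2_diff_triangle[OF e pL[of n] qL] by (simp add: D_def)
      then show ?thesis using real_sqrt_less_mono[OF pD[of n]] by linarith
    qed
    have "(\<lambda>n. 1 / real (Suc n)) \<longlonglongrightarrow> 0" using LIMSEQ_inverse_real_of_nat by (simp add: inverse_eq_divide)
    then have "(\<lambda>n. sqrt (d + 1 / Suc n) + norm2 M (\<lambda>x. p n x - q x)) \<longlonglongrightarrow> sqrt (d + 0) + 0"
      by (intro tendsto_add tendsto_real_sqrt tendsto_const lim)
    then have "sqrt (D q) \<le> sqrt d" using LIMSEQ_le_const[of _ "sqrt d" "sqrt (D q)"] qd by auto
    then have Dq: "D q \<le> d" by simp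
    have *: "2 * t * ?a \<le> t\<^sup>2 * ?B" for t
    proof -
      have "(\<lambda>x. 1 *\<^sub>R q x + t *\<^sub>R w x) \<in> W" by (intro comb q w)
      then have "d \<le> D (\<lambda>x. 1 *\<^sub>R q x + t *\<^sub>R w x)" by (rule dle)
      also have "\<dots> = (norm2 M (\<lambda>x. (e x - q x) - t *\<^sub>R w x))\<^sup>2"
        unfolding D_def by (simp add: diff_diff_eq)
      also have "\<dots> = D q - 2 * t * ?a + t\<^sup>2 * ?B"
        unfolding D_def by (rule norm2_sq_sub[OF L2_diff[OF e qL] wL])
      finally show ?thesis using Dq by simp
    qed
    have "?a\<^sup>2 \<le> 0 * ?B" by (rule nonneg_quadratic_discriminant) (use * in auto)
    then show "?a = 0" by simp
  qed
  then show ?thesis using that q by blast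
qed

section \<open>Smooth test functions\<close>

lemma partial_eq:
  assumes "(f has_derivative f') (at x)" shows "partial j f x = f' (axis j 1)"
  using frechet_derivative_at[OF assms] by (simp add: partial_def)

lemma Ck_lower: "Ck (Suc k) f \<Longrightarrow> Ck k f"
proof (induction k arbitrary: f)
  case 0
  then show ?case
    by (auto intro!: differentiable_imp_continuous_on simp: differentiable_on_def differentiable_at_withinI)
next
  case (Suc k)
  then show ?case by (metis Ck.simps(2))
qed

lemma Ck_const: "Ck k (\<lambda>x. c)"
proof (induction k arbitrary: c)
  case (Suc k)
  have "partial j (\<lambda>x. c) = (\<lambda>x. 0)" for j
    using partial_eq[OF has_derivative_const] by (intro ext)
  then show ?case using Suc by simp
qed simp

lemma Ck_add: "Ck k f \<Longrightarrow> Ck k h \<Longrightarrow> Ck k (\<lambda>x. f x + h x)"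
proof (induction k arbitrary: f h)
  case (Suc k)
  then have d: "(f has_derivative frechet_derivative f (at x)) (at x)"
    "(h has_derivative frechet_derivative h (at x)) (at x)" for x
    by (simp_all add: frechet_derivative_works[symmetric])
  have "partial j (\<lambda>x. f x + h x) = (\<lambda>x. partial j f x + partial j h x)" for j
    using partial_eq[OF has_derivative_add[OF d]] by (simp add: partial_def fun_eq_iff)
  then show ?case using Suc by auto
qed (auto intro: continuous_on_add)

lemma Ck_mult: "Ck k f \<Longrightarrow> Ck k h \<Longrightarrow> Ck k (\<lambda>x. f x * h x)"
proof (induction k arbitrary: f h)
  case (Suc k)
  then have d: "(f has_derivative frechet_derivative f (at x)) (at x)"
    "(h has_derivative frechet_derivative h (at x)) (at x)" for x
    by (simp_all add: frechet_derivative_works[symmetric])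
  have eq: "partial j (\<lambda>x. f x * h x) = (\<lambda>x. f x * partial j h x + partial j f x * h x)" for j
    using partial_eq[OF has_derivative_mult[OF d]] by (simp add: partial_def fun_eq_iff)
  have "Ck k f" "Ck k h" using Suc.prems by (blast intro: Ck_lower)+
  then have "Ck k (partial j (\<lambda>x. f x * h x))" for j
    unfolding eq using Suc.prems by (intro Ck_add Suc.IH) auto
  moreover have "(\<lambda>x. f x * h x) differentiable (at x)" for x
    using Suc.prems by (intro differentiable_mult) auto
  ultimately show ?case by simp
qed (auto intro: continuous_on_mult)

lemma Ck_prod: "finite I \<Longrightarrow> (\<And>i. i \<in> I \<Longrightarrow> Ck k (f i)) \<Longrightarrow> Ck k (\<lambda>x. \<Prod>i\<in>I. f i x)"
  by (induction I rule: finite_induct) (auto intro: Ck_const Ck_mult)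

lemma partial_translate:
  assumes "f differentiable (at (x + z))"
  shows "partial j (\<lambda>x. f (x + z)) x = partial j f (x + z)"
proof -
  have "(f has_derivative frechet_derivative f (at (x + z))) (at (x + z))"
    using assms by (simp add: frechet_derivative_works[symmetric])
  moreover have "((\<lambda>x. x + z) has_derivative (\<lambda>x. x)) (at x)"
    by (auto intro!: derivative_eq_intros)
  ultimately have "((\<lambda>x. f (x + z)) has_derivative frechet_derivative f (at (x + z))) (at x)"
    using has_derivative_compose[of "\<lambda>x. x + z" "\<lambda>x. x" x UNIV f] by auto
  from partial_eq[OF this] show ?thesis by (simp add: partial_def)
qed

lemma Ck_translate: "Ck k f \<Longrightarrow> Ck k (\<lambda>x. f (x + z))"
proof (induction k arbitrary: f)
  case 0
  then show ?case by (auto intro!: continuous_on_compose2[of UNIV f] continuous_intros)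
next
  case (Suc k)
  have "partial j (\<lambda>x. f (x + z)) = (\<lambda>x. partial j f (x + z))" for j
    using Suc.prems by (auto intro!: ext partial_translate)
  moreover have "(\<lambda>x. f (x + z)) differentiable (at x)" for x
    using Suc.prems by (intro differentiable_compose[of f "\<lambda>x. x + z"] derivative_intros) auto
  ultimately show ?case using Suc by auto
qed

lemma test_function_translate:
  assumes "\<phi> \<in> test_functions" shows "(\<lambda>x. \<phi> (x + z)) \<in> test_functions"
proof -
  have "{x. \<phi> (x + z) \<noteq> 0} = (\<lambda>x. x - z) ` {x. \<phi> x \<noteq> 0}" by (force simp: image_iff)
  then have "closure {x. \<phi> (x + z) \<noteq> 0} = (\<lambda>x. x - z) ` closure {x. \<phi> x \<noteq> 0}"
    using closure_translation[of "-z" "{x. \<phi> x \<noteq> 0}"] by simp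
  moreover have "compact ((\<lambda>x. x - z) ` closure {x. \<phi> x \<noteq> 0})"
    using assms by (intro compact_continuous_image continuous_intros) (auto simp: test_functions_def)
  ultimately show ?thesis using assms by (simp add: test_functions_def Ck_translate del: compact_closure)
qed

lemma test_function_has_derivative:
  assumes "\<phi> \<in> test_functions"
  shows "(\<phi> has_derivative (\<lambda>y. \<Sum>j\<in>UNIV. y $ j * partial j \<phi> x)) (at x)"
proof -
  have "Ck 1 \<phi>" using assms by (auto simp: test_functions_def)
  then have d: "(\<phi> has_derivative frechet_derivative \<phi> (at x)) (at x)"
    by (simp add: frechet_derivative_works[symmetric])
  then have l: "linear (frechet_derivative \<phi> (at x))" by (rule has_derivative_linear)
  have "frechet_derivative \<phi> (at x) y = (\<Sum>j\<in>UNIV. y $ j * partial j \<phi> x)" for y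
  proof -
    have "y = (\<Sum>j\<in>UNIV. y $ j *\<^sub>R axis j 1)" using basis_expansion[of y] by (simp add: scalar_mult_eq_scaleR)
    then have "frechet_derivative \<phi> (at x) y = frechet_derivative \<phi> (at x) (\<Sum>j\<in>UNIV. y $ j *\<^sub>R axis j 1)" by simp
    then show ?thesis using l by (simp add: linear_sum linear_scale partial_def)
  qed
  then have "frechet_derivative \<phi> (at x) = (\<lambda>y. \<Sum>j\<in>UNIV. y $ j * partial j \<phi> x)" by (rule ext)
  then show ?thesis using d by simp
qed

lemma test_function_continuous:
  assumes "\<phi> \<in> test_functions"
  shows "continuous_on UNIV \<phi>" "continuous_on UNIV (partial j \<phi>)"
proof -
  have "Ck 0 \<phi>" "Ck 1 \<phi>" using assms by (auto simp: test_functions_def)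
  then show "continuous_on UNIV \<phi>" "continuous_on UNIV (partial j \<phi>)" by simp_all
qed

lemma test_function_borel:
  assumes "\<phi> \<in> test_functions"
  shows "\<phi> \<in> borel_measurable borel" "partial j \<phi> \<in> borel_measurable borel"
  using test_function_continuous[OF assms] by (auto intro: borel_measurable_continuous_onI)

lemma test_function_bounds:
  assumes \<phi>: "\<phi> \<in> test_functions"
  shows "\<exists>R C. C > 0 \<and> (\<forall>x. \<bar>\<phi> x\<bar> \<le> C * indicator (cball 0 R) x) \<and>
    (\<forall>j x. \<bar>partial j \<phi> x\<bar> \<le> C * indicator (cball 0 R) x)"
proof -
  note c = test_function_continuous(1)[OF \<phi>] and cp = test_function_continuous(2)[OF \<phi>]
  have K: "compact (closure {x. \<phi> x \<noteq> 0})" using \<phi> by (auto simp: test_functions_def)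
  obtain R0 where R0: "\<And>x. x \<in> closure {x. \<phi> x \<noteq> 0} \<Longrightarrow> norm x \<le> R0"
    using compact_imp_bounded[OF K] by (auto simp: bounded_iff)
  define R where "R = max R0 1"
  have R: "x \<notin> cball 0 R \<Longrightarrow> x \<notin> closure {x. \<phi> x \<noteq> 0}" for x using R0[of x] by (auto simp: R_def)
  have z: "\<phi> x = 0" if "x \<notin> cball 0 R" for x
    using R[OF that] closure_subset[of "{x. \<phi> x \<noteq> 0}"] by auto
  have zp: "partial j \<phi> x = 0" if "x \<notin> cball 0 R" for j x
  proof -
    \<comment> \<open>Outside the closed support the function vanishes on a neighbourhood, so its derivative vanishes too.\<close>
    have o: "open (- closure {x. \<phi> x \<noteq> 0})" by auto
    have "(\<phi> has_derivative (\<lambda>_. 0)) (at x)"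
    proof (rule has_derivative_transform_within_open[OF _ o])
      show "((\<lambda>_. 0) has_derivative (\<lambda>_. 0)) (at x)" by simp
      show "x \<in> - closure {x. \<phi> x \<noteq> 0}" using R[OF that] by simp
      show "0 = \<phi> y" if "y \<in> - closure {x. \<phi> x \<noteq> 0}" for y
        using that closure_subset[of "{x. \<phi> x \<noteq> 0}"] by auto
    qed
    from partial_eq[OF this] show ?thesis by simp
  qed
  have "compact (\<phi> ` cball 0 R)" by (intro compact_continuous_image continuous_on_subset[OF c]) auto
  then have "\<exists>A. \<forall>x \<in> cball 0 R. \<bar>\<phi> x\<bar> \<le> A"
    by (auto dest!: compact_imp_bounded simp: bounded_iff)
  then obtain A where A: "\<And>x. x \<in> cball 0 R \<Longrightarrow> \<bar>\<phi> x\<bar> \<le> A" by metis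
  have cpj: "compact (partial j \<phi> ` cball 0 R)" for j
    by (intro compact_continuous_image continuous_on_subset[OF cp]) auto
  have "\<exists>B. \<forall>x \<in> cball 0 R. \<bar>partial j \<phi> x\<bar> \<le> B" for j
    using compact_imp_bounded[OF cpj[of j]] by (auto simp: bounded_iff)
  then obtain B where B: "\<And>j x. x \<in> cball 0 R \<Longrightarrow> \<bar>partial j \<phi> x\<bar> \<le> B j" by metis
  define C where "C = \<bar>A\<bar> + (\<Sum>j\<in>UNIV. \<bar>B j\<bar>) + 1"
  have BC: "B j \<le> C" for j
    using member_le_sum[of j UNIV "\<lambda>j. \<bar>B j\<bar>"] by (simp add: C_def)
  have AC: "A \<le> C" unfolding C_def by (simp add: add_increasing2 sum_nonneg)
  have "C > 0" unfolding C_def by (smt (verit) sum_nonneg abs_ge_zero)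
  moreover have "\<bar>\<phi> x\<bar> \<le> C * indicator (cball 0 R) x" for x
    using A[of x] z[of x] AC by (auto simp: indicator_def)
  moreover have "\<bar>partial j \<phi> x\<bar> \<le> C * indicator (cball 0 R) x" for j x
    using B[of x j] zp[of x j] BC[of j] by (auto simp: indicator_def)
  ultimately show ?thesis by blast
qed

text \<open>These functions, which are flat at \<open>0\<close>, form a class that is closed under differentiation, so each of
them is smooth.\<close>

definition flat_exp :: "real poly \<Rightarrow> real \<Rightarrow> real" where
  "flat_exp q t = (if t > 0 then poly q (1/t) * exp (- (1/t)) else 0)"

lemma poly_times_exp_tendsto_0: "((\<lambda>y. poly q y * exp (- y)) \<longlongrightarrow> (0::real)) at_top"
proof -
  have "((\<lambda>y. \<Sum>i\<le>degree q. coeff q i * (y ^ i / exp y)) \<longlongrightarrow> (\<Sum>i\<le>degree q. coeff q i * 0)) at_top"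
    by (intro tendsto_intros tendsto_power_div_exp_0)
  then show ?thesis
    by (simp add: poly_altdef exp_minus sum_distrib_right divide_inverse mult.assoc)
qed

text \<open>Only \<open>t = 0\<close> needs an argument: there the difference quotient from the right is \<open>y q(y) exp (- y)\<close> with
\<open>y = 1 / h\<close>, and the exponential wins.\<close>

lemma flat_exp_derivative:
  "(flat_exp q has_real_derivative flat_exp ((q - pderiv q) * [:0,0,1:]) t) (at t)"
proof -
  consider "t > 0" | "t < 0" | "t = 0" by linarith
  then show ?thesis
  proof cases
    case 1
    have "((\<lambda>t. poly q (1/t) * exp (- (1/t))) has_real_derivative
        flat_exp ((q - pderiv q) * [:0,0,1:]) t) (at t)"
      using 1 by (auto intro!: derivative_eq_intros simp: flat_exp_def field_simps power2_eq_square)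
    then show ?thesis
      by (rule has_field_derivative_transform_within_open[where S="{0<..}"]) (use 1 in \<open>auto simp: flat_exp_def\<close>)
  next
    case 2
    have "((\<lambda>t. 0) has_real_derivative flat_exp ((q - pderiv q) * [:0,0,1:]) t) (at t)"
      using 2 by (auto simp: flat_exp_def)
    then show ?thesis
      by (rule has_field_derivative_transform_within_open[where S="{..<0}"]) (use 2 in \<open>auto simp: flat_exp_def\<close>)
  next
    case 3
    have "((\<lambda>h. poly ([:0,1:] * q) (inverse h) * exp (- inverse h)) \<longlongrightarrow> 0) (at_right 0)"
      by (rule filterlim_compose[OF poly_times_exp_tendsto_0 filterlim_inverse_at_top_right])
    then have r: "((\<lambda>h. flat_exp q h / h) \<longlongrightarrow> 0) (at_right 0)"
      by (rule Lim_transform_eventually)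
        (auto simp: eventually_at_right_less flat_exp_def field_simps intro: eventually_mono[OF eventually_at_right_less])
    have l: "((\<lambda>h. flat_exp q h / h) \<longlongrightarrow> 0) (at_left 0)"
      by (rule Lim_transform_eventually[OF tendsto_const])
        (auto simp: flat_exp_def eventually_at_left_field intro: exI[of _ "-1"])
    show ?thesis
      using filterlim_split_at[OF l r] 3 by (simp add: has_field_derivative_iff flat_exp_def[of _ 0])
  qed
qed

lemma Ck_flat_exp: "Ck k (\<lambda>x. flat_exp q (c * x $ i + d))"
proof (induction k arbitrary: q)
  have D: "((\<lambda>x::real^3. flat_exp q (c * x $ i + d)) has_derivative
      (\<lambda>y. flat_exp ((q - pderiv q) * [:0,0,1:]) (c * x $ i + d) * (c * y $ i))) (at x)" for q x
  proof -
    have "((\<lambda>x::real^3. c * x $ i + d) has_derivative (\<lambda>y. c * y $ i)) (at x)"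
      by (auto intro!: derivative_eq_intros bounded_linear.has_derivative[OF bounded_linear_vec_nth])
    from has_derivative_compose[OF this flat_exp_derivative[unfolded has_field_derivative_def]]
    show ?thesis by simp
  qed
  {
    case 0
    show ?case
      unfolding Ck.simps by (rule has_derivative_continuous_on, rule has_derivative_at_withinI, rule D)
  next
    case (Suc k)
    have "partial j (\<lambda>x::real^3. flat_exp q (c * x $ i + d)) =
       (\<lambda>x. flat_exp ((q - pderiv q) * [:0,0,1:]) (c * x $ i + d) * (c * axis j 1 $ i))" for j
      using partial_eq[OF D] by (intro ext)
    then have "Ck k (partial j (\<lambda>x::real^3. flat_exp q (c * x $ i + d)))" for j
      by (simp only:) (intro Ck_mult Ck_const Suc)
    moreover have "(\<lambda>x::real^3. flat_exp q (c * x $ i + d)) differentiable (at x)" for x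
      unfolding differentiable_def using D by blast
    ultimately show ?case by simp
  }
qed

text \<open>For each \<open>t > 0\<close> the value \<open>exp (- 1 / (n t))\<close> tends to \<open>1\<close>, so these products increase to the indicator
function of the open box as \<open>n\<close> grows, without any normalization.\<close>

definition box_cutoff :: "real^3 \<Rightarrow> real^3 \<Rightarrow> nat \<Rightarrow> real^3 \<Rightarrow> real" where
  "box_cutoff a b n x = (\<Prod>i\<in>UNIV. flat_exp 1 (real n * (x $ i - a $ i)) * flat_exp 1 (real n * (b $ i - x $ i)))"

lemma flat_exp_1_bounds: "0 \<le> flat_exp 1 t" "flat_exp 1 t \<le> 1"
  by (auto simp: flat_exp_def)

lemma box_cutoff_outside:
  assumes "x \<notin> cbox a b" shows "box_cutoff a b n x = 0"
proof -
  obtain i where "x $ i - a $ i < 0 \<or> b $ i - x $ i < 0"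
    using assms by (auto simp: mem_box_cart not_le)
  then have "flat_exp 1 (real n * (x $ i - a $ i)) * flat_exp 1 (real n * (b $ i - x $ i)) = 0"
    by (auto simp: flat_exp_def zero_less_mult_iff)
  then show ?thesis unfolding box_cutoff_def by (intro prod_zero) auto
qed

lemma box_cutoff_test_function: "box_cutoff a b n \<in> test_functions"
proof -
  have e: "real n * (x $ i - a $ i) = real n * x $ i + - (real n * a $ i)"
    "real n * (b $ i - x $ i) = (- real n) * x $ i + real n * b $ i" for x i by (auto simp: algebra_simps)
  have "Ck k (box_cutoff a b n)" for k
    unfolding box_cutoff_def e by (intro Ck_prod Ck_mult Ck_flat_exp) simp
  moreover have "closure {x. box_cutoff a b n x \<noteq> 0} \<subseteq> cbox a b"
  proof (rule closure_minimal)
    show "{x. box_cutoff a b n x \<noteq> 0} \<subseteq> cbox a b"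
      using box_cutoff_outside by auto
  qed auto
  ultimately show ?thesis unfolding test_functions_def
    by (auto intro: compact_closure[THEN iffD2] bounded_subset[OF bounded_cbox]
        dest: order_trans[OF closure_subset])
qed

lemma box_cutoff_bounds: "0 \<le> box_cutoff a b n x" "box_cutoff a b n x \<le> indicator (cbox a b) x"
proof -
  show "0 \<le> box_cutoff a b n x" unfolding box_cutoff_def by (intro prod_nonneg mult_nonneg_nonneg flat_exp_1_bounds)
  have "box_cutoff a b n x \<le> 1" unfolding box_cutoff_def
    by (intro prod_le_1 conjI mult_nonneg_nonneg mult_le_one flat_exp_1_bounds)
  moreover have "box_cutoff a b n x = 0" if "x \<notin> cbox a b"
    using that by (rule box_cutoff_outside)
  ultimately show "box_cutoff a b n x \<le> indicator (cbox a b) x" by (cases "x \<in> cbox a b") auto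
qed

lemma box_cutoff_tendsto: "(\<lambda>n. box_cutoff a b n x) \<longlonglongrightarrow> indicator (box a b) x"
proof -
  have lim: "(\<lambda>n. flat_exp 1 (real n * t)) \<longlonglongrightarrow> (if t > 0 then 1 else 0)" for t
  proof (cases "t > 0")
    case True
    have "(\<lambda>n. exp (- (inverse (real n) * (1 / t)))) \<longlonglongrightarrow> exp (- (0 * (1/t)))"
      by (intro tendsto_intros lim_inverse_n)
    then have "(\<lambda>n. exp (- (inverse (real n) * (1 / t)))) \<longlonglongrightarrow> 1" by simp
    then have "(\<lambda>n. flat_exp 1 (real n * t)) \<longlonglongrightarrow> 1"
      by (rule Lim_transform_eventually)
        (use True in \<open>auto simp: flat_exp_def field_simps intro!: eventually_sequentiallyI[of 1]\<close>)
    then show ?thesis using True by simp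
  next
    case False
    then show ?thesis by (simp add: flat_exp_def zero_less_mult_iff)
  qed
  have "(\<lambda>n. box_cutoff a b n x) \<longlonglongrightarrow>
    (\<Prod>i\<in>UNIV. (if x $ i - a $ i > 0 then 1 else 0) * (if b $ i - x $ i > 0 then 1 else 0))"
    unfolding box_cutoff_def by (intro tendsto_intros lim)
  also have "(\<Prod>i\<in>UNIV. (if x $ i - a $ i > 0 then 1 else 0) * (if b $ i - x $ i > 0 then 1 else 0))
    = (indicator (box a b) x :: real)"
    by (auto simp: indicator_def mem_box_cart intro!: prod.neutral)
  finally show ?thesis .
qed

text \<open>The densities given by the positive and the negative part of \<open>f\<close> agree on open boxes, which are closed
under intersection and generate the Borel sets; hence they agree as measures, and so do the two parts.\<close>

lemma AE_zero_if_box_integrals_zero: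
  fixes f :: "real^3 \<Rightarrow> real"
  assumes [measurable]: "f \<in> borel_measurable borel"
    and int: "\<And>a b. integrable lborel (\<lambda>x. indicator (cbox a b) x * f x)"
    and 0: "\<And>a b. (LBINT x. indicator (box a b) x * f x) = 0"
  shows "AE x in lborel. f x = 0"
proof -
  have int': "integrable lborel (\<lambda>x. indicator (box a b) x * f x)" for a b
    using int[of a b] by (rule Bochner_Integration.integrable_bound)
      (auto simp: indicator_def dest: box_subset_cbox[THEN subsetD])
  let ?P = "\<lambda>a b. \<integral>\<^sup>+x. ennreal (indicator (box a b) x * f x) \<partial>lborel"
    and ?N = "\<lambda>a b. \<integral>\<^sup>+x. ennreal (- (indicator (box a b) x * f x)) \<partial>lborel"
  let ?p = "density lborel (\<lambda>x. ennreal (f x))" and ?n = "density lborel (\<lambda>x. ennreal (- f x))"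
  have e: "?P a b = ?N a b" and fin: "?P a b \<noteq> \<infinity>" for a b
  proof -
    have f: "?P a b \<noteq> \<infinity>" "?N a b \<noteq> \<infinity>"
      using int'[of a b] by (auto simp: real_integrable_def)
    then show "?P a b \<noteq> \<infinity>" by simp
    have "ennreal (enn2real (?P a b)) = ennreal (enn2real (?N a b))"
      using 0[of a b] real_lebesgue_integral_def[OF int'] by simp
    then show "?P a b = ?N a b"
      using f by (simp add: ennreal_enn2real_if)
  qed
  have em: "emeasure ?p (box a b) = ?P a b"
    "emeasure ?n (box a b) = ?N a b" for a b
    by (auto simp: emeasure_density intro!: nn_integral_cong split: split_indicator)
  have "?p = ?n"
  proof (rule measure_eqI_generator_eq)
    let ?E = "range (\<lambda>(a, b). box a b::(real^3) set)"
    show "Int_stable ?E" by (auto simp: Int_stable_def box_Int_box)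
    show "?E \<subseteq> Pow UNIV" "sets ?p = sigma_sets UNIV ?E" "sets ?n = sigma_sets UNIV ?E"
      by (simp_all add: borel_eq_box)
    let ?A = "\<lambda>n::nat. box (- (real n *\<^sub>R One)) (real n *\<^sub>R One) :: (real^3) set"
    show "range ?A \<subseteq> ?E" "(\<Union>i. ?A i) = UNIV"
      unfolding UN_box_eq_UNIV by auto
    show "emeasure ?p (?A i) \<noteq> \<infinity>" for i using fin em by simp
    show "emeasure ?p X = emeasure ?n X" if "X \<in> ?E" for X using that em e by auto
  qed
  then have "AE x in lborel. ennreal (f x) = ennreal (- f x)"
    by (intro sigma_finite_measure.density_unique[OF sigma_finite_lborel]) auto
  then show ?thesis
  proof eventually_elim
    case (elim x)
    then show ?case by (cases "f x \<ge> 0") (auto simp: ennreal_neg)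
  qed
qed

text \<open>Testing with the cutoffs of a box shows that the integral of \<open>f\<close> over each box vanishes.\<close>

lemma fundamental_lemma:
  fixes f :: "real^3 \<Rightarrow> real"
  assumes m [measurable]: "f \<in> borel_measurable borel"
    and int: "\<And>a b. integrable lborel (\<lambda>x. indicator (cbox a b) x * f x)"
    and 0: "\<And>\<phi>. \<phi> \<in> test_functions \<Longrightarrow> (LBINT x. f x * \<phi> x) = 0"
  shows "AE x in lborel. f x = 0"
proof (rule AE_zero_if_box_integrals_zero[OF m int])
  fix a b :: "real^3"
  have [measurable]: "box_cutoff a b n \<in> borel_measurable borel" for n
    by (rule test_function_borel(1)[OF box_cutoff_test_function])
  have "(\<lambda>n. \<integral>x. f x * box_cutoff a b n x \<partial>lborel) \<longlonglongrightarrow> (LBINT x. indicator (box a b) x * f x)"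
  proof (rule integral_dominated_convergence)
    show "integrable lborel (\<lambda>x. norm (indicator (cbox a b) x * f x))" using int by (intro integrable_norm)
    have "(\<lambda>n. f x * box_cutoff a b n x) \<longlonglongrightarrow> f x * indicator (box a b) x" for x
      by (intro tendsto_intros box_cutoff_tendsto)
    then show "AE x in lborel. (\<lambda>n. f x * box_cutoff a b n x) \<longlonglongrightarrow> indicator (box a b) x * f x"
      by (simp add: mult.commute)
    show "AE x in lborel. norm (f x * box_cutoff a b n x) \<le> norm (indicator (cbox a b) x * f x)" for n
      using box_cutoff_bounds[of a b n]
      by (auto simp: abs_mult mult.commute[of _ "\<bar>f _\<bar>"] intro!: mult_left_mono)
  qed auto
  then show "(LBINT x. indicator (box a b) x * f x) = 0"
    using 0[OF box_cutoff_test_function] by (simp add: LIMSEQ_const_iff)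
qed

section \<open>Periodic functions and the periodicity cell\<close>

lemma lborel_nn_integral_translate:
  fixes f :: "'a::euclidean_space \<Rightarrow> ennreal"
  assumes [measurable]: "f \<in> borel_measurable borel"
  shows "(\<integral>\<^sup>+x. f (x + z) \<partial>lborel) = (\<integral>\<^sup>+x. f x \<partial>lborel)"
proof -
  have "(\<integral>\<^sup>+x. f x \<partial>lborel) = (\<integral>\<^sup>+x. f x \<partial>distr lborel borel ((+) z))"
    by (simp add: lborel_distr_plus)
  also have "\<dots> = (\<integral>\<^sup>+x. f (z + x) \<partial>lborel)" by (rule nn_integral_distr) auto
  finally show ?thesis by (simp add: add.commute)
qed

lemma AE_lborel_translate:
  fixes z :: "'a::euclidean_space"
  assumes "AE x in lborel. P x" shows "AE x in lborel. P (x + z)"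
proof -
  have "AE x in distr lborel borel ((+) z). P x" unfolding lborel_distr_plus by (rule assms)
  then have "AE x in lborel. P (z + x)" by (rule AE_distrD[rotated]) measurable
  then show ?thesis by (simp add: add.commute)
qed

lemma lebesgue_measurable_ex_borel:
  fixes f :: "'a::euclidean_space \<Rightarrow> 'b::euclidean_space"
  assumes f: "f \<in> borel_measurable lebesgue"
  obtains h where "h \<in> borel_measurable borel" "AE x in lborel. f x = h x"
proof -
  have "\<exists>h\<in>borel_measurable lborel. AE x in lborel. f x \<bullet> b = h x" for b
    by (rule completion_ex_borel_measurable_real) (use f in measurable)
  then obtain h where h: "\<And>b. h b \<in> borel_measurable lborel" "\<And>b. AE x in lborel. f x \<bullet> b = h b x" by metis
  have [measurable]: "h b \<in> borel_measurable borel" for b using h(1)[of b] by simp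
  have m: "(\<lambda>x. \<Sum>b\<in>Basis. h b x *\<^sub>R b) \<in> borel_measurable borel" by measurable
  have "AE x in lborel. \<forall>b\<in>Basis. f x \<bullet> b = h b x" 
    using h(2) by (subst AE_ball_countable) (auto intro: countable_finite)
  then have "AE x in lborel. f x = (\<Sum>b\<in>Basis. h b x *\<^sub>R b)"
  proof eventually_elim
    case (elim x)
    then have "(\<Sum>b\<in>Basis. h b x *\<^sub>R b) = (\<Sum>b\<in>Basis. (f x \<bullet> b) *\<^sub>R b)" by simp
    then show ?case by (simp add: euclidean_representation)
  qed
  with m that show ?thesis by blast
qed

locale lattice_basis =
  fixes g :: "3 \<Rightarrow> real^3"
  assumes inj_g: "inj g" and indep_g: "independent (range g)"
begin

definition combo :: "real^3 \<Rightarrow> real^3" where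
  "combo s = (\<Sum>i\<in>UNIV. s $ i *\<^sub>R g i)"

definition coord :: "real^3 \<Rightarrow> real^3" where
  "coord = inv combo"

definition shift :: "(3 \<Rightarrow> int) \<Rightarrow> real^3" where
  "shift n = (\<Sum>i\<in>UNIV. of_int (n i) *\<^sub>R g i)"

definition invariant :: "(real^3 \<Rightarrow> 'b) \<Rightarrow> bool" where
  "invariant f \<longleftrightarrow> (\<forall>n x. f (x + shift n) = f x)"

text \<open>Half open, so that its lattice translates tile the space without overlap.\<close>

definition unit_cell :: "(real^3) set" where
  "unit_cell = {x. \<forall>i. 0 \<le> coord x $ i \<and> coord x $ i < 1}"

text \<open>A measure on the whole space, so that translated functions can be integrated against it directly.\<close>

definition cell_measure :: "(real^3) measure" (\<open>\<mu>\<close>) where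
  "\<mu> = density lborel (indicator unit_cell)"

abbreviation cell_norm :: "(real^3 \<Rightarrow> 'b::euclidean_space) \<Rightarrow> real" where
  "cell_norm \<equiv> norm2 \<mu>"

lemma linear_combo: "linear combo"
  by (rule linearI) (simp_all add: combo_def scaleR_left_distrib sum.distrib scaleR_sum_right)

lemma inj_combo: "inj combo"
proof -
  have "s = 0" if "combo s = 0" for s
  proof -
    have "(\<Sum>v\<in>range g. s $ inv g v *\<^sub>R v) = 0"
      using that by (simp add: combo_def sum.reindex[OF inj_g] inj_g)
    then have "s $ inv g (g i) = 0" for i
      using independentD[OF indep_g, of "range g" "\<lambda>v. s $ inv g v" "g i"] by auto
    then show ?thesis by (simp add: inj_g vec_eq_iff)
  qed
  then show ?thesis using linear_injective_0[OF linear_combo] by blast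
qed

lemma linear_coord: "linear coord" and combo_coord: "combo (coord x) = x" and coord_combo: "coord (combo s) = s"
proof -
  obtain f' where f': "linear f'" "\<And>x. f' (combo x) = x" "\<And>x. combo (f' x) = x"
    using linear_injective_isomorphism[OF linear_combo inj_combo] by blast
  have "coord = f'" unfolding coord_def by (rule inv_unique_comp) (use f' in \<open>auto simp: fun_eq_iff\<close>)
  then show "linear coord" "combo (coord x) = x" "coord (combo s) = s" using f' by auto
qed

lemma continuous_coord: "continuous_on UNIV coord"
  by (rule linear_continuous_on[OF linear_conv_bounded_linear[THEN iffD1, OF linear_coord]])

lemma coord_measurable [measurable]: "coord \<in> borel_measurable borel"
  by (rule borel_measurable_continuous_onI[OF continuous_coord])

lemma coord_nth_measurable [measurable]: "(\<lambda>x. coord x $ i) \<in> borel_measurable borel"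
  by (intro borel_measurable_continuous_onI continuous_on_component continuous_coord)

lemma shift_eq_combo: "shift n = combo (\<chi> i. of_int (n i))"
  by (simp add: shift_def combo_def)

lemma coord_add_shift [simp]: "coord (x + shift n) $ i = coord x $ i + of_int (n i)"
  by (simp add: linear_add[OF linear_coord] shift_eq_combo coord_combo)

lemma coord_diff_shift [simp]: "coord (x - shift n) $ i = coord x $ i - of_int (n i)"
  by (simp add: linear_diff[OF linear_coord] shift_eq_combo coord_combo)

lemma lattice_eq: "lattice g = range shift"
  by (auto simp: lattice_def shift_def)

lemma invariant_translate:
  assumes "invariant f" shows "invariant (\<lambda>x. f (x + z))"
proof -
  have "f ((x + z) + shift n) = f (x + z)" for x n using assms unfolding invariant_def by blast
  then show ?thesis by (simp add: invariant_def ac_simps)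
qed

lemma cell_eq: "cell g = {x. \<forall>i. coord x $ i \<in> {0..1}}"
proof (intro subset_antisym subsetI)
  fix x assume "x \<in> cell g"
  then obtain s where s: "x = (\<Sum>i\<in>UNIV. s i *\<^sub>R g i)" "\<forall>i. s i \<in> {0..1}" by (auto simp: cell_def)
  then have "x = combo (\<chi> i. s i)" by (simp add: combo_def)
  then show "x \<in> {x. \<forall>i. coord x $ i \<in> {0..1}}" using s by (simp add: coord_combo)
next
  fix x assume "x \<in> {x. \<forall>i. coord x $ i \<in> {0..1}}"
  then have "\<forall>i. (\<lambda>i. coord x $ i) i \<in> {0..1}" "x = (\<Sum>i\<in>UNIV. (\<lambda>i. coord x $ i) i *\<^sub>R g i)"
    using combo_coord[of x] by (auto simp: combo_def)
  then show "x \<in> cell g" unfolding cell_def by blast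
qed

lemma compact_cell: "compact (cell g)"
proof -
  have "cell g = combo ` cbox 0 (\<chi> i. 1)"
    unfolding cell_eq by (force simp: mem_box_cart coord_combo image_iff intro: combo_coord[symmetric])
  moreover have "compact (combo ` cbox 0 (\<chi> i. 1))"
    by (intro compact_continuous_image linear_continuous_on compact_cbox
        linear_conv_bounded_linear[THEN iffD1, OF linear_combo])
  ultimately show ?thesis by simp
qed

lemma unit_cell_subset: "unit_cell \<subseteq> cell g"
  by (auto simp: unit_cell_def cell_eq less_imp_le)

lemma unit_cell_borel [measurable]: "unit_cell \<in> sets borel"
proof -
  have "{x \<in> space borel. \<forall>i. 0 \<le> coord x $ i \<and> coord x $ i < 1} \<in> sets borel" by measurable
  then show ?thesis by (simp add: unit_cell_def)
qed

lemma sets_cell_measure [simp, measurable_cong]: "sets \<mu> = sets borel"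
  and space_cell_measure [simp]: "space \<mu> = UNIV"
  by (simp_all add: cell_measure_def)

lemma L2_cell_borel: "f \<in> L2 \<mu> \<Longrightarrow> f \<in> borel_measurable borel"
  using L2_measurable[of f \<mu>] by (simp add: measurable_cong_sets[OF sets_cell_measure refl])

lemma nn_integral_cell:
  "f \<in> borel_measurable borel \<Longrightarrow>
    (\<integral>\<^sup>+x. f x \<partial>\<mu>) = (\<integral>\<^sup>+x. indicator unit_cell x * f x \<partial>lborel)"
  unfolding cell_measure_def by (subst nn_integral_density) auto

lemma finite_cell_measure: "finite_measure \<mu>"
proof (rule finite_measureI)
  have "emeasure lborel unit_cell \<le> emeasure lborel (cell g)"
    using unit_cell_subset compact_cell by (intro emeasure_mono) (auto dest: compact_imp_closed)
  also have "\<dots> < \<infinity>" by (rule emeasure_compact_finite[OF compact_cell])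
  finally show "emeasure \<mu> (space \<mu>) \<noteq> \<infinity>"
    by (simp add: cell_measure_def emeasure_density)
qed

lemma AE_cell_measure: "(AE x in \<mu>. P x) \<longleftrightarrow> (AE x in lborel. x \<in> unit_cell \<longrightarrow> P x)"
  unfolding cell_measure_def by (subst AE_density) (auto simp: indicator_def)

text \<open>The two cells differ by points with some lattice coordinate equal to \<open>1\<close>, that is, by subsets of three
planes.\<close>

lemma AE_cell_boundary: "AE x in lborel. (x \<in> cell g) = (x \<in> unit_cell)"
proof -
  have "AE x in lborel. coord x $ i \<noteq> 1" for i
  proof -
    have "bounded_linear (\<lambda>x. coord x $ i)"
      using bounded_linear_compose[OF bounded_linear_vec_nth linear_conv_bounded_linear[THEN iffD1, OF linear_coord]] .
    then have lin: "linear (\<lambda>x. coord x $ i)" by (rule bounded_linear.linear)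
    have "coord x $ i = x \<bullet> adjoint (\<lambda>x. coord x $ i) 1" for x
      using adjoint_works[OF lin, of x 1] by simp
    then obtain a where a: "\<And>x. coord x $ i = a \<bullet> x" by (metis inner_commute)
    have "coord (combo (axis i 1)) $ i = 1" by (simp add: coord_combo)
    then have "a \<noteq> 0" using a by force
    then have "negligible {x. a \<bullet> x = 1}" by (intro negligible_hyperplane) simp
    then have "{x. a \<bullet> x = 1} \<in> null_sets lborel"
      by (simp add: negligible_iff_null_sets null_sets_completion_iff closed_hyperplane borel_closed)
    then have "AE x in lborel. x \<notin> {x. a \<bullet> x = 1}" by (rule AE_not_in)
    then show ?thesis by (simp add: a)
  qed
  then have "AE x in lborel. \<forall>i. coord x $ i \<noteq> 1" by (simp add: AE_all_countable)
  then show ?thesis by eventually_elim (auto simp: cell_eq unit_cell_def less_le)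
qed

text \<open>Exactly one lattice translate of a point lies in the half-open cell: the one that subtracts the integer
parts of its coordinates.\<close>

lemma sum_indicator_translates_plus:
  "(\<integral>\<^sup>+n. indicator unit_cell (x + shift n) \<partial>count_space UNIV) = 1"
proof -
  have *: "(0 \<le> c + real_of_int m \<and> c + real_of_int m < 1) = (m = - \<lfloor>c\<rfloor>)" for c m by linarith
  have "indicator unit_cell (x + shift n) = (indicator {\<lambda>i. - \<lfloor>coord x $ i\<rfloor>} n :: ennreal)" for n
    by (auto simp: indicator_def unit_cell_def * fun_eq_iff)
  then show ?thesis by simp
qed

lemma sum_indicator_translates_minus:
  "(\<integral>\<^sup>+n. indicator unit_cell (x - shift n) \<partial>count_space UNIV) = 1"
proof -
  have *: "(0 \<le> c - real_of_int m \<and> c - real_of_int m < 1) = (m = \<lfloor>c\<rfloor>)" for c m by linarith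
  have "indicator unit_cell (x - shift n) = (indicator {\<lambda>i. \<lfloor>coord x $ i\<rfloor>} n :: ennreal)" for n
    by (auto simp: indicator_def unit_cell_def diff_le_eq[symmetric] * fun_eq_iff simp del: le_diff_eq diff_ge_0_iff_ge)
  then show ?thesis by simp
qed

text \<open>The indicator functions of the translated cells sum to \<open>1\<close>; inserting this sum and moving each piece
back to the cell by translation invariance of the Lebesgue measure gives the formula.\<close>

lemma nn_integral_tiling:
  assumes [measurable]: "f \<in> borel_measurable borel"
  shows "(\<integral>\<^sup>+x. f x \<partial>lborel) = (\<integral>\<^sup>+n. (\<integral>\<^sup>+x. f (x + shift n) \<partial>\<mu>) \<partial>count_space UNIV)"
proof -
  have "(\<integral>\<^sup>+x. f x \<partial>lborel) = (\<integral>\<^sup>+x. (\<integral>\<^sup>+n. f x * indicator unit_cell (x - shift n) \<partial>count_space UNIV) \<partial>lborel)"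
    by (simp add: nn_integral_cmult sum_indicator_translates_minus)
  also have "\<dots> = (\<integral>\<^sup>+n. (\<integral>\<^sup>+x. f x * indicator unit_cell (x - shift n) \<partial>lborel) \<partial>count_space UNIV)"
    by (rule nn_integral_count_space_nn_integral) auto
  also have "\<dots> = (\<integral>\<^sup>+n. (\<integral>\<^sup>+x. f (x + shift n) \<partial>\<mu>) \<partial>count_space UNIV)"
  proof (rule nn_integral_cong)
    fix n
    have "(\<integral>\<^sup>+x. f x * indicator unit_cell (x - shift n) \<partial>lborel)
        = (\<integral>\<^sup>+x. f (x + shift n) * indicator unit_cell (x + shift n - shift n) \<partial>lborel)"
      by (rule lborel_nn_integral_translate[symmetric]) auto
    then show "(\<integral>\<^sup>+x. f x * indicator unit_cell (x - shift n) \<partial>lborel) = (\<integral>\<^sup>+x. f (x + shift n) \<partial>\<mu>)"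
      by (subst nn_integral_cell) (auto simp: mult.commute)
  qed
  finally show ?thesis .
qed

text \<open>A null cell would, by tiling, make the whole space null.\<close>

lemma cell_measure_pos: "measure \<mu> UNIV > 0"
proof (rule ccontr)
  assume "\<not> measure \<mu> UNIV > 0"
  then have "measure \<mu> UNIV = 0" using measure_nonneg[of \<mu> UNIV] by linarith
  then have "emeasure \<mu> UNIV = 0"
    using finite_measure.emeasure_eq_measure[OF finite_cell_measure, of UNIV] by simp
  then have "(\<integral>\<^sup>+x. 1 \<partial>(lborel :: (real^3) measure)) = 0"
    by (subst nn_integral_tiling) simp_all
  then show False by simp
qed

text \<open>The translated cell is another fundamental domain: it is cut along the tiling by the original cell, the
pieces are moved back by lattice vectors, and they fill the original cell exactly once.\<close>

lemma nn_integral_cell_translate: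
  assumes [measurable]: "f \<in> borel_measurable borel" and inv: "invariant f"
  shows "(\<integral>\<^sup>+x. f (x + z) \<partial>\<mu>) = (\<integral>\<^sup>+x. f x \<partial>\<mu>)"
proof -
  have "(\<integral>\<^sup>+x. f (x + z) \<partial>\<mu>) = (\<integral>\<^sup>+x. indicator unit_cell (x + z - z) * f (x + z) \<partial>lborel)"
    by (subst nn_integral_cell) auto
  also have "\<dots> = (\<integral>\<^sup>+x. indicator unit_cell (x - z) * f x \<partial>lborel)"
    by (rule lborel_nn_integral_translate[where f = "\<lambda>x. indicator unit_cell (x - z) * f x"]) auto
  also have "\<dots> = (\<integral>\<^sup>+n. (\<integral>\<^sup>+x. indicator unit_cell (x + shift n - z) * f (x + shift n) \<partial>\<mu>) \<partial>count_space UNIV)"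
    by (rule nn_integral_tiling) auto
  also have "\<dots> = (\<integral>\<^sup>+n. (\<integral>\<^sup>+x. f x * indicator unit_cell ((x - z) + shift n) \<partial>\<mu>) \<partial>count_space UNIV)"
    using inv by (simp add: invariant_def mult.commute algebra_simps)
  also have "\<dots> = (\<integral>\<^sup>+x. (\<integral>\<^sup>+n. f x * indicator unit_cell ((x - z) + shift n) \<partial>count_space UNIV) \<partial>\<mu>)"
    by (rule nn_integral_count_space_nn_integral[symmetric]) auto
  also have "\<dots> = (\<integral>\<^sup>+x. f x \<partial>\<mu>)"
    by (simp add: nn_integral_cmult sum_indicator_translates_plus)
  finally show ?thesis .
qed

lemma integral_cell_translate:
  fixes f :: "real^3 \<Rightarrow> real"
  assumes [measurable]: "f \<in> borel_measurable borel" and inv: "invariant f"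
  shows "(LINT x|\<mu>. f (x + z)) = (LINT x|\<mu>. f x)"
    and "integrable \<mu> (\<lambda>x. f (x + z)) \<longleftrightarrow> integrable \<mu> f"
proof -
  have i: "invariant (\<lambda>x. ennreal (f x))" "invariant (\<lambda>x. ennreal (- f x))" "invariant (\<lambda>x. ennreal (norm (f x)))"
    using inv by (auto simp: invariant_def)
  note t = i[THEN nn_integral_cell_translate[rotated], of z]
  show I: "integrable \<mu> (\<lambda>x. f (x + z)) \<longleftrightarrow> integrable \<mu> f"
    unfolding integrable_iff_bounded using t(3) by (simp add: measurable_cong_sets[OF sets_cell_measure refl])
  show "(LINT x|\<mu>. f (x + z)) = (LINT x|\<mu>. f x)"
  proof (cases "integrable \<mu> f")
    case True
    then show ?thesis using I t(1,2) by (simp add: real_lebesgue_integral_def)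
  next
    case False
    then show ?thesis using I by (simp add: not_integrable_integral_eq)
  qed
qed

text \<open>A bounded set meets only finitely many translates of the cell; their number is the constant.\<close>

lemma nn_integral_bounded_set:
  assumes "bounded K"
  shows "\<exists>c\<ge>0. \<forall>f\<in>borel_measurable borel. invariant f \<longrightarrow>
    (\<integral>\<^sup>+x\<in>K. f x \<partial>lborel) \<le> ennreal c * (\<integral>\<^sup>+x. f x \<partial>\<mu>)"
proof -
  obtain B where B: "\<And>x. x \<in> K \<Longrightarrow> norm x \<le> B" using assms by (auto simp: bounded_iff)
  have [measurable]: "cball 0 B \<in> sets (borel :: (real^3) measure)" by simp
  have bK: "K \<subseteq> cball 0 B" using B by auto
  have "compact (coord ` cball 0 B)"
    by (intro compact_continuous_image continuous_on_subset[OF continuous_coord]) auto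
  then obtain A where A: "\<And>x. x \<in> cball 0 B \<Longrightarrow> norm (coord x) \<le> A"
    using compact_imp_bounded bounded_iff[of "coord ` cball 0 B"] by (metis imageI)
  define N where "N = \<lceil>A\<rceil> + 1"
  define F where "F = {n :: 3 \<Rightarrow> int. \<forall>i. n i \<in> {-N..N}}"
  have "F = PiE UNIV (\<lambda>_. {-N..N})" by (auto simp: F_def PiE_def Pi_def)
  then have finF: "finite F" by (simp add: finite_PiE)
  have ind: "indicator (cball 0 B) (x + shift n) \<le> (indicator F n :: ennreal)" if "x \<in> unit_cell" for x n
  proof (cases "x + shift n \<in> cball 0 B")
    case True
    have "n i \<in> {-N..N}" for i
    proof -
      have "\<bar>coord (x + shift n) $ i\<bar> \<le> A" using A[OF True] component_le_norm_cart order_trans by blast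
      moreover have "0 \<le> coord x $ i" "coord x $ i < 1" using that by (auto simp: unit_cell_def)
      ultimately have "\<bar>real_of_int (n i)\<bar> \<le> A + 1" by simp
      then show ?thesis unfolding N_def by simp linarith
    qed
    then show ?thesis by (simp add: F_def indicator_def)
  qed simp
  show ?thesis
  proof (intro exI[of _ "real (card F)"] conjI ballI impI)
    show "0 \<le> real (card F)" by simp
    fix f :: "real^3 \<Rightarrow> ennreal" assume f [measurable]: "f \<in> borel_measurable borel" and inv: "invariant f"
    have "(\<integral>\<^sup>+x\<in>K. f x \<partial>lborel) \<le> (\<integral>\<^sup>+x. f x * indicator (cball 0 B) x \<partial>lborel)"
      using bK by (intro nn_integral_mono) (auto simp: indicator_def)
    also have "\<dots> = (\<integral>\<^sup>+n. (\<integral>\<^sup>+x. f (x + shift n) * indicator (cball 0 B) (x + shift n) \<partial>\<mu>) \<partial>count_space UNIV)"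
      by (rule nn_integral_tiling) auto
    also have "\<dots> \<le> (\<integral>\<^sup>+n. (\<integral>\<^sup>+x. f x * indicator F n \<partial>\<mu>) \<partial>count_space UNIV)"
      using ind inv by (intro nn_integral_mono nn_integral_mono_AE)
        (auto simp: AE_cell_measure invariant_def intro!: mult_left_mono)
    also have "\<dots> = (\<integral>\<^sup>+n. (\<integral>\<^sup>+x. f x \<partial>\<mu>) * indicator F n \<partial>count_space UNIV)"
      by (intro nn_integral_cong nn_integral_multc) auto
    also have "\<dots> = (\<integral>\<^sup>+x. f x \<partial>\<mu>) * of_nat (card F)"
      using finF by (simp add: nn_integral_cmult_indicator)
    finally show "(\<integral>\<^sup>+x\<in>K. f x \<partial>lborel) \<le> ennreal (real (card F)) * (\<integral>\<^sup>+x. f x \<partial>\<mu>)"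
      by (simp add: mult.commute ennreal_of_nat_eq_real_of_nat)
  qed
qed

text \<open>The exceptional set is invariant, so by tiling it is null as soon as its part in the cell is.\<close>

lemma AE_invariant:
  assumes inv: "invariant P" and meas: "{x. P x} \<in> sets borel"
    and P: "AE x in \<mu>. P x"
  shows "AE x in lborel. P x"
proof -
  have [measurable]: "{x. \<not> P x} \<in> sets borel" using sets.compl_sets[OF meas] by (simp add: Collect_neg_eq Compl_eq_Diff_UNIV)
  have "(\<integral>\<^sup>+x. indicator {x. \<not> P x} (x + shift n) \<partial>\<mu>) = 0" for n
  proof -
    have "(\<integral>\<^sup>+x. indicator {x. \<not> P x} (x + shift n) \<partial>\<mu>) = (\<integral>\<^sup>+x. 0 \<partial>\<mu>)"
      using P inv by (intro nn_integral_cong_AE) (auto simp: invariant_def)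
    then show ?thesis by simp
  qed
  then have "(\<integral>\<^sup>+x. indicator {x. \<not> P x} x \<partial>lborel) = 0"
    by (subst nn_integral_tiling) simp_all
  then have "{x. \<not> P x} \<in> null_sets lborel" by (simp add: null_sets_def)
  then have "AE x in lborel. x \<notin> {x. \<not> P x}" by (rule AE_not_in)
  then show ?thesis by simp
qed

lemma AE_cell_if_lborel: "AE x in lborel. P x \<Longrightarrow> AE x in \<mu>. P x"
  unfolding AE_cell_measure by (erule eventually_mono) simp

text \<open>Borel functions that are periodic at every point and square integrable over the cell. They represent
the almost everywhere periodic fields and can be translated without exceptional null sets.\<close>

definition L2_inv :: "(real^3 \<Rightarrow> 'b::euclidean_space) set" where
  "L2_inv = {f \<in> L2 \<mu>. invariant f}"

lemma L2_inv_borel [measurable_dest]: "f \<in> L2_inv \<Longrightarrow> f \<in> borel_measurable borel"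
  by (auto simp: L2_inv_def L2_cell_borel)

lemma L2_inv_L2: "f \<in> L2_inv \<Longrightarrow> f \<in> L2 \<mu>"
  by (simp add: L2_inv_def)

lemma L2_inv_invariant: "f \<in> L2_inv \<Longrightarrow> invariant f"
  by (simp add: L2_inv_def)

lemma L2_inv_translate:
  assumes f: "f \<in> L2_inv"
  shows "(\<lambda>x. f (x + z)) \<in> L2_inv" "cell_norm (\<lambda>x. f (x + z)) = cell_norm f"
proof -
  note [measurable] = L2_inv_borel[OF f]
  have i: "invariant (\<lambda>x. (norm (f x))\<^sup>2)" using L2_inv_invariant[OF f] by (auto simp: invariant_def)
  have m: "(\<lambda>x. (norm (f x))\<^sup>2) \<in> borel_measurable borel" by measurable
  show "cell_norm (\<lambda>x. f (x + z)) = cell_norm f"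
    using integral_cell_translate(1)[OF m i, of z] by (simp add: norm2_def)
  have "(\<lambda>x. f (x + z)) \<in> borel_measurable \<mu>" by measurable
  then show "(\<lambda>x. f (x + z)) \<in> L2_inv"
    using integral_cell_translate(2)[OF m i, of z] f
    by (simp add: L2_inv_def L2_def invariant_translate)
qed

lemma L2_inv_add: "f \<in> L2_inv \<Longrightarrow> h \<in> L2_inv \<Longrightarrow> (\<lambda>x. f x + h x) \<in> L2_inv"
  by (simp add: L2_inv_def L2_add invariant_def)

lemma L2_inv_diff: "f \<in> L2_inv \<Longrightarrow> h \<in> L2_inv \<Longrightarrow> (\<lambda>x. f x - h x) \<in> L2_inv"
  by (simp add: L2_inv_def L2_diff invariant_def)

lemma L2_inv_scaleR: "f \<in> L2_inv \<Longrightarrow> (\<lambda>x. c *\<^sub>R f x) \<in> L2_inv"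
  by (simp add: L2_inv_def L2_scaleR invariant_def)

lemma L2_inv_const: "(\<lambda>x. c) \<in> L2_inv"
  by (simp add: L2_inv_def L2_const[OF finite_cell_measure] invariant_def)

lemma L2_inv_bounded_linear: "bounded_linear T \<Longrightarrow> f \<in> L2_inv \<Longrightarrow> (\<lambda>x. T (f x)) \<in> L2_inv"
  by (simp add: L2_inv_def L2_bounded_linear invariant_def)

lemma L2_inv_periodic: "f \<in> L2_inv \<Longrightarrow> periodic g f"
  by (auto simp: periodic_def lattice_eq dest: L2_inv_invariant simp: invariant_def)

lemma L2_inv_set_integrable:
  assumes "f \<in> L2_inv" "bounded K" "K \<in> sets borel"
  shows "integrable lborel (\<lambda>x. indicator K x *\<^sub>R (norm (f x))\<^sup>2)"
proof -
  note [measurable] = L2_inv_borel[OF assms(1)] assms(3)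
  obtain c where c: "c \<ge> 0" "\<And>f. f \<in> borel_measurable borel \<Longrightarrow> invariant f \<Longrightarrow>
    (\<integral>\<^sup>+x\<in>K. f x \<partial>lborel) \<le> ennreal c * (\<integral>\<^sup>+x. f x \<partial>\<mu>)"
    using nn_integral_bounded_set[OF assms(2)] by blast
  have "(\<integral>\<^sup>+x\<in>K. ennreal ((norm (f x))\<^sup>2) \<partial>lborel) \<le> ennreal c * (\<integral>\<^sup>+x. ennreal ((norm (f x))\<^sup>2) \<partial>\<mu>)"
    using L2_inv_invariant[OF assms(1)] by (intro c) (auto simp: invariant_def)
  also have "\<dots> < \<infinity>" using norm2_nn[OF L2_inv_L2[OF assms(1)]] by (simp add: ennreal_mult_less_top)
  finally have "(\<integral>\<^sup>+x. ennreal (norm (indicator K x *\<^sub>R (norm (f x))\<^sup>2)) \<partial>lborel) < \<infinity>"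
    by (rule le_less_trans[rotated]) (auto intro!: nn_integral_mono simp: indicator_def)
  then show ?thesis by (intro integrableI_bounded) auto
qed

lemma L2_inv_L2_loc:
  assumes "f \<in> L2_inv" shows "f \<in> L2_loc"
proof -
  note [measurable] = L2_inv_borel[OF assms(1)]
  have "set_integrable lebesgue K (\<lambda>x. (norm (f x))\<^sup>2)" if "compact K" for K
    unfolding set_integrable_def
  proof (subst integrable_completion)
    have K [measurable]: "K \<in> sets borel" using that by (simp add: borel_compact)
    show "(\<lambda>x. indicator K x *\<^sub>R (norm (f x))\<^sup>2) \<in> borel_measurable lborel" by measurable
    show "integrable lborel (\<lambda>x. indicator K x *\<^sub>R (norm (f x))\<^sup>2)"
      using assms that K by (intro L2_inv_set_integrable) (auto dest: compact_imp_bounded)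
  qed
  moreover have "f \<in> borel_measurable lebesgue" by (rule measurable_completion) simp
  ultimately show ?thesis by (simp add: L2_loc_def)
qed

text \<open>A Borel representative is evaluated at the point of the half-open cell that is equivalent to the
argument. This changes it only on a null set, because the lattice is countable.\<close>

lemma L2_inv_representative:
  fixes f :: "real^3 \<Rightarrow> 'b::euclidean_space"
  assumes f: "f \<in> L2_loc" and per: "periodic g f"
  obtains h where "h \<in> L2_inv" "AE x in lborel. f x = h x"
proof -
  have fm: "f \<in> borel_measurable lebesgue" using f by (simp add: L2_loc_def)
  obtain b where b [measurable]: "b \<in> borel_measurable borel" and fb: "AE x in lborel. f x = b x"
    using lebesgue_measurable_ex_borel[OF fm] .
  define h where "h x = b (combo (\<chi> i. frac (coord x $ i)))" for x
  have [measurable]: "h \<in> borel_measurable borel" unfolding h_def combo_def frac_def by simp measurable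
  have inv: "invariant h" by (simp add: invariant_def h_def frac_def)
  \<comment> \<open>Passing to fractional parts of the coordinates is a translation by a lattice vector depending on the point.\<close>
  have cf: "combo (\<chi> i. frac (coord x $ i)) = x + shift (\<lambda>i. - \<lfloor>coord x $ i\<rfloor>)" for x
  proof -
    have "coord (combo (\<chi> i. frac (coord x $ i))) = coord (x + shift (\<lambda>i. - \<lfloor>coord x $ i\<rfloor>))"
      by (simp add: vec_eq_iff coord_combo frac_def)
    then show ?thesis by (metis combo_coord)
  qed
  have "AE x in lborel. b (x + shift n) = b x" for n
  proof -
    have "AE x in lborel. f (x + shift n) = f x"
      using per by (simp add: periodic_def lattice_eq AE_completion_iff)
    with fb AE_lborel_translate[OF fb, of "shift n"] show ?thesis by eventually_elim simp
  qed
  then have "AE x in lborel. \<forall>n. b (x + shift n) = b x" by (simp add: AE_all_countable)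
  with fb have fh: "AE x in lborel. f x = h x" by eventually_elim (simp add: h_def cf)
  have "set_integrable lebesgue (cell g) (\<lambda>x. (norm (f x))\<^sup>2)"
    using f compact_cell by (simp add: L2_loc_def)
  then have "(\<integral>\<^sup>+x. ennreal (norm (indicator (cell g) x *\<^sub>R (norm (f x))\<^sup>2)) \<partial>lborel) < \<infinity>"
    unfolding set_integrable_def integrable_iff_bounded by (simp add: nn_integral_completion)
  moreover have "(\<integral>\<^sup>+x. ennreal ((norm (h x))\<^sup>2) \<partial>\<mu>)
      = (\<integral>\<^sup>+x. ennreal (norm (indicator (cell g) x *\<^sub>R (norm (f x))\<^sup>2)) \<partial>lborel)"
    using fh AE_cell_boundary
    by (subst nn_integral_cell, simp, intro nn_integral_cong_AE) (auto elim!: eventually_rev_mp simp: indicator_def)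
  ultimately have "h \<in> L2 \<mu>"
    by (auto simp: L2_def integrable_iff_bounded measurable_cong_sets[OF sets_cell_measure refl])
  with inv fh that show ?thesis by (auto simp: L2_inv_def)
qed

lemma set_integral_cell:
  fixes F h :: "real^3 \<Rightarrow> 'b::euclidean_space"
  assumes [measurable]: "F \<in> borel_measurable lebesgue" "h \<in> borel_measurable borel"
    and eq: "AE x in lborel. F x = h x"
  shows "(LINT y:cell g|lebesgue. F y) = (LINT y|\<mu>. h y)"
proof -
  have [measurable]: "cell g \<in> sets borel" by (rule borel_compact[OF compact_cell])
  have "cell g \<in> sets lebesgue" by simp
  then have m1: "(\<lambda>y. indicator (cell g) y *\<^sub>R F y) \<in> borel_measurable lebesgue" by measurable
  have "(\<lambda>y. indicator unit_cell y *\<^sub>R h y) \<in> borel_measurable lborel" by measurable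
  then have m2: "(\<lambda>y. indicator unit_cell y *\<^sub>R h y) \<in> borel_measurable lebesgue" by (rule measurable_completion)
  have "AE y in lborel. indicator (cell g) y *\<^sub>R F y = indicator unit_cell y *\<^sub>R h y"
    using eq AE_cell_boundary by eventually_elim (simp add: indicator_def)
  then have "(LINT y:cell g|lebesgue. F y) = (\<integral>y. indicator unit_cell y *\<^sub>R h y \<partial>lebesgue)"
    unfolding set_lebesgue_integral_def by (intro integral_cong_AE m1 m2) (simp add: AE_completion_iff)
  also have "\<dots> = (LBINT y. indicator unit_cell y *\<^sub>R h y)"
    by (rule integral_completion) measurable
  also have "\<dots> = (\<integral>y. h y \<partial>density lborel (\<lambda>x. ennreal (indicator unit_cell x)))"
    by (subst integral_density) auto
  finally show ?thesis by (simp add: cell_measure_def ennreal_indicator)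
qed

end

section \<open>Continuity of translations in the mean\<close>

lemma clamp_L2_tendsto:
  fixes f :: "'a \<Rightarrow> real"
  assumes f: "f \<in> L2 M"
  shows "(\<lambda>n. norm2 M (\<lambda>x. f x - max (- real n) (min (real n) (f x)))) \<longlonglongrightarrow> 0"
proof -
  note [measurable] = L2_measurable[OF f]
  have "(\<lambda>n. \<integral>x. (norm (f x - max (- real n) (min (real n) (f x))))\<^sup>2 \<partial>M) \<longlonglongrightarrow> (LINT x|M. 0)"
  proof (rule integral_dominated_convergence)
    show "integrable M (\<lambda>x. (norm (f x))\<^sup>2)" by (rule L2_integrable[OF f])
    have "(\<lambda>n. (norm (f x - max (- real n) (min (real n) (f x))))\<^sup>2) \<longlonglongrightarrow> 0" for x
    proof (rule tendsto_eventually)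
      obtain N where "\<bar>f x\<bar> \<le> real N" using real_arch_simple by blast
      then show "\<forall>\<^sub>F n in sequentially. (norm (f x - max (- real n) (min (real n) (f x))))\<^sup>2 = 0"
        by (intro eventually_sequentiallyI[of N]) (auto simp: min_def max_def)
    qed
    then show "AE x in M. (\<lambda>n. (norm (f x - max (- real n) (min (real n) (f x))))\<^sup>2) \<longlonglongrightarrow> 0" by simp
    have "\<bar>f x - max (- real n) (min (real n) (f x))\<bar> \<le> \<bar>f x\<bar>" for n x by (auto simp: min_def max_def)
    then show "AE x in M. norm ((norm (f x - max (- real n) (min (real n) (f x))))\<^sup>2) \<le> (norm (f x))\<^sup>2" for n
      by (simp flip: abs_le_square_iff)
  qed auto
  then have "(\<lambda>n. sqrt (LINT x|M. (norm (f x - max (- real n) (min (real n) (f x))))\<^sup>2)) \<longlonglongrightarrow> sqrt 0"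
    by (intro tendsto_real_sqrt) simp
  then show ?thesis by (simp add: norm2_def)
qed

context lattice_basis
begin

text \<open>A measurable function is almost everywhere a limit of continuous functions. Cut off at the bound \<open>R\<close>,
they converge in the mean on bounded sets, and for a bounded continuous function the claim is dominated
convergence.\<close>

lemma translate_continuous_bounded:
  fixes f :: "real^3 \<Rightarrow> real"
  assumes f: "f \<in> L2_inv" and R: "\<And>x. \<bar>f x\<bar> \<le> R" and z: "z \<longlonglongrightarrow> 0"
  shows "(\<lambda>j. cell_norm (\<lambda>x. f (x + z j) - f x)) \<longlonglongrightarrow> 0"
proof -
  have fm [measurable]: "f \<in> borel_measurable borel" by (rule L2_inv_borel[OF f])
  have "f \<in> borel_measurable lebesgue" by (rule measurable_completion) simp
  then have "f measurable_on UNIV" by (intro lebesgue_measurable_imp_measurable_on) auto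
  then obtain N h where N: "negligible N" and h: "\<And>n. continuous_on UNIV (h n)"
    and lim: "\<And>x. x \<notin> N \<Longrightarrow> (\<lambda>n. h n x) \<longlonglongrightarrow> f x"
    unfolding measurable_on_def by auto
  have R0: "R \<ge> 0" using R[of 0] by linarith
  define k where "k n x = max (- R) (min R (h n x))" for n :: nat and x
  have kc: "continuous_on UNIV (k n)" for n unfolding k_def by (intro continuous_intros h)
  have km [measurable]: "k n \<in> borel_measurable borel" for n by (rule borel_measurable_continuous_onI[OF kc])
  have kR: "\<bar>k n x\<bar> \<le> R" for n x using R0 by (auto simp: k_def min_def max_def)
  have klim: "(\<lambda>n. k n x) \<longlonglongrightarrow> f x" if "x \<notin> N" for x
  proof -
    have "(\<lambda>n. k n x) \<longlonglongrightarrow> max (- R) (min R (f x))" unfolding k_def by (intro tendsto_intros lim that)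
    moreover have "max (- R) (min R (f x)) = f x" using R[of x] by (auto simp: min_def max_def)
    ultimately show ?thesis by simp
  qed
  have diffR: "(norm (f x - k n x))\<^sup>2 \<le> (2 * R)\<^sup>2" for x n
    using R[of x] kR[of n x] by (intro power_mono) auto
  \<comment> \<open>The continuous approximants are not periodic, so closeness is needed on a ball that contains all translates of the cell by vectors of length at most one.\<close>
  obtain b where b: "\<And>x. x \<in> unit_cell \<Longrightarrow> norm x \<le> b"
    using unit_cell_subset compact_imp_bounded[OF compact_cell] by (auto simp: bounded_iff)
  define B where "B = cball (0::real^3) (b + 1)"
  have Bm [measurable]: "B \<in> sets borel" by (simp add: B_def)
  have near: "x + w \<in> B" if "x \<in> unit_cell" "norm w \<le> 1" for x w
    using norm_triangle_le[of x w "b + 1"] b[OF that(1)] that(2) by (simp add: B_def)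
  have AEN: "AE x in lborel. x \<notin> N"
    using AE_not_in[of N lebesgue] N by (simp add: negligible_iff_null_sets AE_completion_iff)
  define D where "D n = (LBINT x. indicator B x * (norm (f x - k n x))\<^sup>2)" for n
  have Bint: "integrable lborel (\<lambda>x. indicator B x * (2 * R)\<^sup>2)"
    using emeasure_compact_finite[of B] by (intro integrable_mult_left) (auto simp: B_def)
  have Dint: "integrable lborel (\<lambda>x. indicator B x * (norm (f x - k n x))\<^sup>2)" for n
    using Bint by (rule Bochner_Integration.integrable_bound)
      (use diffR in \<open>auto simp: indicator_def\<close>)
  have "D \<longlonglongrightarrow> (\<integral>x. 0 \<partial>(lborel :: (real^3) measure))"
    unfolding D_def
  proof (rule integral_dominated_convergence[OF _ _ Bint])
    show "AE x in lborel. (\<lambda>n. indicator B x * (norm (f x - k n x))\<^sup>2) \<longlonglongrightarrow> 0"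
      using AEN
    proof eventually_elim
      case (elim x)
      have "(\<lambda>n. indicator B x * (norm (f x - k n x))\<^sup>2) \<longlonglongrightarrow> indicator B x * (norm (f x - f x))\<^sup>2"
        by (intro tendsto_intros klim elim)
      then show ?case by simp
    qed
    show "AE x in lborel. norm (indicator B x * (norm (f x - k n x))\<^sup>2) \<le> indicator B x * (2 * R)\<^sup>2" for n
      using diffR by (auto simp: indicator_def)
  qed auto
  then have D0: "(\<lambda>n. sqrt (D n)) \<longlonglongrightarrow> 0" using tendsto_real_sqrt[of D 0] by simp
  have approx: "(\<lambda>x. f (x + w) - k n (x + w)) \<in> L2 \<mu>"
    "cell_norm (\<lambda>x. f (x + w) - k n (x + w)) \<le> sqrt (D n)" if "norm w \<le> 1" for w n
  proof -
    have "(\<integral>\<^sup>+x. ennreal ((norm (f (x + w) - k n (x + w)))\<^sup>2) \<partial>\<mu>)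
        = (\<integral>\<^sup>+x. indicator unit_cell x * ennreal ((norm (f (x + w) - k n (x + w)))\<^sup>2) \<partial>lborel)"
      by (rule nn_integral_cell) measurable
    also have "\<dots> \<le> (\<integral>\<^sup>+x. ennreal (indicator B (x + w) * (norm (f (x + w) - k n (x + w)))\<^sup>2) \<partial>lborel)"
      using near[OF _ that] by (intro nn_integral_mono) (auto simp: indicator_def)
    also have "\<dots> = (\<integral>\<^sup>+x. ennreal (indicator B x * (norm (f x - k n x))\<^sup>2) \<partial>lborel)"
      by (rule lborel_nn_integral_translate[where f = "\<lambda>x. ennreal (indicator B x * (norm (f x - k n x))\<^sup>2)"]) simp
    also have "\<dots> = ennreal (D n)" unfolding D_def
      by (rule nn_integral_eq_integral[OF Dint]) simp
    finally have *: "(\<integral>\<^sup>+x. ennreal ((norm (f (x + w) - k n (x + w)))\<^sup>2) \<partial>\<mu>) \<le> ennreal ((sqrt (D n))\<^sup>2)"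
      by (simp add: D_def)
    have m: "(\<lambda>x. f (x + w) - k n (x + w)) \<in> borel_measurable \<mu>" by measurable
    show "(\<lambda>x. f (x + w) - k n (x + w)) \<in> L2 \<mu>"
      "cell_norm (\<lambda>x. f (x + w) - k n (x + w)) \<le> sqrt (D n)"
      using L2_nn_bound[OF m *] by (auto simp: D_def)
  qed
  have kL: "(\<lambda>x. k n (x + w)) \<in> L2 \<mu>" for n w
  proof -
    have "(\<lambda>x. k n (x + w)) \<in> borel_measurable \<mu>" by measurable
    from L2_dominated[OF this L2_const[OF finite_cell_measure, of R], of 1] show ?thesis using kR R0 by simp
  qed
  have kshift: "(\<lambda>j. cell_norm (\<lambda>x. k n (x + z j) - k n x)) \<longlonglongrightarrow> 0" for n
  proof -
    have "(\<lambda>j. \<integral>x. (norm (k n (x + z j) - k n x))\<^sup>2 \<partial>\<mu>) \<longlonglongrightarrow> (LINT x|\<mu>. 0)"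
    proof (rule integral_dominated_convergence)
      show "integrable \<mu> (\<lambda>x. (2 * R)\<^sup>2)"
        by (rule finite_measure.integrable_const[OF finite_cell_measure])
      have "(\<lambda>j. (norm (k n (x + z j) - k n x))\<^sup>2) \<longlonglongrightarrow> 0" for x
      proof -
        have "(\<lambda>j. x + z j) \<longlonglongrightarrow> x + 0" by (intro tendsto_intros z)
        then have "(\<lambda>j. k n (x + z j)) \<longlonglongrightarrow> k n x"
          using continuous_on_tendsto_compose[OF kc, of "\<lambda>j. x + z j" x] by simp
        then have "(\<lambda>j. (norm (k n (x + z j) - k n x))\<^sup>2) \<longlonglongrightarrow> (norm (k n x - k n x))\<^sup>2"
          by (intro tendsto_intros)
        then show ?thesis by simp
      qed
      then show "AE x in \<mu>. (\<lambda>j. (norm (k n (x + z j) - k n x))\<^sup>2) \<longlonglongrightarrow> 0" by simp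
      have "(norm (k n (x + w) - k n x))\<^sup>2 \<le> (2 * R)\<^sup>2" for x w
        using kR[of n x] kR[of n "x + w"] by (intro power_mono) auto
      then show "AE x in \<mu>. norm ((norm (k n (x + z j) - k n x))\<^sup>2) \<le> (2 * R)\<^sup>2" for j by simp
    qed measurable
    then have "(\<lambda>j. sqrt (LINT x|\<mu>. (norm (k n (x + z j) - k n x))\<^sup>2)) \<longlonglongrightarrow> sqrt 0"
      by (intro tendsto_real_sqrt) simp
    then show ?thesis by (simp add: norm2_def)
  qed
  show ?thesis
  proof (rule LIMSEQ_I)
    fix e :: real assume e: "e > 0"
    from LIMSEQ_D[OF D0, of "e/3"] obtain n where "norm (sqrt (D n) - 0) < e / 3" using e by auto
    then have n: "sqrt (D n) < e / 3" by simp
    from LIMSEQ_D[OF kshift[of n], of "e/3"] obtain J1 where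
      J1: "\<And>j. j \<ge> J1 \<Longrightarrow> cell_norm (\<lambda>x. k n (x + z j) - k n x) < e / 3" using e by force
    from LIMSEQ_D[OF z, of 1] obtain J2 where J2: "\<And>j. j \<ge> J2 \<Longrightarrow> norm (z j) < 1" by force
    have "norm (cell_norm (\<lambda>x. f (x + z j) - f x) - 0) < e" if j: "j \<ge> max J1 J2" for j
    proof -
      have z1: "norm (z j) \<le> 1" using J2[of j] j by simp
      have fL: "(\<lambda>x. f (x + z j)) \<in> L2 \<mu>" "f \<in> L2 \<mu>"
        using L2_inv_L2 L2_inv_translate(1)[OF f] f by blast+
      have kL0: "k n \<in> L2 \<mu>" using kL[of n 0] by simp
      have "cell_norm (\<lambda>x. f (x + z j) - f x) \<le> cell_norm (\<lambda>x. f (x + z j) - k n (x + z j))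
          + (cell_norm (\<lambda>x. k n (x + z j) - k n x) + cell_norm (\<lambda>x. k n x - f x))"
        using norm2_diff_triangle[OF fL(1) kL[of n "z j"] fL(2)]
          norm2_diff_triangle[OF kL[of n "z j"] kL0 fL(2)] by linarith
      moreover have "cell_norm (\<lambda>x. k n x - f x) \<le> sqrt (D n)"
        using approx(2)[of 0 n] norm2_minus_commute[of \<mu> "k n" f] by simp
      ultimately show ?thesis using approx(2)[OF z1, of n] n J1[of j] j by simp
    qed
    then show "\<exists>no. \<forall>j\<ge>no. norm (cell_norm (\<lambda>x. f (x + z j) - f x) - 0) < e" by blast
  qed
qed

text \<open>Cutting off at height \<open>n\<close> reduces the claim to bounded functions; the error does not change under
translation, since the cut-off function is periodic again.\<close>

lemma translate_continuous_seq:
  fixes f :: "real^3 \<Rightarrow> real"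
  assumes f: "f \<in> L2_inv" and z: "z \<longlonglongrightarrow> 0"
  shows "(\<lambda>j. cell_norm (\<lambda>x. f (x + z j) - f x)) \<longlonglongrightarrow> 0"
proof (rule LIMSEQ_I)
  fix e :: real assume e: "e > 0"
  define c where "c n x = max (- real n) (min (real n) (f x))" for n x
  note [measurable] = L2_inv_borel[OF f]
  have cL: "c n \<in> L2_inv" for n
  proof -
    have "c n \<in> borel_measurable \<mu>" unfolding c_def by measurable
    then have "c n \<in> L2 \<mu>"
      by (rule L2_dominated[OF _ L2_inv_L2[OF f], of _ 1]) (auto simp: c_def min_def max_def)
    then show ?thesis using L2_inv_invariant[OF f] by (simp add: L2_inv_def invariant_def c_def)
  qed
  have "(\<lambda>n. cell_norm (\<lambda>x. f x - c n x)) \<longlonglongrightarrow> 0"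
    unfolding c_def by (rule clamp_L2_tendsto[OF L2_inv_L2[OF f]])
  from LIMSEQ_D[OF this, of "e/3"] obtain n where n: "cell_norm (\<lambda>x. f x - c n x) < e / 3" using e by force
  have "(\<lambda>j. cell_norm (\<lambda>x. c n (x + z j) - c n x)) \<longlonglongrightarrow> 0"
    by (rule translate_continuous_bounded[OF cL _ z, of _ "real n"]) (auto simp: c_def min_def max_def)
  from LIMSEQ_D[OF this, of "e/3"] obtain J where
    J: "\<And>j. j \<ge> J \<Longrightarrow> cell_norm (\<lambda>x. c n (x + z j) - c n x) < e / 3" using e by force
  have "norm (cell_norm (\<lambda>x. f (x + z j) - f x) - 0) < e" if "j \<ge> J" for j
  proof -
    note L = L2_inv_L2[OF f] L2_inv_L2[OF cL[of n]]
      L2_inv_L2[OF L2_inv_translate(1)[OF f, of "z j"]] L2_inv_L2[OF L2_inv_translate(1)[OF cL[of n], of "z j"]]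
    have "cell_norm (\<lambda>x. f (x + z j) - f x) \<le> cell_norm (\<lambda>x. f (x + z j) - c n (x + z j))
        + (cell_norm (\<lambda>x. c n (x + z j) - c n x) + cell_norm (\<lambda>x. c n x - f x))"
      using norm2_diff_triangle[OF L(3,4,1)] norm2_diff_triangle[OF L(4,2,1)] by linarith
    moreover have "cell_norm (\<lambda>x. f (x + z j) - c n (x + z j)) = cell_norm (\<lambda>x. f x - c n x)"
      using L2_inv_translate(2)[OF L2_inv_diff[OF f cL[of n]], of "z j"] .
    moreover have "cell_norm (\<lambda>x. c n x - f x) = cell_norm (\<lambda>x. f x - c n x)"
      by (rule norm2_minus_commute)
    ultimately show ?thesis using n J[OF that] by simp
  qed
  then show "\<exists>no. \<forall>j\<ge>no. norm (cell_norm (\<lambda>x. f (x + z j) - f x) - 0) < e" by blast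
qed

lemma translate_continuous:
  fixes f :: "real^3 \<Rightarrow> real"
  assumes f: "f \<in> L2_inv" and e: "e > 0"
  obtains \<delta> where "\<delta> > 0" "\<And>w. norm w < \<delta> \<Longrightarrow> cell_norm (\<lambda>x. f (x + w) - f x) < e"
proof (rule ccontr)
  assume "\<not> thesis"
  then have "\<exists>w. norm w < 1 / Suc n \<and> cell_norm (\<lambda>x. f (x + w) - f x) \<ge> e" for n
    using that[of "1 / Suc n"] by force
  then obtain w where w: "\<And>n. norm (w n) < 1 / Suc n"
    and we: "\<And>n. cell_norm (\<lambda>x. f (x + w n) - f x) \<ge> e" by metis
  have "(\<lambda>n. norm (w n)) \<longlonglongrightarrow> 0"
    by (rule tendsto_sandwich[OF _ _ tendsto_const LIMSEQ_inverse_real_of_nat])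
      (use w in \<open>auto simp: inverse_eq_divide less_imp_le\<close>)
  then have "w \<longlonglongrightarrow> 0" by (simp add: tendsto_norm_zero_iff)
  from LIMSEQ_D[OF translate_continuous_seq[OF f this] e] obtain J
    where "cell_norm (\<lambda>x. f (x + w J) - f x) < e" by auto
  with we[of J] show False by simp
qed

end

section \<open>Weak gradients and line integrals\<close>

text \<open>The scalar notion behind \<open>has_weak_grad\<close>, for Borel functions.\<close>

definition weak_gradient :: "(real^3 \<Rightarrow> real) \<Rightarrow> (real^3 \<Rightarrow> real^3) \<Rightarrow> bool" where
  "weak_gradient u d \<longleftrightarrow> (\<forall>\<phi>\<in>test_functions. \<forall>j.
     (LBINT x. u x * partial j \<phi> x) = - (LBINT x. d x $ j * \<phi> x))"

text \<open>Lebesgue measure on the unit interval, as a measure on all reals; \<open>t\<close> is the parameter of a segment.\<close>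

definition unit_time :: "real measure" where
  "unit_time = density lborel (indicator {0..1})"

lemma sets_unit_time [simp, measurable_cong]: "sets unit_time = sets borel"
  and space_unit_time [simp]: "space unit_time = UNIV"
  by (simp_all add: unit_time_def)

lemma emeasure_unit_time: "emeasure unit_time UNIV = 1"
  by (simp add: unit_time_def emeasure_density)

lemma finite_unit_time: "finite_measure unit_time"
  by (rule finite_measureI) (simp add: emeasure_unit_time)

lemma vec_nth_measurable [measurable (raw)]:
  fixes f :: "'a \<Rightarrow> 'b::euclidean_space ^ 'n"
  assumes "f \<in> borel_measurable M" shows "(\<lambda>x. f x $ i) \<in> borel_measurable M"
  by (rule measurable_compose[OF assms])
    (intro borel_measurable_continuous_onI linear_continuous_on bounded_linear_vec_nth)

lemma integral_unit_time:
  fixes f :: "real \<Rightarrow> real"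
  assumes [measurable]: "f \<in> borel_measurable borel"
  shows "(LINT t|unit_time. f t) = (LBINT t. f t * indicator {0..1} t)"
proof -
  have "(\<integral>t. f t \<partial>density lborel (\<lambda>t. ennreal (indicator {0..1} t))) = (LBINT t. indicator {0..1} t *\<^sub>R f t)"
    by (rule integral_density) auto
  then show ?thesis by (simp add: unit_time_def ennreal_indicator mult.commute)
qed

lemma AE_unit_time: "AE t in unit_time. 0 \<le> t \<and> t \<le> 1"
  unfolding unit_time_def by (subst AE_density) (auto simp: indicator_def)

text \<open>Jensen's inequality. If \<open>f\<close> is not square integrable, then the right-hand side is infinite.\<close>

lemma square_integral_unit_time_le:
  fixes f :: "real \<Rightarrow> real"
  assumes [measurable]: "f \<in> borel_measurable borel"
  shows "ennreal ((LINT t|unit_time. f t)\<^sup>2) \<le> (\<integral>\<^sup>+t. ennreal ((f t)\<^sup>2) \<partial>unit_time)"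
proof (cases "f \<in> L2 unit_time")
  case True
  have "(\<lambda>t. 1::real) \<in> L2 unit_time" by (rule L2_const[OF finite_unit_time])
  from L2_Cauchy_Schwarz[OF True this]
  have "\<bar>\<integral>t. f t \<partial>unit_time\<bar> \<le> norm2 unit_time f"
    by (simp add: norm2_def measure_def emeasure_unit_time)
  then have "(LINT t|unit_time. f t)\<^sup>2 \<le> (norm2 unit_time f)\<^sup>2" by (simp add: abs_le_square_iff[symmetric])
  then show ?thesis using norm2_nn[OF True] by (simp add: ennreal_leI)
next
  case False
  then have "(\<integral>\<^sup>+t. ennreal ((f t)\<^sup>2) \<partial>unit_time) = \<infinity>"
    by (auto simp: L2_def integrable_iff_bounded less_top[symmetric])
  then show ?thesis by simp
qed

lemma lborel_integral_translate:
  fixes f :: "real^3 \<Rightarrow> real"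
  assumes [measurable]: "f \<in> borel_measurable borel"
  shows "(LBINT x. f (x + z)) = (LBINT x. f x)"
proof -
  have "(LBINT x. f x) = (\<integral>x. f x \<partial>distr lborel borel ((+) z))" by (simp add: lborel_distr_plus)
  also have "\<dots> = (LBINT x. f (z + x))" by (rule integral_distr) auto
  finally show ?thesis by (simp add: add.commute)
qed

lemma integrable_pair_bounded_slices:
  fixes F :: "'a \<Rightarrow> 'b \<Rightarrow> real"
  assumes M: "sigma_finite_measure M" and T: "finite_measure T"
    and F [measurable]: "case_prod F \<in> borel_measurable (M \<Otimes>\<^sub>M T)"
    and b: "\<And>t. (\<integral>\<^sup>+x. ennreal \<bar>F x t\<bar> \<partial>M) \<le> ennreal B"
  shows "integrable (M \<Otimes>\<^sub>M T) (case_prod F)"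
proof -
  interpret T: finite_measure T by (rule T)
  interpret P: pair_sigma_finite M T
    by (intro pair_sigma_finite.intro M T.sigma_finite_measure_axioms)
  have "(\<integral>\<^sup>+p. ennreal (norm (case_prod F p)) \<partial>(M \<Otimes>\<^sub>M T)) = (\<integral>\<^sup>+t. \<integral>\<^sup>+x. ennreal \<bar>F x t\<bar> \<partial>M \<partial>T)"
    by (subst P.nn_integral_snd[symmetric]) auto
  also have "\<dots> \<le> (\<integral>\<^sup>+t. ennreal B \<partial>T)" by (intro nn_integral_mono b)
  also have "\<dots> < \<infinity>" by (auto simp: ennreal_mult_eq_top_iff less_top[symmetric])
  finally show ?thesis by (intro integrableI_bounded F)
qed

text \<open>The fundamental theorem of calculus on the segment from \<open>x\<close> to \<open>x - z\<close>.\<close>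

lemma test_function_translation_integral:
  assumes \<phi>: "\<phi> \<in> test_functions"
  shows "\<phi> (x - z) - \<phi> x = - (LINT t|unit_time. (\<Sum>j\<in>UNIV. z $ j * partial j \<phi> (x - t *\<^sub>R z)))"
proof -
  note cp = test_function_continuous(2)[OF \<phi>]
  let ?p = "\<lambda>t. \<Sum>j\<in>UNIV. z $ j * partial j \<phi> (x - t *\<^sub>R z)"
  have c: "continuous_on UNIV ?p"
    by (intro continuous_intros continuous_on_compose2[OF cp]) auto
  have D: "((\<lambda>t. \<phi> (x - t *\<^sub>R z)) has_real_derivative - ?p t) (at t)" for t
  proof -
    have "((\<lambda>t. x - t *\<^sub>R z) has_derivative (\<lambda>s. - (s *\<^sub>R z))) (at t)"
      by (auto intro!: derivative_eq_intros)
    from has_derivative_compose[OF this test_function_has_derivative[OF \<phi>]]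
    show ?thesis
      unfolding has_field_derivative_def
      by (rule has_derivative_eq_rhs) (simp add: fun_eq_iff sum_distrib_left sum_negf ac_simps)
  qed
  have "(LBINT t. (- ?p t) * indicator {0..1} t) = \<phi> (x - 1 *\<^sub>R z) - \<phi> (x - 0 *\<^sub>R z)"
    by (rule integral_FTC_Icc_real) (use D c in \<open>auto simp: continuous_on_eq_continuous_at intro!: continuous_minus\<close>)
  moreover have "?p \<in> borel_measurable borel" by (rule borel_measurable_continuous_onI[OF c])
  ultimately show ?thesis by (simp add: integral_unit_time)
qed

lemma weak_gradient_unique:
  assumes [measurable]: "d \<in> borel_measurable borel" "d' \<in> borel_measurable borel"
    "u \<in> borel_measurable borel" "u' \<in> borel_measurable borel"
    and int: "\<And>a b. integrable lborel (\<lambda>x. indicator (cbox a b) x *\<^sub>R d x)"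
      "\<And>a b. integrable lborel (\<lambda>x. indicator (cbox a b) x *\<^sub>R d' x)"
    and w: "weak_gradient u d" "weak_gradient u' d'" and eq: "AE x in lborel. u x = u' x"
  shows "AE x in lborel. d x = d' x"
proof -
  have "AE x in lborel. d x $ j - d' x $ j = 0" for j
  proof (rule fundamental_lemma)
    show "(\<lambda>x. d x $ j - d' x $ j) \<in> borel_measurable borel" by measurable
    have i: "integrable lborel (\<lambda>x. indicator (cbox a b) x * d x $ j)"
      "integrable lborel (\<lambda>x. indicator (cbox a b) x * d' x $ j)" for a b
      using int[THEN integrable_bounded_linear[OF bounded_linear_vec_nth[of j]], of a b] by simp_all
    show "integrable lborel (\<lambda>x. indicator (cbox a b) x * (d x $ j - d' x $ j))" for a b
      using Bochner_Integration.integrable_diff[OF i(1)[of a b] i(2)[of a b]] by (simp add: algebra_simps)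
    fix \<phi> assume \<phi>: "\<phi> \<in> test_functions"
    obtain R C where C: "C > 0" and R: "\<And>x. \<bar>\<phi> x\<bar> \<le> C * indicator (cball 0 R) x"
      and "\<And>j x. \<bar>partial j \<phi> x\<bar> \<le> C * indicator (cball 0 R) x"
      using test_function_bounds[OF \<phi>] by blast
    note [measurable] = test_function_borel[OF \<phi>]
    obtain a b where ab: "cball 0 R \<subseteq> cbox a (b :: real^3)"
      using bounded_subset_cbox_symmetric[OF bounded_cball[of "0 :: real^3" R]] by blast
    have bd: "\<bar>\<phi> x\<bar> \<le> C * indicator (cbox a b) x" for x
      using R[of x] ab C by (cases "x \<in> cball 0 R") (auto simp: indicator_def)
    have "integrable lborel (\<lambda>x. h x * \<phi> x)"
      if h: "integrable lborel (\<lambda>x. indicator (cbox a b) x * h x)" "h \<in> borel_measurable borel" for h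
    proof -
      note [measurable] = h(2)
      have "integrable lborel (\<lambda>x. C * (indicator (cbox a b) x * h x))" using h(1) by simp
      then show ?thesis
      proof (rule Bochner_Integration.integrable_bound)
        have "\<bar>h x\<bar> * \<bar>\<phi> x\<bar> \<le> \<bar>h x\<bar> * (C * indicator (cbox a b) x)" for x by (intro mult_left_mono bd) simp
        then show "AE x in lborel. norm (h x * \<phi> x) \<le> norm (C * (indicator (cbox a b) x * h x))"
          using C by (simp add: abs_mult ac_simps)
      qed measurable
    qed
    then have "integrable lborel (\<lambda>x. d x $ j * \<phi> x)" "integrable lborel (\<lambda>x. d' x $ j * \<phi> x)"
      using i by simp_all
    then have "(LBINT x. (d x $ j - d' x $ j) * \<phi> x) = (LBINT x. d x $ j * \<phi> x) - (LBINT x. d' x $ j * \<phi> x)"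
      by (simp add: left_diff_distrib)
    also have "\<dots> = (LBINT x. u' x * partial j \<phi> x) - (LBINT x. u x * partial j \<phi> x)"
      using w \<phi> by (simp add: weak_gradient_def)
    also have "(LBINT x. u x * partial j \<phi> x) = (LBINT x. u' x * partial j \<phi> x)"
      using eq by (intro integral_cong_AE) auto
    finally show "(LBINT x. (d x $ j - d' x $ j) * \<phi> x) = 0" by simp
  qed
  then have "AE x in lborel. \<forall>j. d x $ j - d' x $ j = 0" by (simp add: AE_all_countable)
  then show ?thesis by eventually_elim (simp add: vec_eq_iff)
qed

context lattice_basis
begin

lemma sigma_finite_cell: "sigma_finite_measure \<mu>"
  using finite_cell_measure by (rule finite_measure.axioms(1))

lemma L2_inv_nth: "f \<in> L2_inv \<Longrightarrow> (\<lambda>x. f x $ i) \<in> L2_inv" for f :: "real^3 \<Rightarrow> 'c::euclidean_space^3"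
  by (rule L2_inv_bounded_linear[OF bounded_linear_vec_nth])

lemma L2_inv_inner: "f \<in> L2_inv \<Longrightarrow> (\<lambda>x. f x \<bullet> z) \<in> L2_inv"
  by (rule L2_inv_bounded_linear[OF bounded_linear_inner_left])

text \<open>Compact support of \<open>\<psi>\<close> reduces the integral to finitely many cells, where the norm over a single cell
controls everything.\<close>

lemma pairing_bound:
  assumes [measurable]: "\<psi> \<in> borel_measurable borel" and bd: "\<And>x. \<bar>\<psi> x\<bar> \<le> C * indicator (cball 0 R) x"
  shows "\<exists>B\<ge>0. \<forall>u\<in>L2_inv. (\<integral>\<^sup>+x. ennreal \<bar>u x * \<psi> x\<bar> \<partial>lborel) \<le> ennreal (B * cell_norm u)
    \<and> integrable lborel (\<lambda>x. u x * \<psi> x)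
    \<and> \<bar>\<integral>x. u x * \<psi> x \<partial>lborel\<bar> \<le> B * cell_norm u"
proof -
  obtain c where c: "c \<ge> 0" "\<And>f. f \<in> borel_measurable borel \<Longrightarrow> invariant f \<Longrightarrow>
    (\<integral>\<^sup>+x\<in>cball 0 R. f x \<partial>lborel) \<le> ennreal c * (\<integral>\<^sup>+x. f x \<partial>\<mu>)"
    using nn_integral_bounded_set[OF bounded_cball[of 0 R]] by blast
  have [measurable]: "cball 0 R \<in> sets (borel :: (real^3) measure)" by simp
  define m where "m = sqrt (measure \<mu> UNIV)"
  define B where "B = \<bar>C\<bar> * (c * m)"
  have nn: "(\<integral>\<^sup>+x. ennreal \<bar>u x * \<psi> x\<bar> \<partial>lborel) \<le> ennreal (B * cell_norm u)" if u: "u \<in> L2_inv" for u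
  proof -
    note [measurable] = L2_inv_borel[OF u]
    have "(\<integral>\<^sup>+x. ennreal \<bar>u x * \<psi> x\<bar> \<partial>lborel) \<le> (\<integral>\<^sup>+x. ennreal \<bar>C\<bar> * (ennreal \<bar>u x\<bar> * indicator (cball 0 R) x) \<partial>lborel)"
    proof (rule nn_integral_mono)
      fix x
      have "\<bar>u x\<bar> * \<bar>\<psi> x\<bar> \<le> \<bar>u x\<bar> * (\<bar>C\<bar> * indicator (cball 0 R) x)"
        using bd[of x] by (intro mult_left_mono) (auto simp: indicator_def)
      then have "ennreal \<bar>u x * \<psi> x\<bar> \<le> ennreal (\<bar>C\<bar> * (\<bar>u x\<bar> * indicator (cball 0 R) x))"
        by (intro ennreal_leI) (simp add: abs_mult ac_simps)
      then show "ennreal \<bar>u x * \<psi> x\<bar> \<le> ennreal \<bar>C\<bar> * (ennreal \<bar>u x\<bar> * indicator (cball 0 R) x)"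
        by (simp add: ennreal_mult ennreal_indicator)
    qed
    also have "\<dots> = ennreal \<bar>C\<bar> * (\<integral>\<^sup>+x\<in>cball 0 R. ennreal \<bar>u x\<bar> \<partial>lborel)"
      by (rule nn_integral_cmult) measurable
    also have "\<dots> \<le> ennreal \<bar>C\<bar> * (ennreal c * (\<integral>\<^sup>+x. ennreal \<bar>u x\<bar> \<partial>\<mu>))"
      using L2_inv_invariant[OF u] by (intro mult_left_mono c) (auto simp: invariant_def)
    also have "(\<integral>\<^sup>+x. ennreal \<bar>u x\<bar> \<partial>\<mu>) = ennreal (LINT x|\<mu>. norm (u x))"
      using L2_integrable_norm(1)[OF finite_cell_measure L2_inv_L2[OF u]]
      by (subst nn_integral_eq_integral) auto
    also have "\<dots> \<le> ennreal (m * cell_norm u)"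
      using L2_integrable_norm(3)[OF finite_cell_measure L2_inv_L2[OF u]] by (intro ennreal_leI) (simp add: m_def)
    finally show ?thesis using c(1) by (simp add: B_def ennreal_mult m_def mult.assoc mult_left_mono)
  qed
  have i: "integrable lborel (\<lambda>x. u x * \<psi> x)" if u: "u \<in> L2_inv" for u
  proof (rule integrableI_bounded)
    note [measurable] = L2_inv_borel[OF u]
    show "(\<lambda>x. u x * \<psi> x) \<in> borel_measurable lborel" by measurable
    show "(\<integral>\<^sup>+x. ennreal (norm (u x * \<psi> x)) \<partial>lborel) < \<infinity>" using nn[OF u] by (auto intro: le_less_trans)
  qed
  show ?thesis
  proof (intro exI[of _ B] conjI ballI nn i)
    show B0: "B \<ge> 0" using c(1) by (simp add: B_def m_def)
    fix u :: "real^3 \<Rightarrow> real" assume u: "u \<in> L2_inv"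
    have "ennreal (norm (LBINT x. u x * \<psi> x)) \<le> (\<integral>\<^sup>+x. ennreal (norm (u x * \<psi> x)) \<partial>lborel)"
      by (rule integral_norm_bound_ennreal[OF i[OF u]])
    also have "\<dots> \<le> ennreal (B * cell_norm u)" using nn[OF u] by simp
    finally show "\<bar>\<integral>x. u x * \<psi> x \<partial>lborel\<bar> \<le> B * cell_norm u"
      using B0 by (simp add: ennreal_le_iff)
  qed
qed

lemma pairing_integrable:
  fixes u :: "real^3 \<Rightarrow> real" and \<psi> :: "real^3 \<Rightarrow> real"
  assumes "u \<in> L2_inv" "\<psi> \<in> borel_measurable borel" "\<And>x. \<bar>\<psi> x\<bar> \<le> C * indicator (cball 0 R) x"
  shows "integrable lborel (\<lambda>x. u x * \<psi> x)"
  using pairing_bound[OF assms(2,3)] assms(1) by blast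

lemma integrable_along_lines:
  fixes w :: "real^3 \<Rightarrow> real"
  assumes w: "w \<in> L2_inv" and [measurable]: "\<psi> \<in> borel_measurable borel"
    and bd: "\<And>x. \<bar>\<psi> x\<bar> \<le> C * indicator (cball 0 R) x"
  shows "integrable (lborel \<Otimes>\<^sub>M unit_time) (\<lambda>(x, t). w (x + t *\<^sub>R z) * \<psi> x)"
    and "integrable (lborel \<Otimes>\<^sub>M unit_time) (\<lambda>(x, t). w x * \<psi> (x - t *\<^sub>R z))"
proof -
  note [measurable] = L2_inv_borel[OF w]
  obtain B where "B \<ge> 0"
    and B: "\<And>u. u \<in> L2_inv \<Longrightarrow> (\<integral>\<^sup>+x. ennreal \<bar>u x * \<psi> x\<bar> \<partial>lborel) \<le> ennreal (B * cell_norm u)"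
    using pairing_bound[OF assms(2) bd] by blast
  have b1: "(\<integral>\<^sup>+x. ennreal \<bar>w (x + t *\<^sub>R z) * \<psi> x\<bar> \<partial>lborel) \<le> ennreal (B * cell_norm w)" for t
    using B[OF L2_inv_translate(1)[OF w]] L2_inv_translate(2)[OF w] by simp
  show "integrable (lborel \<Otimes>\<^sub>M unit_time) (\<lambda>(x, t). w (x + t *\<^sub>R z) * \<psi> x)"
    by (rule integrable_pair_bounded_slices[OF sigma_finite_lborel finite_unit_time _ b1]) measurable
  have "(\<integral>\<^sup>+x. ennreal \<bar>w x * \<psi> (x - t *\<^sub>R z)\<bar> \<partial>lborel) = (\<integral>\<^sup>+x. ennreal \<bar>w (x + t *\<^sub>R z) * \<psi> x\<bar> \<partial>lborel)" for t
    using lborel_nn_integral_translate[of "\<lambda>x. ennreal \<bar>w x * \<psi> (x - t *\<^sub>R z)\<bar>" "t *\<^sub>R z"] by simp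
  then have b2: "(\<integral>\<^sup>+x. ennreal \<bar>w x * \<psi> (x - t *\<^sub>R z)\<bar> \<partial>lborel) \<le> ennreal (B * cell_norm w)" for t
    using b1 by simp
  show "integrable (lborel \<Otimes>\<^sub>M unit_time) (\<lambda>(x, t). w x * \<psi> (x - t *\<^sub>R z))"
    by (rule integrable_pair_bounded_slices[OF sigma_finite_lborel finite_unit_time _ b2]) measurable
qed

lemma pair_lborel_time: "pair_sigma_finite (lborel :: (real^3) measure) unit_time"
  and pair_cell_time: "pair_sigma_finite \<mu> unit_time"
  and pair_cell_cell: "pair_sigma_finite \<mu> \<mu>"
  by (intro pair_sigma_finite.intro sigma_finite_lborel sigma_finite_cell finite_measure.axioms(1)[OF finite_unit_time])+

lemma AE_integrable_along_lines:
  fixes w :: "real^3 \<Rightarrow> real"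
  assumes w: "w \<in> L2_inv"
  shows "AE x in \<mu>. integrable unit_time (\<lambda>t. w (x + t *\<^sub>R z))"
proof -
  interpret pair_sigma_finite \<mu> unit_time by (rule pair_cell_time)
  note [measurable] = L2_inv_borel[OF w]
  have "integrable (\<mu> \<Otimes>\<^sub>M unit_time) (\<lambda>(x, t). w (x + t *\<^sub>R z))"
  proof (rule integrable_pair_bounded_slices[OF sigma_finite_cell finite_unit_time])
    show "(\<lambda>(x, t). w (x + t *\<^sub>R z)) \<in> borel_measurable (\<mu> \<Otimes>\<^sub>M unit_time)" by measurable
    fix t
    have "(\<integral>\<^sup>+x. ennreal \<bar>w (x + t *\<^sub>R z)\<bar> \<partial>\<mu>) = (\<integral>\<^sup>+x. ennreal \<bar>w x\<bar> \<partial>\<mu>)"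
      using L2_inv_invariant[OF w]
      by (intro nn_integral_cell_translate[where f = "\<lambda>x. ennreal \<bar>w x\<bar>"]) (auto simp: invariant_def)
    also have "\<dots> = ennreal (LINT x|\<mu>. norm (w x))"
      using L2_integrable_norm(1)[OF finite_cell_measure L2_inv_L2[OF w]]
      by (subst nn_integral_eq_integral) auto
    finally show "(\<integral>\<^sup>+x. ennreal \<bar>w (x + t *\<^sub>R z)\<bar> \<partial>\<mu>) \<le> ennreal (LINT x|\<mu>. norm (w x))" by simp
  qed
  from AE_integrable_fst[OF this] show ?thesis .
qed

text \<open>Tested against \<open>\<phi>\<close>, the left-hand side is the integral of \<open>u\<close> against \<open>\<phi> (x - z) - \<phi> x\<close>, because the
translation can be moved to \<open>\<phi>\<close>. This difference is an integral of derivatives of \<open>\<phi>\<close> along the segment,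
to which the weak formulation applies for each \<open>t\<close>; moving the translation back gives the right-hand side.
The fundamental lemma removes \<open>\<phi>\<close>.\<close>

lemma weak_gradient_line_integral:
  assumes u: "u \<in> L2_inv" and d: "d \<in> L2_inv" and wg: "weak_gradient u d"
  shows "AE x in lborel. u (x + z) - u x = (LINT t|unit_time. d (x + t *\<^sub>R z) \<bullet> z)"
proof -
  interpret pair_sigma_finite "lborel :: (real^3) measure" unit_time by (rule pair_lborel_time)
  define w where "w x = d x \<bullet> z" for x
  have w: "w \<in> L2_inv" unfolding w_def by (rule L2_inv_inner[OF d])
  note [measurable] = L2_inv_borel[OF u] L2_inv_borel[OF d] L2_inv_borel[OF w]
  define L where "L x = (LINT t|unit_time. w (x + t *\<^sub>R z))" for x
  have Lm [measurable]: "L \<in> borel_measurable borel"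
  proof -
    have "(\<lambda>(x, t). w (x + t *\<^sub>R z)) \<in> borel_measurable (borel \<Otimes>\<^sub>M unit_time)" by measurable
    from sigma_finite_measure.borel_measurable_lebesgue_integral[OF finite_measure.axioms(1)[OF finite_unit_time] this] show ?thesis by (simp add: L_def[abs_def])
  qed
  have Lint: "integrable lborel (\<lambda>x. L x * \<psi> x)"
    and Lswap: "(LBINT x. L x * \<psi> x) = (LINT t|unit_time. (LBINT x. w (x + t *\<^sub>R z) * \<psi> x))"
    if "\<psi> \<in> borel_measurable borel" "\<And>x. \<bar>\<psi> x\<bar> \<le> C * indicator (cball 0 R) x" for \<psi> C R
    using integrable_fst[OF integrable_along_lines(1)[OF w that]]
      Fubini_integral[OF integrable_along_lines(1)[OF w that]] by (simp_all add: L_def)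
  have uz: "(\<lambda>x. u (x + z)) \<in> L2_inv" by (rule L2_inv_translate(1)[OF u])
  have "AE x in lborel. (u (x + z) - u x) - L x = 0"
  proof (rule fundamental_lemma)
    show "(\<lambda>x. (u (x + z) - u x) - L x) \<in> borel_measurable borel" by measurable
    fix a b :: "real^3"
    obtain R where R: "\<forall>x\<in>cbox a b. norm x \<le> R"
      using bounded_cbox[of a b] by (auto simp: bounded_iff)
    have bd: "\<bar>indicator (cbox a b) x :: real\<bar> \<le> 1 * indicator (cball 0 R) x" for x
      using R by (auto simp: indicator_def)
    have m: "(indicator (cbox a b) :: _ \<Rightarrow> real) \<in> borel_measurable borel" by simp
    have "integrable lborel (\<lambda>x. u (x + z) * indicator (cbox a b) x)" "integrable lborel (\<lambda>x. u x * indicator (cbox a b) x)"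
      by (intro pairing_integrable[OF _ m bd] u uz)+
    with Lint[OF m bd] have "integrable lborel (\<lambda>x. u (x + z) * indicator (cbox a b) x - u x * indicator (cbox a b) x - L x * indicator (cbox a b) x)"
      by (intro Bochner_Integration.integrable_diff)
    then show "integrable lborel (\<lambda>x. indicator (cbox a b) x * ((u (x + z) - u x) - L x))"
      by (simp add: algebra_simps)
  next
    fix \<phi> assume \<phi>: "\<phi> \<in> test_functions"
    obtain R C where C: "C > 0" and R: "\<And>x. \<bar>\<phi> x\<bar> \<le> C * indicator (cball 0 R) x"
      and Rp: "\<And>j x. \<bar>partial j \<phi> x\<bar> \<le> C * indicator (cball 0 R) x"
      using test_function_bounds[OF \<phi>] by blast
    note \<phi>m [measurable] = test_function_borel(1)[OF \<phi>] and \<phi>pm [measurable] = test_function_borel(2)[OF \<phi>]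
    define \<psi> where "\<psi> x = (\<Sum>j\<in>UNIV. z $ j * partial j \<phi> x)" for x
    have \<psi>m [measurable]: "\<psi> \<in> borel_measurable borel" unfolding \<psi>_def by measurable
    have \<psi>b: "\<bar>\<psi> x\<bar> \<le> ((\<Sum>j\<in>UNIV. \<bar>z $ j\<bar>) * C) * indicator (cball 0 R) x" for x
    proof -
      have "\<bar>\<psi> x\<bar> \<le> (\<Sum>j\<in>UNIV. \<bar>z $ j\<bar> * (C * indicator (cball 0 R) x))"
        unfolding \<psi>_def by (rule order_trans[OF sum_abs]) (auto simp: abs_mult intro!: sum_mono mult_left_mono Rp)
      then show ?thesis by (simp add: sum_distrib_right mult.assoc)
    qed
    have diff: "\<phi> (x - z) - \<phi> x = - (LINT t|unit_time. \<psi> (x - t *\<^sub>R z))" for x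
      unfolding \<psi>_def by (rule test_function_translation_integral[OF \<phi>])
    \<comment> \<open>The weak formulation for the translated test function, contracted with \<open>z\<close>.\<close>
    have wgt: "(LBINT x. u x * \<psi> (x - t *\<^sub>R z)) = - (LBINT x. w (x + t *\<^sub>R z) * \<phi> x)" for t
    proof -
      let ?\<phi> = "\<lambda>x. \<phi> (x + (- (t *\<^sub>R z)))"
      have \<phi>t: "?\<phi> \<in> test_functions" by (rule test_function_translate[OF \<phi>])
      have "Ck 1 \<phi>" using \<phi> by (auto simp: test_functions_def)
      then have pt: "partial j ?\<phi> = (\<lambda>x. partial j \<phi> (x - t *\<^sub>R z))" for j
        by (intro ext) (subst partial_translate, auto)
      obtain R' C' where "C' > 0" and R': "\<And>x. \<bar>?\<phi> x\<bar> \<le> C' * indicator (cball 0 R') x"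
        and Rp': "\<And>j x. \<bar>partial j ?\<phi> x\<bar> \<le> C' * indicator (cball 0 R') x"
        using test_function_bounds[OF \<phi>t] by blast
      have pm: "partial j ?\<phi> \<in> borel_measurable borel" for j unfolding pt by measurable
      have iu: "integrable lborel (\<lambda>x. u x * partial j ?\<phi> x)" for j
        by (rule pairing_integrable[OF u pm Rp'])
      have "?\<phi> \<in> borel_measurable borel" by measurable
      from pairing_integrable[OF L2_inv_nth[OF d] this R']
      have id: "integrable lborel (\<lambda>x. d x $ j * ?\<phi> x)" for j .
      have "(LBINT x. u x * \<psi> (x - t *\<^sub>R z)) = (LBINT x. (\<Sum>j\<in>UNIV. z $ j * (u x * partial j ?\<phi> x)))"
        unfolding \<psi>_def pt by (simp add: sum_distrib_left ac_simps)
      also have "\<dots> = (\<Sum>j\<in>UNIV. z $ j * (LBINT x. u x * partial j ?\<phi> x))"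
        using iu by simp
      also have "\<dots> = (\<Sum>j\<in>UNIV. z $ j * - (LBINT x. d x $ j * ?\<phi> x))"
        using wg \<phi>t unfolding weak_gradient_def by simp
      also have "\<dots> = - (LBINT x. (\<Sum>j\<in>UNIV. z $ j * (d x $ j * ?\<phi> x)))"
        using id by (simp add: sum_negf)
      also have "(LBINT x. (\<Sum>j\<in>UNIV. z $ j * (d x $ j * ?\<phi> x))) = (LBINT x. w x * \<phi> (x - t *\<^sub>R z))"
        by (simp add: w_def inner_vec_def sum_distrib_left ac_simps)
      also have "\<dots> = (LBINT x. w (x + t *\<^sub>R z) * \<phi> x)"
        using lborel_integral_translate[of "\<lambda>x. w x * \<phi> (x - t *\<^sub>R z)" "t *\<^sub>R z"] by simp
      finally show ?thesis .
    qed
    have iu: "integrable lborel (\<lambda>x. u x * \<phi> x)" "integrable lborel (\<lambda>x. u (x + z) * \<phi> x)"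
      by (intro pairing_integrable[OF _ \<phi>m R] u uz)+
    obtain R' C' where "C' > 0" and R': "\<And>x. \<bar>\<phi> (x + (- z))\<bar> \<le> C' * indicator (cball 0 R') x"
      and "\<And>j x. \<bar>partial j (\<lambda>x. \<phi> (x + (- z))) x\<bar> \<le> C' * indicator (cball 0 R') x"
      using test_function_bounds[OF test_function_translate[OF \<phi>]] by blast
    have "(\<lambda>x. \<phi> (x + (- z))) \<in> borel_measurable borel" by measurable
    from pairing_integrable[OF u this R'] have iuz: "integrable lborel (\<lambda>x. u x * \<phi> (x - z))" by simp
    have "(LBINT x. (u (x + z) - u x) * \<phi> x) = (LBINT x. u (x + z) * \<phi> x) - (LBINT x. u x * \<phi> x)"
      using iu by (simp add: left_diff_distrib)
    also have "(LBINT x. u (x + z) * \<phi> x) = (LBINT x. u x * \<phi> (x - z))"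
      using lborel_integral_translate[of "\<lambda>x. u x * \<phi> (x - z)" z] by simp
    also have "\<dots> - (LBINT x. u x * \<phi> x) = (LBINT x. u x * (\<phi> (x - z) - \<phi> x))"
      using iu iuz by (simp add: right_diff_distrib)
    also have "\<dots> = - (LBINT x. (LINT t|unit_time. u x * \<psi> (x - t *\<^sub>R z)))"
      unfolding diff by simp
    also have "(LBINT x. (LINT t|unit_time. u x * \<psi> (x - t *\<^sub>R z)))
        = (LINT t|unit_time. (LBINT x. u x * \<psi> (x - t *\<^sub>R z)))"
      by (rule Fubini_integral[OF integrable_along_lines(2)[OF u \<psi>m \<psi>b], symmetric])
    also have "\<dots> = - (LBINT x. L x * \<phi> x)"
      unfolding wgt using Lswap[OF \<phi>m R] by simp
    finally show "(LBINT x. ((u (x + z) - u x) - L x) * \<phi> x) = 0"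
      using Lint[OF \<phi>m R] iu by (simp add: left_diff_distrib)
  qed
  then show ?thesis by eventually_elim (simp add: L_def w_def)
qed

end

section \<open>The inequalities of Poincare and Korn\<close>

lemma transpose_nth: "transpose A $ i $ j = A $ j $ i"
  by (simp add: transpose_def)

lemma linear_transpose: "linear (transpose :: real^'n^'m \<Rightarrow> real^'m^'n)"
  by (rule linearI) (simp_all add: vec_eq_iff transpose_nth)

lemma bounded_linear_transpose: "bounded_linear (transpose :: real^'n^'m \<Rightarrow> real^'m^'n)"
  by (simp add: linear_transpose flip: linear_conv_bounded_linear)

lemma inner_matrix: "A \<bullet> B = (\<Sum>i\<in>UNIV. \<Sum>j\<in>UNIV. A $ i $ j * B $ i $ j)" for A B :: "real^'n^'m"
  by (simp add: inner_vec_def)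

lemma inner_transpose: "transpose A \<bullet> transpose B = A \<bullet> B" for A B :: "real^'n^'m"
  unfolding inner_matrix transpose_nth by (rule sum.swap)

lemma norm_transpose: "norm (transpose A) = norm A" for A :: "real^'n^'m"
  by (simp add: norm_eq_sqrt_inner inner_transpose)

definition symm :: "real^3^3 \<Rightarrow> real^3^3" where
  "symm A = (1/2) *\<^sub>R (A + transpose A)"

lemma linear_symm: "linear symm"
  by (rule linearI) (simp_all add: symm_def linear_add[OF linear_transpose] linear_scale[OF linear_transpose] algebra_simps)

lemma bounded_linear_symm: "bounded_linear symm"
  using linear_symm by (simp add: linear_conv_bounded_linear)

lemma norm_symm_le: "norm (symm A) \<le> norm A"
  using norm_triangle_ineq[of A "transpose A"] by (simp add: symm_def norm_transpose)

lemma transpose_symm: "transpose (symm A) = symm A"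
  by (simp add: symm_def vec_eq_iff transpose_nth)

lemma inner_symm: "transpose S = S \<Longrightarrow> S \<bullet> symm A = S \<bullet> A"
  using inner_transpose[of S A] by (simp add: symm_def inner_right_distrib)

lemma norm2_vec_le:
  fixes F :: "'a \<Rightarrow> 'b::euclidean_space^'n::finite"
  assumes "F \<in> L2 M" shows "norm2 M F \<le> (\<Sum>i\<in>UNIV. norm2 M (\<lambda>x. F x $ i))"
proof -
  have c: "(\<lambda>x. F x $ i) \<in> L2 M" for i
    by (rule L2_bounded_linear[OF bounded_linear_vec_nth assms])
  have pt: "(norm (F x))\<^sup>2 = (\<Sum>i\<in>UNIV. (norm (F x $ i))\<^sup>2)" for x
    by (simp add: norm_vec_def L2_set_def sum_nonneg)
  have "(norm2 M F)\<^sup>2 = (\<Sum>i\<in>UNIV. (norm2 M (\<lambda>x. F x $ i))\<^sup>2)"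
    unfolding norm2_sq pt using L2_integrable[OF c] by simp
  then have "norm2 M F = L2_set (\<lambda>i. norm2 M (\<lambda>x. F x $ i)) UNIV"
    unfolding L2_set_def by (metis norm2_nonneg real_sqrt_unique)
  also have "\<dots> \<le> (\<Sum>i\<in>UNIV. norm2 M (\<lambda>x. F x $ i))" by (intro L2_set_le_sum) simp
  finally show ?thesis .
qed

lemma norm2_matrix_le:
  fixes F :: "'a \<Rightarrow> real^'n::finite^'m::finite"
  assumes F: "F \<in> L2 M" shows "norm2 M F \<le> (\<Sum>i\<in>UNIV. \<Sum>j\<in>UNIV. norm2 M (\<lambda>x. F x $ i $ j))"
  by (intro order_trans[OF norm2_vec_le[OF F]] sum_mono norm2_vec_le
      L2_bounded_linear[OF bounded_linear_vec_nth F])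

context lattice_basis
begin

lemma L2_inv_sum: "finite I \<Longrightarrow> (\<And>i. i \<in> I \<Longrightarrow> f i \<in> L2_inv) \<Longrightarrow> (\<lambda>x. \<Sum>i\<in>I. f i x) \<in> L2_inv"
  by (induction I rule: finite_induct) (auto intro: L2_inv_const L2_inv_add)

lemma L2_inv_vec:
  fixes F :: "'n::finite \<Rightarrow> real^3 \<Rightarrow> 'b::euclidean_space"
  assumes "\<And>i. F i \<in> L2_inv" shows "(\<lambda>x. \<chi> i. F i x) \<in> L2_inv"
proof -
  have "bounded_linear (axis i :: 'b \<Rightarrow> 'b^'n)" for i
    unfolding linear_conv_bounded_linear[symmetric] by (rule linearI) (auto simp: axis_def vec_eq_iff)
  then have "(\<lambda>x. \<Sum>i\<in>UNIV. axis i (F i x)) \<in> L2_inv"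
    by (intro L2_inv_sum L2_inv_bounded_linear[OF _ assms]) auto
  moreover have "(\<Sum>i\<in>UNIV. axis i (F i x)) = (\<chi> i. F i x)" for x
    by (simp add: vec_eq_iff axis_def if_distrib cong: if_cong)
  ultimately show ?thesis by simp
qed

text \<open>Jensen's inequality in \<open>t\<close> and Tonelli's theorem: the norm of an average is at most the largest norm of
its members.\<close>

lemma L2_average_le:
  fixes Q :: "real^3 \<Rightarrow> real \<Rightarrow> real"
  assumes Q [measurable]: "case_prod Q \<in> borel_measurable (borel \<Otimes>\<^sub>M borel)"
    and [measurable]: "h \<in> borel_measurable borel"
    and h: "AE x in \<mu>. h x = (LINT t|unit_time. Q x t)"
    and b: "\<And>t. 0 \<le> t \<Longrightarrow> t \<le> 1 \<Longrightarrow> (\<integral>\<^sup>+x. ennreal ((Q x t)\<^sup>2) \<partial>\<mu>) \<le> ennreal (c\<^sup>2)" and "0 \<le> c"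
  shows "cell_norm h \<le> c"
proof (rule L2_nn_bound(2)[OF _ _ \<open>0 \<le> c\<close>])
  show "h \<in> borel_measurable \<mu>" by measurable
  interpret pair_sigma_finite \<mu> unit_time by (rule pair_cell_time)
  have Q': "(\<lambda>(x, t). ennreal ((Q x t)\<^sup>2)) \<in> borel_measurable (\<mu> \<Otimes>\<^sub>M unit_time)" by measurable
  have "(\<integral>\<^sup>+x. ennreal ((norm (h x))\<^sup>2) \<partial>\<mu>) = (\<integral>\<^sup>+x. ennreal ((LINT t|unit_time. Q x t)\<^sup>2) \<partial>\<mu>)"
    using h by (intro nn_integral_cong_AE) auto
  also have "\<dots> \<le> (\<integral>\<^sup>+x. (\<integral>\<^sup>+t. ennreal ((Q x t)\<^sup>2) \<partial>unit_time) \<partial>\<mu>)"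
    by (intro nn_integral_mono square_integral_unit_time_le) measurable
  also have "\<dots> = (\<integral>\<^sup>+t. (\<integral>\<^sup>+x. ennreal ((Q x t)\<^sup>2) \<partial>\<mu>) \<partial>unit_time)"
    by (rule Fubini'[OF Q', symmetric])
  also have "\<dots> \<le> (\<integral>\<^sup>+t. ennreal (c\<^sup>2) \<partial>unit_time)"
  proof (rule nn_integral_mono_AE, use AE_unit_time in eventually_elim)
    case (elim t)
    then show ?case using b by blast
  qed
  finally show "(\<integral>\<^sup>+x. ennreal ((norm (h x))\<^sup>2) \<partial>\<mu>) \<le> ennreal (c\<^sup>2)"
    by (simp add: emeasure_unit_time)
qed

lemma norm2_translate_diff_le:
  assumes u: "u \<in> L2_inv" and d: "d \<in> L2_inv" and wg: "weak_gradient u d"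
  shows "cell_norm (\<lambda>x. u (x + z) - u x) \<le> norm z * cell_norm d"
proof -
  define w where "w x = d x \<bullet> z" for x
  have w: "w \<in> L2_inv" unfolding w_def by (rule L2_inv_inner[OF d])
  note [measurable] = L2_inv_borel[OF u] L2_inv_borel[OF w]
  have "cell_norm (\<lambda>x. u (x + z) - u x) \<le> cell_norm w"
  proof (rule L2_average_le)
    show "(\<lambda>(x, t). w (x + t *\<^sub>R z)) \<in> borel_measurable (borel \<Otimes>\<^sub>M borel)" by measurable
    show "(\<lambda>x. u (x + z) - u x) \<in> borel_measurable borel" by measurable
    show "AE x in \<mu>. u (x + z) - u x = (LINT t|unit_time. w (x + t *\<^sub>R z))"
      unfolding w_def by (rule AE_cell_if_lborel[OF weak_gradient_line_integral[OF u d wg]])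
    show "(\<integral>\<^sup>+x. ennreal ((w (x + t *\<^sub>R z))\<^sup>2) \<partial>\<mu>) \<le> ennreal ((cell_norm w)\<^sup>2)" for t
      using norm2_nn[OF L2_inv_L2[OF L2_inv_translate(1)[OF w]], of "t *\<^sub>R z"] L2_inv_translate(2)[OF w] by simp
  qed simp
  also have "\<dots> \<le> cell_norm (\<lambda>x. norm z *\<^sub>R d x)"
    using L2_inv_L2[OF w] Cauchy_Schwarz_ineq2[of "d _" z]
    by (intro norm2_dominated L2_scaleR L2_inv_L2[OF d]) (auto simp: w_def mult.commute)
  finally show ?thesis by (simp add: norm2_scaleR)
qed

text \<open>The error of the difference quotient is the average over the segment of \<open>d (x + t h e\<^sub>j) - d x\<close>, component
\<open>j\<close>, and it is small in the mean because translations are continuous.\<close>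

lemma difference_quotient_L2:
  assumes u: "u \<in> L2_inv" and d: "d \<in> L2_inv" and wg: "weak_gradient u d" and e: "e > 0"
  shows "\<exists>\<delta>>0. \<forall>h. 0 < h \<and> h < \<delta> \<longrightarrow>
    cell_norm (\<lambda>x. (u (x + h *\<^sub>R axis j 1) - u x) / h - d x $ j) \<le> e"
proof -
  define w where "w x = d x $ j" for x
  have w: "w \<in> L2_inv" unfolding w_def by (rule L2_inv_nth[OF d])
  note [measurable] = L2_inv_borel[OF u] L2_inv_borel[OF w]
  obtain \<delta> where \<delta>: "\<delta> > 0" "\<And>z. norm z < \<delta> \<Longrightarrow> cell_norm (\<lambda>x. w (x + z) - w x) < e"
    using translate_continuous[OF w e] by blast
  have "cell_norm (\<lambda>x. (u (x + h *\<^sub>R axis j 1) - u x) / h - w x) \<le> e" if h: "0 < h" "h < \<delta>" for h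
  proof (rule L2_average_le)
    let ?z = "h *\<^sub>R axis j 1 :: real^3"
    show "(\<lambda>(x, t). w (x + t *\<^sub>R ?z) - w x) \<in> borel_measurable (borel \<Otimes>\<^sub>M borel)" by measurable
    show "(\<lambda>x. (u (x + ?z) - u x) / h - w x) \<in> borel_measurable borel" by measurable
    have dz: "d x \<bullet> ?z = h * w x" for x by (simp add: w_def inner_axis)
    show "AE x in \<mu>. (u (x + ?z) - u x) / h - w x = (LINT t|unit_time. w (x + t *\<^sub>R ?z) - w x)"
      using AE_cell_if_lborel[OF weak_gradient_line_integral[OF u d wg, of ?z]] AE_integrable_along_lines[OF w, of ?z]
    proof eventually_elim
      case (elim x)
      have "(LINT t|unit_time. w (x + t *\<^sub>R ?z) - w x) = (LINT t|unit_time. w (x + t *\<^sub>R ?z)) - (LINT t|unit_time. w x)"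
        by (intro Bochner_Integration.integral_diff elim finite_measure.integrable_const[OF finite_unit_time])
      moreover have "(LINT t|unit_time. w x) = w x" by (simp add: measure_def emeasure_unit_time)
      moreover have "u (x + ?z) - u x = h * (LINT t|unit_time. w (x + t *\<^sub>R ?z))"
        using elim(1) unfolding dz by simp
      ultimately show ?case using h by simp
    qed
    show "(\<integral>\<^sup>+x. ennreal ((w (x + t *\<^sub>R ?z) - w x)\<^sup>2) \<partial>\<mu>) \<le> ennreal (e\<^sup>2)" if t: "0 \<le> t" "t \<le> 1" for t
    proof -
      have "norm (t *\<^sub>R ?z) \<le> h" using t h by (simp add: norm_axis_1 mult_left_le_one_le)
      then have "cell_norm (\<lambda>x. w (x + t *\<^sub>R ?z) - w x) \<le> e" using \<delta>(2)[of "t *\<^sub>R ?z"] h by simp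
      then have "(cell_norm (\<lambda>x. w (x + t *\<^sub>R ?z) - w x))\<^sup>2 \<le> e\<^sup>2" by (intro power_mono) auto
      then show ?thesis
        using norm2_nn[OF L2_inv_L2[OF L2_inv_diff[OF L2_inv_translate(1)[OF w] w]], of "t *\<^sub>R ?z"]
        by (simp add: ennreal_leI)
    qed
  qed (use e in simp)
  then show ?thesis using \<delta>(1) by (auto simp: w_def)
qed

text \<open>For mean zero, the double integral of \<open>(u (x + z) - u x)\<^sup>2\<close> over \<open>x\<close> and \<open>z\<close> in the cell equals twice the volume of
the cell times \<open>\<parallel>u\<parallel>\<^sup>2\<close>, since for fixed \<open>x\<close> the point \<open>x + z\<close> runs through a full period. For fixed \<open>z\<close> it is at most
\<open>(\<bar>z\<bar> \<parallel>d\<parallel>)\<^sup>2\<close>, so the constant can be any bound of the vectors in the cell.\<close>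

lemma poincare:
  obtains r where "r \<ge> 0" "\<And>u d. u \<in> L2_inv \<Longrightarrow> d \<in> L2_inv \<Longrightarrow> weak_gradient u d \<Longrightarrow>
     (LINT x|\<mu>. u x) = 0 \<Longrightarrow> cell_norm u \<le> r * cell_norm d"
proof -
  obtain b where b: "\<And>x. x \<in> unit_cell \<Longrightarrow> norm x \<le> b" "b \<ge> 0"
    using unit_cell_subset compact_imp_bounded[OF compact_cell] unfolding bounded_pos
    by (metis less_imp_le subsetD)
  show ?thesis
  proof (rule that[OF b(2)])
    fix u d assume u: "u \<in> L2_inv" and d: "d \<in> L2_inv" and wg: "weak_gradient u d"
      and mean: "(LINT x|\<mu>. u x) = 0"
    note uL = L2_inv_L2[OF u]
    note [measurable] = L2_inv_borel[OF u]
    interpret finite_measure \<mu> by (rule finite_cell_measure)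
    interpret pair_sigma_finite \<mu> \<mu> by (rule pair_cell_cell)
    let ?N = "cell_norm u" and ?m = "measure \<mu> UNIV"
    have mE: "emeasure \<mu> UNIV = ennreal ?m" by (simp add: emeasure_eq_measure)
    \<comment> \<open>The mixed term of the square drops out because the mean of \<open>u\<close> is zero.\<close>
    have inner: "(\<integral>\<^sup>+z. ennreal ((u (x + z) - u x)\<^sup>2) \<partial>\<mu>) = ennreal (?N\<^sup>2 + ?m * (u x)\<^sup>2)" for x
    proof -
      have "(\<integral>\<^sup>+z. ennreal ((u (z + x) - u x)\<^sup>2) \<partial>\<mu>) = (\<integral>\<^sup>+z. ennreal ((u z - u x)\<^sup>2) \<partial>\<mu>)"
        using L2_inv_invariant[OF u]
        by (intro nn_integral_cell_translate[where f = "\<lambda>z. ennreal ((u z - u x)\<^sup>2)"]) (auto simp: invariant_def)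
      also have "\<dots> = ennreal ((cell_norm (\<lambda>z. u z - 1 *\<^sub>R u x))\<^sup>2)"
        using norm2_nn[OF L2_diff[OF uL L2_const[OF finite_cell_measure, of "u x"]]] by simp
      also have "(cell_norm (\<lambda>z. u z - 1 *\<^sub>R u x))\<^sup>2 = ?N\<^sup>2 + ?m * (u x)\<^sup>2"
        using norm2_sq_sub[OF uL L2_const[OF finite_cell_measure, of "u x"], of 1] mean
        by (simp add: norm2_sq)
      finally show ?thesis by (simp add: add.commute)
    qed
    have "(\<integral>\<^sup>+x. (\<integral>\<^sup>+z. ennreal ((u (x + z) - u x)\<^sup>2) \<partial>\<mu>) \<partial>\<mu>)
        = (\<integral>\<^sup>+x. ennreal (?N\<^sup>2) + ennreal ?m * ennreal ((norm (u x))\<^sup>2) \<partial>\<mu>)"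
      unfolding inner by (simp add: ennreal_mult)
    also have "\<dots> = ennreal (?N\<^sup>2) * ennreal ?m + ennreal ?m * ennreal (?N\<^sup>2)"
      by (subst nn_integral_add, simp, simp) (simp add: nn_integral_cmult norm2_nn[OF uL, simplified] mE)
    also have "\<dots> = ennreal (2 * ?m * ?N\<^sup>2)"
      by (simp flip: ennreal_mult ennreal_plus)
    finally have L: "(\<integral>\<^sup>+x. (\<integral>\<^sup>+z. ennreal ((u (x + z) - u x)\<^sup>2) \<partial>\<mu>) \<partial>\<mu>) = ennreal (2 * ?m * ?N\<^sup>2)" .
    let ?c = "b * cell_norm d"
    have "(\<lambda>(x, z). ennreal ((u (x + z) - u x)\<^sup>2)) \<in> borel_measurable (\<mu> \<Otimes>\<^sub>M \<mu>)" by measurable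
    from Fubini'[OF this] L
    have "ennreal (2 * ?m * ?N\<^sup>2) = (\<integral>\<^sup>+z. (\<integral>\<^sup>+x. ennreal ((u (x + z) - u x)\<^sup>2) \<partial>\<mu>) \<partial>\<mu>)" by simp
    also have "\<dots> \<le> (\<integral>\<^sup>+z. ennreal (?c\<^sup>2) \<partial>\<mu>)"
    proof (rule nn_integral_mono_AE, unfold AE_cell_measure, rule AE_I2, rule impI)
      fix z assume "z \<in> unit_cell"
      then have "cell_norm (\<lambda>x. u (x + z) - u x) \<le> ?c"
        using norm2_translate_diff_le[OF u d wg, of z] mult_right_mono[OF b(1), of z "cell_norm d"] by simp
      then have "(cell_norm (\<lambda>x. u (x + z) - u x))\<^sup>2 \<le> ?c\<^sup>2" by (intro power_mono) auto
      then show "(\<integral>\<^sup>+x. ennreal ((u (x + z) - u x)\<^sup>2) \<partial>\<mu>) \<le> ennreal (?c\<^sup>2)"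
        using norm2_nn[OF L2_diff[OF L2_inv_L2[OF L2_inv_translate(1)[OF u, of z]] uL]] by (simp add: ennreal_leI)
    qed
    also have "\<dots> = ennreal (?c\<^sup>2 * ?m)" by (simp add: mE ennreal_mult)
    finally have le: "2 * ?m * ?N\<^sup>2 \<le> ?c\<^sup>2 * ?m" by (simp add: ennreal_le_iff)
    have "(2 * ?N\<^sup>2) * ?m \<le> ?c\<^sup>2 * ?m" using le by (simp add: ac_simps)
    then have "2 * ?N\<^sup>2 \<le> ?c\<^sup>2" using cell_measure_pos by (rule mult_right_le_imp_le)
    then have "?N\<^sup>2 \<le> ?c\<^sup>2" using zero_le_power2[of ?N] by linarith
    then show "?N \<le> ?c" using b(2) by (intro power2_le_imp_le[of ?N ?c]) auto
  qed
qed

text \<open>The discrete form of \<open>\<integral> \<partial>\<^sub>jv\<^sub>i \<partial>\<^sub>iv\<^sub>j = \<integral> \<partial>\<^sub>iv\<^sub>i \<partial>\<^sub>jv\<^sub>j\<close>: expanding both products into four translated products,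
each term on the left is a common translate of one on the right, provided that the differences on the right
are taken backwards. The sum over \<open>i\<close> and \<open>j\<close> is then the integral of the squared discrete divergence.\<close>

lemma discrete_korn:
  fixes v :: "real^3 \<Rightarrow> real^3"
  assumes v: "v \<in> L2_inv"
  shows "0 \<le> (LINT x|\<mu>. (\<Sum>i\<in>UNIV. \<Sum>j\<in>UNIV. (v (x + h *\<^sub>R axis j 1) $ i - v x $ i) * (v (x + h *\<^sub>R axis i 1) $ j - v x $ j)))"
proof -
  define a where "a i = h *\<^sub>R (axis i 1 :: real^3)" for i
  have vi: "(\<lambda>x. v x $ i) \<in> L2_inv" for i by (rule L2_inv_nth[OF v])
  note [measurable] = L2_inv_borel[OF v]
  have int: "integrable \<mu> (\<lambda>x. v (x + p) $ i * v (x + q) $ j)" for p q i j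
    using L2_inner_integrable[OF L2_inv_L2[OF L2_inv_translate(1)[OF vi[of i], of p]]
        L2_inv_L2[OF L2_inv_translate(1)[OF vi[of j], of q]]]
    by simp
  define P where "P i p j q = (LINT x|\<mu>. v (x + p) $ i * v (x + q) $ j)"
    for i j :: 3 and p q :: "real^3"
  have Ptrans: "P i (p + c) j (q + c) = P i p j q" for i p j q c
  proof -
    have "invariant (\<lambda>x. v (x + p) $ i * v (x + q) $ j)"
      using invariant_translate[OF L2_inv_invariant[OF v], of p] invariant_translate[OF L2_inv_invariant[OF v], of q]
      by (simp add: invariant_def)
    from integral_cell_translate(1)[OF _ this, of c] show ?thesis by (simp add: P_def ac_simps)
  qed
  have L: "(LINT x|\<mu>. (v (x + a j) $ i - v x $ i) * (v (x + a i) $ j - v x $ j))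
      = P i (a j) j (a i) - P i (a j) j 0 - P i 0 j (a i) + P i 0 j 0" for i j
    using int[of "a j" i "a i" j] int[of "a j" i 0 j] int[of 0 i "a i" j] int[of 0 i 0 j]
    by (simp add: P_def algebra_simps)
  have R: "(LINT x|\<mu>. (v (x + 0) $ i - v (x - a i) $ i) * (v (x + 0) $ j - v (x - a j) $ j))
      = P i 0 j 0 - P i 0 j (- a j) - P i (- a i) j 0 + P i (- a i) j (- a j)" for i j
    using int[of 0 i 0 j] int[of 0 i "- a j" j] int[of "- a i" i 0 j] int[of "- a i" i "- a j" j]
    by (simp add: P_def algebra_simps)
  \<comment> \<open>The products are translated by \<open>- a i - a j\<close>, by \<open>- a j\<close> and by \<open>- a i\<close>, respectively; the last one stays.\<close>
  have eq: "(LINT x|\<mu>. (v (x + a j) $ i - v x $ i) * (v (x + a i) $ j - v x $ j))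
     = (LINT x|\<mu>. (v (x + 0) $ i - v (x - a i) $ i) * (v (x + 0) $ j - v (x - a j) $ j))" for i j
    unfolding L R
    using Ptrans[of i "a j" "- a i - a j" j "a i"] Ptrans[of i "a j" "- a j" j 0] Ptrans[of i 0 "- a i" j "a i"] by simp
  have d: "(\<lambda>x. v (x + p) $ i - v (x + q) $ i) \<in> L2 \<mu>" for p q i
    by (intro L2_diff L2_inv_L2 L2_inv_translate(1)[OF vi])
  have i1: "integrable \<mu> (\<lambda>x. (v (x + a j) $ i - v x $ i) * (v (x + a i) $ j - v x $ j))" for i j
    using L2_inner_integrable[OF d[of "a j" i 0] d[of "a i" j 0]] by simp
  have i2: "integrable \<mu> (\<lambda>x. (v (x + 0) $ i - v (x - a i) $ i) * (v (x + 0) $ j - v (x - a j) $ j))" for i j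
    using L2_inner_integrable[OF d[of 0 i "- a i"] d[of 0 j "- a j"]] by simp
  have "(LINT x|\<mu>. (\<Sum>i\<in>UNIV. \<Sum>j\<in>UNIV. (v (x + a j) $ i - v x $ i) * (v (x + a i) $ j - v x $ j)))
      = (\<Sum>i\<in>UNIV. \<Sum>j\<in>UNIV. (LINT x|\<mu>. (v (x + a j) $ i - v x $ i) * (v (x + a i) $ j - v x $ j)))"
    using i1 by simp
  also have "\<dots> = (LINT x|\<mu>. (\<Sum>i\<in>UNIV. \<Sum>j\<in>UNIV. (v (x + 0) $ i - v (x - a i) $ i) * (v (x + 0) $ j - v (x - a j) $ j)))"
    unfolding eq using i2 by simp
  also have "\<dots> = (LINT x|\<mu>. (\<Sum>i\<in>UNIV. v (x + 0) $ i - v (x - a i) $ i)\<^sup>2)"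
    by (simp only: power2_eq_square sum_product)
  also have "\<dots> \<ge> 0" by (rule Bochner_Integration.integral_nonneg) simp
  finally show ?thesis by (simp only: a_def)
qed

text \<open>For difference quotients, the cross term in \<open>\<parallel>Q + Q\<^sup>T\<parallel>\<^sup>2 = 2 \<parallel>Q\<parallel>\<^sup>2 + 2 \<integral> Q \<bullet> Q\<^sup>T\<close> is nonnegative by the
discrete identity, which is the inequality with \<open>Q\<close> in place of \<open>D\<close>. As the step tends to zero, \<open>Q\<close>
converges to \<open>D\<close> in the mean.\<close>

lemma korn:
  fixes v :: "real^3 \<Rightarrow> real^3" and D :: "real^3 \<Rightarrow> real^3^3"
  assumes v: "v \<in> L2_inv" and D: "D \<in> L2_inv" and wg: "\<And>i. weak_gradient (\<lambda>x. v x $ i) (\<lambda>x. D x $ i)"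
  shows "cell_norm D \<le> sqrt 2 * cell_norm (\<lambda>x. symm (D x))"
proof -
  have vi: "(\<lambda>x. v x $ i) \<in> L2_inv" for i by (rule L2_inv_nth[OF v])
  define Q where "Q h x = (\<chi> i j. (v (x + h *\<^sub>R axis j 1) $ i - v x $ i) / h)" for h x
  have QL: "Q h \<in> L2_inv" for h
  proof -
    have "(\<lambda>x. (v (x + h *\<^sub>R axis j 1) $ i - v x $ i) / h) \<in> L2_inv" for i j
      using L2_inv_scaleR[OF L2_inv_diff[OF L2_inv_translate(1)[OF vi] vi], where c = "inverse h"]
      by (simp add: divide_inverse mult.commute)
    then show ?thesis unfolding Q_def[abs_def] by (intro L2_inv_vec)
  qed
  have kornQ: "cell_norm (Q h) \<le> sqrt 2 * cell_norm (\<lambda>x. symm (Q h x))" for h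
  proof -
    let ?T = "\<lambda>x. transpose (Q h x)"
    note QL2 = L2_inv_L2[OF QL[of h]]
    have TL2: "?T \<in> L2 \<mu>" by (rule L2_bounded_linear[OF bounded_linear_transpose QL2])
    have "Q h x \<bullet> ?T x = (1 / h\<^sup>2) * (\<Sum>i\<in>UNIV. \<Sum>j\<in>UNIV.
        (v (x + h *\<^sub>R axis j 1) $ i - v x $ i) * (v (x + h *\<^sub>R axis i 1) $ j - v x $ j))" for x
      by (simp add: inner_matrix transpose_nth Q_def sum_distrib_left power2_eq_square)
    then have pos: "0 \<le> (LINT x|\<mu>. Q h x \<bullet> ?T x)"
      using discrete_korn[OF v, of h] by (simp add: zero_le_divide_iff)
    have "cell_norm ?T = cell_norm (Q h)" by (simp add: norm2_def norm_transpose)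
    with pos have "2 * (cell_norm (Q h))\<^sup>2 \<le> (cell_norm (\<lambda>x. Q h x + ?T x))\<^sup>2"
      using norm2_sq_add[OF QL2 TL2] by simp
    moreover have "cell_norm (\<lambda>x. Q h x + ?T x) = 2 * cell_norm (\<lambda>x. symm (Q h x))"
      unfolding symm_def by (subst norm2_scaleR) simp
    ultimately have "(cell_norm (Q h))\<^sup>2 \<le> (sqrt 2 * cell_norm (\<lambda>x. symm (Q h x)))\<^sup>2"
      by (simp add: power_mult_distrib power_divide)
    then show ?thesis by (rule power2_le_imp_le) simp
  qed
  show ?thesis
  proof (rule field_le_epsilon)
    fix \<epsilon> :: real assume \<epsilon>: "\<epsilon> > 0"
    \<comment> \<open>The nine entries of the matrix contribute at most \<open>9 e\<close>, which enters once directly and once multiplied by \<open>\<surd>2\<close>.\<close>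
    define e where "e = \<epsilon> / (9 * (1 + sqrt 2))"
    have e: "e > 0" using \<epsilon> by (simp add: e_def add_pos_nonneg)
    let ?close = "\<lambda>i j \<delta>. \<forall>h. 0 < h \<and> h < \<delta> \<longrightarrow>
        cell_norm (\<lambda>x. (v (x + h *\<^sub>R axis j 1) $ i - v x $ i) / h - D x $ i $ j) \<le> e"
    have "\<forall>i j. \<exists>\<delta>. \<delta> > 0 \<and> ?close i j \<delta>"
      using difference_quotient_L2[OF vi L2_inv_nth[OF D] wg e] by blast
    then obtain \<delta> where \<delta>: "\<forall>i j. \<delta> i j > 0 \<and> ?close i j (\<delta> i j)"
      unfolding choice_iff by blast
    define h where "h = Min (range (\<lambda>(i, j). \<delta> i j)) / 2"
    have "Min (range (\<lambda>(i, j). \<delta> i j)) > 0" using \<delta> by (subst Min_gr_iff) auto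
    then have h: "h > 0" "h < Min (range (\<lambda>(i, j). \<delta> i j))" by (auto simp: h_def)
    have "Min (range (\<lambda>(i, j). \<delta> i j)) \<le> \<delta> i j" for i j by (rule Min_le) (auto intro: image_eqI[of _ _ "(i, j)"])
    then have hd: "h < \<delta> i j" for i j using h(2) by (meson less_le_trans)
    have diffL: "(\<lambda>x. Q h x - D x) \<in> L2 \<mu>" by (rule L2_inv_L2[OF L2_inv_diff[OF QL D]])
    have "cell_norm (\<lambda>x. Q h x - D x) \<le> (\<Sum>i\<in>UNIV. \<Sum>j\<in>UNIV. cell_norm (\<lambda>x. (Q h x - D x) $ i $ j))"
      by (rule norm2_matrix_le[OF diffL])
    also have "\<dots> \<le> (\<Sum>i\<in>(UNIV::3 set). \<Sum>j\<in>(UNIV::3 set). e)"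
      using \<delta> h(1) hd by (intro sum_mono) (simp add: Q_def)
    finally have close: "cell_norm (\<lambda>x. Q h x - D x) \<le> 9 * e" by simp
    note QL2 = L2_inv_L2[OF QL[of h]] and DL2 = L2_inv_L2[OF D]
    note sQ = L2_bounded_linear[OF bounded_linear_symm QL2] and sD = L2_bounded_linear[OF bounded_linear_symm DL2]
    have "cell_norm (\<lambda>x. symm (Q h x) - symm (D x)) \<le> cell_norm (\<lambda>x. Q h x - D x)"
      using norm_symm_le[of "Q h _ - D _"] by (intro norm2_dominated diffL L2_measurable[OF L2_diff[OF sQ sD]])
        (simp add: linear_diff[OF linear_symm])
    then have s: "cell_norm (\<lambda>x. symm (Q h x)) \<le> cell_norm (\<lambda>x. symm (D x)) + 9 * e"
      using norm2_triangle[OF L2_diff[OF sQ sD] sD] close by simp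
    have "cell_norm D \<le> cell_norm (Q h) + 9 * e"
      using norm2_triangle[OF L2_diff[OF DL2 QL2] QL2] close norm2_minus_commute[of \<mu> D "Q h"] by simp
    also have "\<dots> \<le> sqrt 2 * (cell_norm (\<lambda>x. symm (D x)) + 9 * e) + 9 * e"
      using order_trans[OF kornQ[of h] mult_left_mono[OF s real_sqrt_ge_zero[of 2]]] by simp
    also have "\<dots> = sqrt 2 * cell_norm (\<lambda>x. symm (D x)) + (9 * (1 + sqrt 2)) * e" by (simp add: algebra_simps)
    also have "(9 * (1 + sqrt 2)) * e = \<epsilon>"
      using add_pos_nonneg[of 1 "sqrt 2"] by (simp add: e_def)
    finally show "cell_norm D \<le> sqrt 2 * cell_norm (\<lambda>x. symm (D x)) + \<epsilon>" .
  qed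
qed

text \<open>Pairings with a fixed test function are continuous in the norm over the cell.\<close>

lemma weak_gradient_L2_limit:
  assumes un: "\<And>n. u n \<in> L2_inv" and dn: "\<And>n. d n \<in> L2_inv" and wg: "\<And>n. weak_gradient (u n) (d n)"
    and U: "U \<in> L2_inv" and E: "E \<in> L2_inv"
    and lu: "(\<lambda>n. cell_norm (\<lambda>x. u n x - U x)) \<longlonglongrightarrow> 0"
    and ld: "(\<lambda>n. cell_norm (\<lambda>x. d n x - E x)) \<longlonglongrightarrow> 0"
  shows "weak_gradient U E"
  unfolding weak_gradient_def
proof (intro ballI allI)
  fix \<phi> j assume \<phi>: "\<phi> \<in> test_functions"
  obtain R C where R: "\<And>x. \<bar>\<phi> x\<bar> \<le> C * indicator (cball 0 R) x"
    "\<And>j x. \<bar>partial j \<phi> x\<bar> \<le> C * indicator (cball 0 R) x" using test_function_bounds[OF \<phi>] by blast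
  have lim: "(\<lambda>n. \<integral>x. f n x * \<psi> x \<partial>lborel) \<longlonglongrightarrow> (LBINT x. F x * \<psi> x)"
    if "\<And>n. f n \<in> L2_inv" "F \<in> L2_inv" "(\<lambda>n. cell_norm (\<lambda>x. f n x - F x)) \<longlonglongrightarrow> 0"
      and \<psi>: "\<psi> \<in> borel_measurable borel" "\<And>x. \<bar>\<psi> x\<bar> \<le> C * indicator (cball 0 R) x"
    for f and F \<psi> :: "real^3 \<Rightarrow> real"
  proof -
    obtain B where B: "\<And>u. u \<in> L2_inv \<Longrightarrow> \<bar>\<integral>x. u x * \<psi> x \<partial>lborel\<bar> \<le> B * cell_norm u"
      using pairing_bound[OF \<psi>] by blast
    have "(\<lambda>n. (LBINT x. f n x * \<psi> x) - (LBINT x. F x * \<psi> x)) \<longlonglongrightarrow> 0"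
    proof (rule Lim_null_comparison)
      show "(\<lambda>n. B * cell_norm (\<lambda>x. f n x - F x)) \<longlonglongrightarrow> 0" using tendsto_mult_right_zero[OF that(3)] .
      have "(LBINT x. f n x * \<psi> x) - (LBINT x. F x * \<psi> x) = (LBINT x. (f n x - F x) * \<psi> x)" for n
        using pairing_integrable[OF that(1) \<psi>] pairing_integrable[OF that(2) \<psi>] by (simp add: left_diff_distrib)
      then show "\<forall>\<^sub>F n in sequentially. norm ((LBINT x. f n x * \<psi> x) - (LBINT x. F x * \<psi> x)) \<le> B * cell_norm (\<lambda>x. f n x - F x)"
        using B[OF L2_inv_diff[OF that(1,2)]] by (intro always_eventually allI) simp
    qed
    then show ?thesis by (rule LIM_zero_cancel)
  qed
  have ldj: "(\<lambda>n. cell_norm (\<lambda>x. d n x $ j - E x $ j)) \<longlonglongrightarrow> 0"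
    by (rule norm2_tendsto_contraction[OF bounded_linear_vec_nth Finite_Cartesian_Product.norm_nth_le
          L2_inv_L2[OF dn] L2_inv_L2[OF E] ld])
  have "(\<lambda>n. \<integral>x. u n x * partial j \<phi> x \<partial>lborel) \<longlonglongrightarrow> (LBINT x. U x * partial j \<phi> x)"
    by (rule lim[OF un U lu test_function_borel(2)[OF \<phi>] R(2)])
  moreover have "(\<lambda>n. \<integral>x. u n x * partial j \<phi> x \<partial>lborel) \<longlonglongrightarrow> - (LBINT x. E x $ j * \<phi> x)"
    using tendsto_minus[OF lim[OF L2_inv_nth[OF dn] L2_inv_nth[OF E] ldj test_function_borel(1)[OF \<phi>] R(1)]]
      wg \<phi> unfolding weak_gradient_def by simp
  ultimately show "(LBINT x. U x * partial j \<phi> x) = - (LBINT x. E x $ j * \<phi> x)"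
    by (rule LIMSEQ_unique)
qed

lemma weak_gradient_linear_combination:
  assumes L: "u \<in> L2_inv" "u' \<in> L2_inv" "d \<in> L2_inv" "d' \<in> L2_inv"
    and wg: "weak_gradient u d" "weak_gradient u' d'"
  shows "weak_gradient (\<lambda>x. a * u x + b * u' x) (\<lambda>x. a *\<^sub>R d x + b *\<^sub>R d' x)"
  unfolding weak_gradient_def
proof (intro ballI allI)
  fix \<phi> j assume \<phi>: "\<phi> \<in> test_functions"
  obtain R C where R: "\<And>x. \<bar>\<phi> x\<bar> \<le> C * indicator (cball 0 R) x"
    "\<And>j x. \<bar>partial j \<phi> x\<bar> \<le> C * indicator (cball 0 R) x" using test_function_bounds[OF \<phi>] by blast
  note p = pairing_integrable[OF _ test_function_borel(2)[OF \<phi>] R(2)]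
    and q = pairing_integrable[OF _ test_function_borel(1)[OF \<phi>] R(1)]
  have "(LBINT x. (a * u x + b * u' x) * partial j \<phi> x) = a * (LBINT x. u x * partial j \<phi> x) + b * (LBINT x. u' x * partial j \<phi> x)"
    using p[OF L(1), of j] p[OF L(2), of j] by (simp add: distrib_right mult.assoc)
  also have "\<dots> = - (a * (LBINT x. d x $ j * \<phi> x) + b * (LBINT x. d' x $ j * \<phi> x))"
    using wg \<phi> by (simp add: weak_gradient_def)
  also have "a * (LBINT x. d x $ j * \<phi> x) + b * (LBINT x. d' x $ j * \<phi> x) = (LBINT x. (a *\<^sub>R d x + b *\<^sub>R d' x) $ j * \<phi> x)"
    using q[OF L2_inv_nth[OF L(3)], of j] q[OF L2_inv_nth[OF L(4)], of j] by (simp add: distrib_right mult.assoc)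
  finally show "(LBINT x. (a * u x + b * u' x) * partial j \<phi> x) = - (LBINT x. (a *\<^sub>R d x + b *\<^sub>R d' x) $ j * \<phi> x)" .
qed

text \<open>The integral of a derivative of a test function vanishes: averaging it over translations along a unit
segment gives the integral of a difference of two translates.\<close>

lemma weak_gradient_const: "weak_gradient (\<lambda>x. c) (\<lambda>x. 0)"
  unfolding weak_gradient_def
proof (intro ballI allI)
  fix \<phi> j assume \<phi>: "\<phi> \<in> test_functions"
  interpret pair_sigma_finite "lborel :: (real^3) measure" unit_time by (rule pair_lborel_time)
  let ?a = "axis j 1 :: real^3"
  note pm = test_function_borel(2)[OF \<phi>, of j] and \<phi>m = test_function_borel(1)[OF \<phi>]
  note [measurable] = pm \<phi>m
  obtain R C where R: "\<And>x. \<bar>\<phi> x\<bar> \<le> C * indicator (cball 0 R) x"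
    "\<And>j x. \<bar>partial j \<phi> x\<bar> \<le> C * indicator (cball 0 R) x" using test_function_bounds[OF \<phi>] by blast
  have one: "(\<lambda>x. 1 :: real) \<in> L2_inv" by (rule L2_inv_const)
  have sum: "(\<Sum>i\<in>UNIV. ?a $ i * f i) = f j" for f :: "3 \<Rightarrow> real"
    by (simp add: axis_def if_distrib[of "\<lambda>c. c * _"] cong: if_cong)
  have i\<phi>: "integrable lborel \<phi>" using pairing_integrable[OF one \<phi>m R(1)] by simp
  have "integrable lborel (\<lambda>x. \<phi> (x + - ?a))"
  proof -
    note t = test_function_translate[OF \<phi>, of "- ?a"]
    obtain R' C' where R': "\<And>x. \<bar>\<phi> (x + - ?a)\<bar> \<le> C' * indicator (cball 0 R') x"
      using test_function_bounds[OF t] by blast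
    show ?thesis using pairing_integrable[OF one test_function_borel(1)[OF t] R'] by simp
  qed
  then have "0 = (LBINT x. \<phi> (x - ?a) - \<phi> x)"
    using i\<phi> lborel_integral_translate[OF \<phi>m, of "- ?a"] by simp
  also have "\<dots> = - (LBINT x. (LINT t|unit_time. 1 * partial j \<phi> (x - t *\<^sub>R ?a)))"
    unfolding test_function_translation_integral[OF \<phi>] sum by simp
  also have "(LBINT x. (LINT t|unit_time. 1 * partial j \<phi> (x - t *\<^sub>R ?a)))
      = (LINT t|unit_time. (LBINT x. 1 * partial j \<phi> (x - t *\<^sub>R ?a)))"
    by (rule Fubini_integral[OF integrable_along_lines(2)[OF one pm R(2)], symmetric])
  also have "\<dots> = (LBINT x. partial j \<phi> x)"
    using lborel_integral_translate[OF pm, of "- (_ *\<^sub>R ?a)"] by (simp add: measure_def emeasure_unit_time)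
  finally show "(LBINT x. c * partial j \<phi> x) = - (LBINT x. (0 :: real^3) $ j * \<phi> x)" by simp
qed

end

section \<open>Periodic Sobolev fields and their symmetric gradients\<close>

lemma integral_lebesgue_eq_lborel:
  fixes F h :: "real^3 \<Rightarrow> real"
  assumes "F \<in> borel_measurable lebesgue" "h \<in> borel_measurable borel" "AE x in lborel. F x = h x"
  shows "(LINT x|lebesgue. F x) = (LBINT x. h x)"
proof -
  have h: "h \<in> borel_measurable lborel" using assms(2) by simp
  have "(LINT x|lebesgue. F x) = (LINT x|lebesgue. h x)"
    using assms(1,3) measurable_completion[OF h] by (intro integral_cong_AE) (simp_all add: AE_completion_iff)
  also have "\<dots> = (LBINT x. h x)" by (rule integral_completion[OF h])
  finally show ?thesis .
qed

text \<open>Replacing Lebesgue measurable fields by Borel representatives changes none of the integrals that define a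
weak gradient.\<close>

lemma has_weak_grad_iff_weak_gradient:
  assumes [measurable]: "v \<in> borel_measurable lebesgue" "D \<in> borel_measurable lebesgue"
    "v' \<in> borel_measurable borel" "D' \<in> borel_measurable borel"
    and v: "AE x in lborel. v x = v' x" and D: "AE x in lborel. D x = D' x"
  shows "has_weak_grad v D \<longleftrightarrow> (\<forall>i. weak_gradient (\<lambda>x. v' x $ i) (\<lambda>x. D' x $ i))"
proof -
  have "(LINT x|lebesgue. v x $ i * partial j \<phi> x) = (LBINT x. v' x $ i * partial j \<phi> x)"
    "(LINT x|lebesgue. D x $ i $ j * \<phi> x) = (LBINT x. D' x $ i $ j * \<phi> x)"
    if \<phi>: "\<phi> \<in> test_functions" for \<phi> i j
  proof -
    note [measurable] = test_function_borel[OF \<phi>]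
    have [measurable]: "\<phi> \<in> borel_measurable lebesgue" "partial j \<phi> \<in> borel_measurable lebesgue"
      by (rule measurable_completion, simp)+
    show "(LINT x|lebesgue. v x $ i * partial j \<phi> x) = (LBINT x. v' x $ i * partial j \<phi> x)"
    proof (rule integral_lebesgue_eq_lborel)
      show "AE x in lborel. v x $ i * partial j \<phi> x = v' x $ i * partial j \<phi> x"
        using v by eventually_elim simp
    qed measurable
    show "(LINT x|lebesgue. D x $ i $ j * \<phi> x) = (LBINT x. D' x $ i $ j * \<phi> x)"
    proof (rule integral_lebesgue_eq_lborel)
      show "AE x in lborel. D x $ i $ j * \<phi> x = D' x $ i $ j * \<phi> x"
        using D by eventually_elim simp
    qed measurable
  qed
  then show ?thesis unfolding has_weak_grad_def weak_gradient_def by auto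
qed

lemma L2_loc_locally_integrable:
  fixes f :: "real^3 \<Rightarrow> 'b::euclidean_space"
  assumes f: "f \<in> L2_loc" and h [measurable]: "h \<in> borel_measurable borel" and eq: "AE x in lborel. f x = h x"
  shows "integrable lborel (\<lambda>x. indicator (cbox a b) x *\<^sub>R h x)"
proof -
  have [measurable]: "f \<in> borel_measurable lebesgue" using f by (simp add: L2_loc_def)
  have "integrable lebesgue (\<lambda>x. indicator (cbox a b) x *\<^sub>R (norm (f x))\<^sup>2)"
    using f by (auto simp: L2_loc_def set_integrable_def)
  moreover have m: "(\<lambda>x. indicator (cbox a b) x *\<^sub>R (norm (h x))\<^sup>2) \<in> borel_measurable lborel" by measurable
  moreover have "AE x in lebesgue. indicator (cbox a b) x *\<^sub>R (norm (f x))\<^sup>2 = indicator (cbox a b) x *\<^sub>R (norm (h x))\<^sup>2"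
    using eq unfolding AE_completion_iff by eventually_elim simp
  ultimately have hi: "integrable lebesgue (\<lambda>x. indicator (cbox a b) x *\<^sub>R (norm (h x))\<^sup>2)"
    by (intro integrable_cong_AE_imp[OF _ measurable_completion[OF m]])
  have "integrable lborel (\<lambda>x. indicator (cbox a b) x *\<^sub>R (norm (h x))\<^sup>2)"
    using hi unfolding integrable_completion[OF m] .
  moreover have "integrable lborel (\<lambda>x. indicator (cbox a b) x :: real)"
    using emeasure_lborel_cbox_finite[of a b] by simp
  ultimately have "integrable lborel (\<lambda>x. indicator (cbox a b) x *\<^sub>R (norm (h x))\<^sup>2 + indicator (cbox a b) x)"
    by (intro Bochner_Integration.integrable_add)
  then show ?thesis
  proof (rule Bochner_Integration.integrable_bound)
    have "2 * norm (h x) \<le> (norm (h x))\<^sup>2 + 1" for x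
      using zero_le_power2[of "norm (h x) - 1"] by (simp add: power2_diff)
    then have "norm (h x) \<le> (norm (h x))\<^sup>2 + 1" for x
      using norm_ge_zero[of "h x"] by (smt (verit))
    then show "AE x in lborel. norm (indicator (cbox a b) x *\<^sub>R h x) \<le> norm (indicator (cbox a b) x *\<^sub>R (norm (h x))\<^sup>2 + indicator (cbox a b) x :: real)"
      by (auto simp: indicator_def)
  qed measurable
qed

lemma weak_gradient_translate:
  assumes [measurable]: "u \<in> borel_measurable borel" "d \<in> borel_measurable borel"
    and wg: "weak_gradient u d"
  shows "weak_gradient (\<lambda>x. u (x + z)) (\<lambda>x. d (x + z))"
  unfolding weak_gradient_def
proof (intro ballI allI)
  fix \<phi> j assume \<phi>: "\<phi> \<in> test_functions"
  let ?\<phi> = "\<lambda>x. \<phi> (x + - z)"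
  have \<phi>t: "?\<phi> \<in> test_functions" by (rule test_function_translate[OF \<phi>])
  note [measurable] = test_function_borel[OF \<phi>]
  have "Ck 1 \<phi>" using \<phi> by (auto simp: test_functions_def)
  then have pt: "partial j ?\<phi> = (\<lambda>x. partial j \<phi> (x - z))"
    by (intro ext) (subst partial_translate, auto)
  have "(LBINT x. u (x + z) * partial j \<phi> x) = (LBINT x. u x * partial j ?\<phi> x)"
    unfolding pt using lborel_integral_translate[of "\<lambda>x. u x * partial j \<phi> (x - z)" z] by simp
  also have "\<dots> = - (LBINT x. d x $ j * ?\<phi> x)" using wg \<phi>t by (simp add: weak_gradient_def)
  also have "(LBINT x. d x $ j * ?\<phi> x) = (LBINT x. d (x + z) $ j * \<phi> x)"
    using lborel_integral_translate[of "\<lambda>x. d x $ j * \<phi> (x - z)" z] by simp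
  finally show "(LBINT x. u (x + z) * partial j \<phi> x) = - (LBINT x. d (x + z) $ j * \<phi> x)" .
qed

lemma lborel_integrable_translate:
  fixes f :: "real^3 \<Rightarrow> 'b::euclidean_space"
  assumes "integrable lborel f" shows "integrable lborel (\<lambda>x. f (x + z))"
proof -
  have "integrable (distr lborel borel ((+) z)) f" using assms by (simp add: lborel_distr_plus)
  then have "integrable lborel (\<lambda>x. f (z + x))" by (rule integrable_distr[rotated]) simp
  then show ?thesis by (simp add: add.commute)
qed

lemma weak_grad_works:
  assumes "v \<in> H1_loc" shows "weak_grad v \<in> L2_loc" "has_weak_grad v (weak_grad v)"
proof -
  have "\<exists>D. D \<in> L2_loc \<and> has_weak_grad v D" using assms by (auto simp: H1_loc_def)
  from someI_ex[OF this] show "weak_grad v \<in> L2_loc" "has_weak_grad v (weak_grad v)"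
    by (simp_all add: weak_grad_def)
qed

lemma sym_grad_eq_symm: "sym_grad v x = symm (weak_grad v x)"
  by (simp add: sym_grad_def symm_def)

context lattice_basis
begin

text \<open>A periodic Sobolev field together with its weak gradient, both represented by functions that are
periodic at every point.\<close>

definition H1_inv :: "(real^3 \<Rightarrow> real^3) \<Rightarrow> (real^3 \<Rightarrow> real^3^3) \<Rightarrow> bool" where
  "H1_inv v D \<longleftrightarrow> v \<in> L2_inv \<and> D \<in> L2_inv \<and> (\<forall>i. weak_gradient (\<lambda>x. v x $ i) (\<lambda>x. D x $ i))"

text \<open>A translated weak gradient is a weak gradient of the translated field, which is the same field; weak
gradients are unique almost everywhere.\<close>

lemma H1_per_weak_grad_periodic:
  assumes v: "v \<in> H1_per g" shows "periodic g (weak_grad v)"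
proof -
  have vL: "v \<in> L2_loc" and vp: "periodic g v" and vH: "v \<in> H1_loc" using v by (auto simp: H1_per_def H1_loc_def)
  note D = weak_grad_works[OF vH]
  have Dm: "weak_grad v \<in> borel_measurable lebesgue" and vm: "v \<in> borel_measurable lebesgue"
    using D(1) vL by (auto simp: L2_loc_def)
  obtain u where u: "u \<in> L2_inv" "AE x in lborel. v x = u x" using L2_inv_representative[OF vL vp] .
  obtain b where b: "b \<in> borel_measurable borel" "AE x in lborel. weak_grad v x = b x"
    using lebesgue_measurable_ex_borel[OF Dm] .
  note [measurable] = b(1) L2_inv_borel[OF u(1)]
  have wg: "weak_gradient (\<lambda>x. u x $ i) (\<lambda>x. b x $ i)" for i
    using has_weak_grad_iff_weak_gradient[OF vm Dm _ b(1) u(2) b(2)] D(2) by simp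
  note int = L2_loc_locally_integrable[OF D(1) b]
  have inti: "integrable lborel (\<lambda>x. indicator (cbox p q) x *\<^sub>R b x $ i)" for p q i
    using integrable_bounded_linear[OF bounded_linear_vec_nth int] by simp
  have "AE x in lborel. b (x + shift n) $ i = b x $ i" for n i
  proof (rule weak_gradient_unique)
    show "weak_gradient (\<lambda>x. u x $ i) (\<lambda>x. b x $ i)" by (rule wg)
    show "weak_gradient (\<lambda>x. u (x + shift n) $ i) (\<lambda>x. b (x + shift n) $ i)"
      by (rule weak_gradient_translate[OF _ _ wg]) measurable
    show "AE x in lborel. u (x + shift n) $ i = u x $ i"
      using L2_inv_invariant[OF u(1)] by (simp add: invariant_def)
    show "integrable lborel (\<lambda>x. indicator (cbox p q) x *\<^sub>R b x $ i)" for p q by (rule inti)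
    show "integrable lborel (\<lambda>x. indicator (cbox p q) x *\<^sub>R b (x + shift n) $ i)" for p q
    proof -
      have "(indicator (cbox (p + shift n) (q + shift n)) (x + shift n) :: real) = indicator (cbox p q) x" for x
        by (auto simp: indicator_def mem_box_cart)
      then show ?thesis
        using lborel_integrable_translate[OF inti[of "p + shift n" "q + shift n" i], of "shift n"] by simp
    qed
  qed measurable
  then have bs: "AE x in lborel. \<forall>i. b (x + shift n) $ i = b x $ i" for n by (simp add: AE_all_countable)
  have "AE x in lborel. weak_grad v (x + shift n) = weak_grad v x" for n
    using bs[of n] b(2) AE_lborel_translate[OF b(2), of "shift n"] by eventually_elim (simp add: vec_eq_iff)
  then show ?thesis by (auto simp: periodic_def lattice_eq AE_completion_iff)
qed

lemma H1_per_representative: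
  assumes v: "v \<in> H1_per g"
  obtains u D where "H1_inv u D" "AE x in lborel. v x = u x" "AE x in lborel. weak_grad v x = D x"
proof -
  have vL: "v \<in> L2_loc" and vp: "periodic g v" and vH: "v \<in> H1_loc" using v by (auto simp: H1_per_def H1_loc_def)
  note G = weak_grad_works[OF vH]
  obtain u where u: "u \<in> L2_inv" "AE x in lborel. v x = u x" using L2_inv_representative[OF vL vp] .
  obtain D where D: "D \<in> L2_inv" "AE x in lborel. weak_grad v x = D x"
    using L2_inv_representative[OF G(1) H1_per_weak_grad_periodic[OF v]] .
  have m: "v \<in> borel_measurable lebesgue" "weak_grad v \<in> borel_measurable lebesgue"
    using vL G(1) by (auto simp: L2_loc_def)
  have "H1_inv u D"
    using has_weak_grad_iff_weak_gradient[OF m L2_inv_borel[OF u(1)] L2_inv_borel[OF D(1)] u(2) D(2)] G(2) u(1) D(1)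
    by (simp add: H1_inv_def)
  then show ?thesis using that u(2) D(2) by blast
qed

text \<open>The gradient chosen by \<open>weak_grad\<close> is some weak gradient, so it agrees almost everywhere with the given
one.\<close>

lemma H1_inv_H1_per:
  assumes H: "H1_inv u D"
  shows "u \<in> H1_per g" "AE x in lborel. weak_grad u x = D x"
proof -
  have u: "u \<in> L2_inv" and D: "D \<in> L2_inv" and wg: "\<And>i. weak_gradient (\<lambda>x. u x $ i) (\<lambda>x. D x $ i)"
    using H by (auto simp: H1_inv_def)
  have uL: "u \<in> L2_loc" and DL: "D \<in> L2_loc" using u D by (auto intro: L2_inv_L2_loc)
  have m: "u \<in> borel_measurable lebesgue" "D \<in> borel_measurable lebesgue" using uL DL by (auto simp: L2_loc_def)
  have "has_weak_grad u D"
    using has_weak_grad_iff_weak_gradient[OF m L2_inv_borel[OF u] L2_inv_borel[OF D]] wg by simp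
  then show P: "u \<in> H1_per g" using uL DL L2_inv_periodic[OF u] by (auto simp: H1_per_def H1_loc_def)
  obtain u' D' where H': "H1_inv u' D'" "AE x in lborel. u x = u' x" "AE x in lborel. weak_grad u x = D' x"
    using H1_per_representative[OF P] .
  have u': "u' \<in> L2_inv" and D': "D' \<in> L2_inv" and wg': "\<And>i. weak_gradient (\<lambda>x. u' x $ i) (\<lambda>x. D' x $ i)"
    using H'(1) by (auto simp: H1_inv_def)
  note [measurable] = L2_inv_borel[OF u] L2_inv_borel[OF D] L2_inv_borel[OF u'] L2_inv_borel[OF D']
  have li: "integrable lborel (\<lambda>x. indicator (cbox p q) x *\<^sub>R F x $ i)" if "F \<in> L2_inv" for F :: "real^3 \<Rightarrow> real^3^3" and p q i
    by (rule L2_loc_locally_integrable[OF L2_inv_L2_loc[OF L2_inv_nth[OF that, of i]] L2_inv_borel[OF L2_inv_nth[OF that, of i]]]) simp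
  have "AE x in lborel. D' x $ i = D x $ i" for i
  proof (rule weak_gradient_unique[OF _ _ _ _ li[OF D'] li[OF D] wg' wg])
    show "AE x in lborel. u' x $ i = u x $ i" using H'(2) by eventually_elim simp
  qed measurable
  then have "AE x in lborel. \<forall>i. D' x $ i = D x $ i" by (simp add: AE_all_countable)
  with H'(3) show "AE x in lborel. weak_grad u x = D x" by eventually_elim (simp add: vec_eq_iff)
qed

lemma H1_inv_combination:
  assumes "H1_inv u D" "H1_inv w E"
  shows "H1_inv (\<lambda>x. a *\<^sub>R u x + b *\<^sub>R w x) (\<lambda>x. a *\<^sub>R D x + b *\<^sub>R E x)"
  using assms weak_gradient_linear_combination[OF L2_inv_nth L2_inv_nth L2_inv_nth L2_inv_nth, of u w D E]
  by (auto simp: H1_inv_def intro!: L2_inv_add L2_inv_scaleR)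

lemma H1_inv_diff: "H1_inv u D \<Longrightarrow> H1_inv w E \<Longrightarrow> H1_inv (\<lambda>x. u x - w x) (\<lambda>x. D x - E x)"
  using H1_inv_combination[of u D w E 1 "-1"] by simp

lemma H1_inv_const: "H1_inv (\<lambda>x. c) (\<lambda>x. 0)"
  by (simp add: H1_inv_def L2_inv_const weak_gradient_const)

lemma H1_inv_zero_mean:
  assumes H: "H1_inv u D"
  obtains w where "H1_inv w D" "(LINT x|\<mu>. w x) = 0"
proof -
  define c where "c = (1 / measure \<mu> UNIV) *\<^sub>R (LINT x|\<mu>. u x)"
  have u: "integrable \<mu> u"
    using L2_integrable_norm(2)[OF finite_cell_measure L2_inv_L2] H by (auto simp: H1_inv_def)
  have "H1_inv (\<lambda>x. u x - c) D" using H1_inv_diff[OF H H1_inv_const[of c]] by simp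
  moreover have "(LINT x|\<mu>. u x - c) = 0"
    using u finite_measure.integrable_const[OF finite_cell_measure, of c] cell_measure_pos by (simp add: c_def)
  ultimately show ?thesis using that by blast
qed

text \<open>The three components of \<open>u\<close> are bounded separately by the Poincare inequality, whence the factor \<open>3\<close>.\<close>

lemma H1_inv_poincare_korn:
  obtains r where "r \<ge> 0" "\<And>u D. H1_inv u D \<Longrightarrow> (LINT x|\<mu>. u x) = 0 \<Longrightarrow>
    cell_norm u \<le> r * cell_norm (\<lambda>x. symm (D x))"
proof -
  obtain r where r: "r \<ge> 0" "\<And>u d. u \<in> L2_inv \<Longrightarrow> d \<in> L2_inv \<Longrightarrow> weak_gradient u d \<Longrightarrow>
     (LINT x|\<mu>. u x) = 0 \<Longrightarrow> cell_norm u \<le> r * cell_norm d"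
    using poincare by blast
  have "cell_norm u \<le> (3 * r * sqrt 2) * cell_norm (\<lambda>x. symm (D x))"
    if H: "H1_inv u D" and mean: "(LINT x|\<mu>. u x) = 0" for u D
  proof -
    have u: "u \<in> L2_inv" and D: "D \<in> L2_inv" and wg: "\<And>i. weak_gradient (\<lambda>x. u x $ i) (\<lambda>x. D x $ i)"
      using H by (auto simp: H1_inv_def)
    have "(LINT x|\<mu>. u x $ i) = 0" for i
      using integral_bounded_linear[OF bounded_linear_vec_nth[of i] L2_integrable_norm(2)[OF finite_cell_measure L2_inv_L2[OF u]]] mean
      by simp
    then have "cell_norm (\<lambda>x. u x $ i) \<le> r * cell_norm (\<lambda>x. D x $ i)" for i
      by (intro r L2_inv_nth u D wg)
    also have "r * cell_norm (\<lambda>x. D x $ i) \<le> r * cell_norm D" for i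
      by (intro mult_left_mono r norm2_dominated L2_inv_L2[OF D] L2_measurable[OF L2_inv_L2[OF L2_inv_nth[OF D]]] Finite_Cartesian_Product.norm_nth_le)
    finally have "(\<Sum>i\<in>UNIV. cell_norm (\<lambda>x. u x $ i)) \<le> (\<Sum>i\<in>(UNIV :: 3 set). r * cell_norm D)"
      by (intro sum_mono)
    then have "cell_norm u \<le> 3 * r * cell_norm D"
      using norm2_vec_le[OF L2_inv_L2[OF u]] by simp
    also have "\<dots> \<le> 3 * r * (sqrt 2 * cell_norm (\<lambda>x. symm (D x)))"
      using r(1) by (intro mult_left_mono korn[OF u D wg]) simp
    finally show ?thesis by (simp add: mult.assoc)
  qed
  then show ?thesis using that[of "3 * r * sqrt 2"] r(1) by simp
qed

lemma L2_inv_complete: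
  fixes f :: "nat \<Rightarrow> real^3 \<Rightarrow> 'b::euclidean_space"
  assumes f: "\<And>n. f n \<in> L2_inv"
    and C: "\<And>e. e > 0 \<Longrightarrow> \<exists>N. \<forall>m\<ge>N. \<forall>n\<ge>N. cell_norm (\<lambda>x. f m x - f n x) < e"
  obtains F where "F \<in> L2_inv" "(\<lambda>n. cell_norm (\<lambda>x. f n x - F x)) \<longlonglongrightarrow> 0"
proof -
  obtain r F where F: "strict_mono r" "F \<in> L2 \<mu>" "F = (\<lambda>x. lim (\<lambda>k. f (r k) x))"
    "(\<lambda>n. cell_norm (\<lambda>x. f n x - F x)) \<longlonglongrightarrow> 0"
    using L2_complete[OF finite_cell_measure L2_inv_L2[OF f] C] by blast
  have "invariant F" unfolding F(3) using L2_inv_invariant[OF f] by (simp add: invariant_def)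
  with F that show ?thesis by (auto simp: L2_inv_def)
qed

definition sym_gradients :: "(real^3 \<Rightarrow> real^3^3) set" where
  "sym_gradients = {\<lambda>x. symm (D x) | u D. H1_inv u D}"

text \<open>Normalized to mean zero, the fields of a Cauchy sequence of symmetric gradients form a Cauchy sequence
together with their full gradients, by the inequalities of Poincare and Korn; the limits are again a
field and its weak gradient.\<close>

lemma sym_gradients_complete:
  assumes p: "\<And>n. p n \<in> sym_gradients"
    and C: "\<And>e. e > 0 \<Longrightarrow> \<exists>N. \<forall>m\<ge>N. \<forall>n\<ge>N. cell_norm (\<lambda>x. p m x - p n x) < e"
  shows "\<exists>q\<in>sym_gradients. (\<lambda>n. cell_norm (\<lambda>x. p n x - q x)) \<longlonglongrightarrow> 0"
proof -
  have "\<exists>u D. H1_inv u D \<and> (LINT x|\<mu>. u x) = 0 \<and> p n = (\<lambda>x. symm (D x))" for n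
    using p[of n] H1_inv_zero_mean unfolding sym_gradients_def by blast
  then obtain u D where H: "\<And>n. H1_inv (u n) (D n)" and mean: "\<And>n. (LINT x|\<mu>. u n x) = 0"
    and pD: "\<And>n. p n = (\<lambda>x. symm (D n x))" by metis
  have uL: "u n \<in> L2_inv" and DL: "D n \<in> L2_inv" for n using H by (auto simp: H1_inv_def)
  have ui: "integrable \<mu> (u n)" for n
    by (rule L2_integrable_norm(2)[OF finite_cell_measure L2_inv_L2[OF uL]])
  have pd: "(\<lambda>x. symm (D m x - D n x)) = (\<lambda>x. p m x - p n x)" for m n
    by (simp add: pD linear_diff[OF linear_symm])
  obtain r where r: "r \<ge> 0" "\<And>u D. H1_inv u D \<Longrightarrow> (LINT x|\<mu>. u x) = 0 \<Longrightarrow>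
    cell_norm u \<le> r * cell_norm (\<lambda>x. symm (D x))"
    using H1_inv_poincare_korn by blast
  have du: "cell_norm (\<lambda>x. u m x - u n x) \<le> r * cell_norm (\<lambda>x. p m x - p n x)" for m n
    using r(2)[OF H1_inv_diff[OF H H], of m n] mean ui by (simp add: pd)
  have dD: "cell_norm (\<lambda>x. D m x - D n x) \<le> sqrt 2 * cell_norm (\<lambda>x. p m x - p n x)" for m n
    using H1_inv_diff[OF H[of m] H[of n]] korn[of "\<lambda>x. u m x - u n x" "\<lambda>x. D m x - D n x"]
    unfolding pd by (simp add: H1_inv_def)
  have cauchy: "\<exists>N. \<forall>m\<ge>N. \<forall>n\<ge>N. cell_norm (\<lambda>x. f m x - f n x) < e"
    if le: "\<And>m n. cell_norm (\<lambda>x. f m x - f n x) \<le> c * cell_norm (\<lambda>x. p m x - p n x)"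
      and c: "c \<ge> 0" and e: "e > 0" for f :: "nat \<Rightarrow> real^3 \<Rightarrow> 'b::euclidean_space" and c e
  proof -
    obtain N where N: "\<And>m n. m \<ge> N \<Longrightarrow> n \<ge> N \<Longrightarrow> cell_norm (\<lambda>x. p m x - p n x) < e / (c + 1)"
      using C[of "e / (c + 1)"] c e by auto
    have "cell_norm (\<lambda>x. f m x - f n x) < e" if "m \<ge> N" "n \<ge> N" for m n
    proof -
      have "cell_norm (\<lambda>x. f m x - f n x) \<le> (c + 1) * cell_norm (\<lambda>x. p m x - p n x)"
        using le[of m n] by (simp add: distrib_right add_increasing2)
      also have "\<dots> < (c + 1) * (e / (c + 1))" using N[OF that] c by (intro mult_strict_left_mono) auto
      finally show ?thesis using c by simp
    qed
    then show ?thesis by blast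
  qed
  obtain U where U: "U \<in> L2_inv" "(\<lambda>n. cell_norm (\<lambda>x. u n x - U x)) \<longlonglongrightarrow> 0"
    using L2_inv_complete[OF uL cauchy[OF du r(1)]] .
  have sqrt2: "0 \<le> sqrt 2" by simp
  obtain E where E: "E \<in> L2_inv" "(\<lambda>n. cell_norm (\<lambda>x. D n x - E x)) \<longlonglongrightarrow> 0"
    using L2_inv_complete[OF DL cauchy[OF dD sqrt2]] .
  note nth = norm2_tendsto_contraction[OF bounded_linear_vec_nth Finite_Cartesian_Product.norm_nth_le L2_inv_L2 L2_inv_L2]
  have "weak_gradient (\<lambda>x. U x $ i) (\<lambda>x. E x $ i)" for i
    by (rule weak_gradient_L2_limit[OF L2_inv_nth[OF uL] L2_inv_nth[OF DL] _ L2_inv_nth[OF U(1)] L2_inv_nth[OF E(1)]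
          nth[OF uL U] nth[OF DL E]]) (use H in \<open>simp add: H1_inv_def\<close>)
  then have "H1_inv U E" using U(1) E(1) by (simp add: H1_inv_def)
  then have q: "(\<lambda>x. symm (E x)) \<in> sym_gradients" by (auto simp: sym_gradients_def)
  have "(\<lambda>n. cell_norm (\<lambda>x. p n x - symm (E x))) \<longlonglongrightarrow> 0"
    unfolding pD
    by (rule norm2_tendsto_contraction[OF bounded_linear_symm norm_symm_le L2_inv_L2[OF DL] L2_inv_L2[OF E(1)] E(2)])
  then show ?thesis by (intro bexI[where x = "\<lambda>x. symm (E x)"] q)
qed

lemma AE_eq_of_L2_inv:
  assumes f: "f \<in> L2_inv" and h: "h \<in> L2_inv" and eq: "cell_norm (\<lambda>x. f x - h x) = 0"
  shows "AE x in lborel. f x = h x"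
proof (rule AE_invariant)
  note [measurable] = L2_inv_borel[OF f] L2_inv_borel[OF h]
  show "invariant (\<lambda>x. f x = h x)"
    using L2_inv_invariant[OF f] L2_inv_invariant[OF h] by (simp add: invariant_def)
  have "{x \<in> space borel. f x = h x} \<in> sets borel" by measurable
  then show "{x. f x = h x} \<in> sets borel" by simp
  show "AE x in \<mu>. f x = h x"
    using norm2_eq_0_AE[OF L2_inv_L2[OF L2_inv_diff[OF f h]] eq] by simp
qed

lemma H1_inv_unique:
  assumes H: "H1_inv u D" "H1_inv w E"
    and mean: "(LINT x|\<mu>. u x) = 0" "(LINT x|\<mu>. w x) = 0"
    and eq: "AE x in lborel. symm (D x) = symm (E x)"
  shows "AE x in lborel. u x = w x"
proof -
  have L: "u \<in> L2_inv" "w \<in> L2_inv" "D \<in> L2_inv" "E \<in> L2_inv" using H by (auto simp: H1_inv_def)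
  have mean': "(LINT x|\<mu>. u x - w x) = 0"
    using mean L2_integrable_norm(2)[OF finite_cell_measure L2_inv_L2[OF L(1)]]
      L2_integrable_norm(2)[OF finite_cell_measure L2_inv_L2[OF L(2)]] by simp
  obtain r where "\<And>u D. H1_inv u D \<Longrightarrow> (LINT x|\<mu>. u x) = 0 \<Longrightarrow>
      cell_norm u \<le> r * cell_norm (\<lambda>x. symm (D x))"
    using H1_inv_poincare_korn by blast
  from this[OF H1_inv_diff[OF H] mean']
  have r: "cell_norm (\<lambda>x. u x - w x) \<le> r * cell_norm (\<lambda>x. symm (D x - E x))" .
  have m: "(\<lambda>x. symm (D x - E x)) \<in> borel_measurable \<mu>"
    by (intro L2_measurable L2_bounded_linear[OF bounded_linear_symm] L2_diff L2_inv_L2 L)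
  have "AE x in \<mu>. symm (D x - E x) = 0"
    by (rule AE_cell_if_lborel) (use eq in \<open>eventually_elim, simp add: linear_diff[OF linear_symm]\<close>)
  then have "cell_norm (\<lambda>x. symm (D x - E x)) = cell_norm (\<lambda>x. 0 :: real^3^3)"
    by (rule norm2_cong_AE[OF _ m]) simp
  also have "\<dots> = 0" by (simp add: norm2_def)
  finally have "cell_norm (\<lambda>x. u x - w x) = 0"
    using r by (intro antisym) simp_all
  then show ?thesis by (rule AE_eq_of_L2_inv[OF L(1,2)])
qed

text \<open>The residual \<open>s\<close> of the projection of \<open>e\<close> on the symmetric gradients is an admissible divergence-free
field. It is orthogonal to \<open>e\<close> by hypothesis and to its projection by construction, hence to itself.\<close>

lemma orthogonal_to_div_free_imp_sym_gradient:
  assumes e: "e \<in> L2_per_sym g"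
    and orth: "\<forall>s\<in>L2_per_sym g. (\<forall>v\<in>H1_per g. div_per g s v = 0) \<longrightarrow> (LINT y:cell g|lebesgue. e y \<bullet> s y) = 0"
  obtains u D where "H1_inv u D" "AE x in lborel. e x = symm (D x)"
proof -
  have eL: "e \<in> L2_loc" and ep: "periodic g e" and es: "AE x in lborel. transpose (e x) = e x"
    using e by (auto simp: L2_per_sym_def AE_completion_iff)
  have em [measurable]: "e \<in> borel_measurable lebesgue" using eL by (simp add: L2_loc_def)
  obtain f0 where f0: "f0 \<in> L2_inv" "AE x in lborel. e x = f0 x" using L2_inv_representative[OF eL ep] .
  \<comment> \<open>The representative is made symmetric at every point, so that the residual is symmetric too.\<close>
  define f where "f x = symm (f0 x)" for x
  have f: "f \<in> L2_inv" unfolding f_def by (rule L2_inv_bounded_linear[OF bounded_linear_symm f0(1)])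
  have ef: "AE x in lborel. e x = f x"
    using f0(2) es by eventually_elim (simp add: f_def symm_def)
  have sgL: "q \<in> L2_inv" if "q \<in> sym_gradients" for q
    using that L2_inv_bounded_linear[OF bounded_linear_symm] by (auto simp: sym_gradients_def H1_inv_def)
  obtain p where p: "p \<in> sym_gradients" and port: "\<And>w. w \<in> sym_gradients \<Longrightarrow> (LINT x|\<mu>. (f x - p x) \<bullet> w x) = 0"
  proof (rule L2_projection[of f \<mu> sym_gradients])
    show "f \<in> L2 \<mu>" by (rule L2_inv_L2[OF f])
    show "sym_gradients \<subseteq> L2 \<mu>" using sgL L2_inv_L2 by blast
    show "(\<lambda>x. 0) \<in> sym_gradients"
      unfolding sym_gradients_def using H1_inv_const[of 0] by (auto intro!: exI[of _ "\<lambda>x. 0"] simp: linear_0[OF linear_symm])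
    show "(\<lambda>x. a *\<^sub>R q x + b *\<^sub>R w x) \<in> sym_gradients" if qw: "q \<in> sym_gradients" "w \<in> sym_gradients" for q w a b
    proof -
      obtain u D u' D' where "H1_inv u D" "q = (\<lambda>x. symm (D x))" "H1_inv u' D'" "w = (\<lambda>x. symm (D' x))"
        using qw unfolding sym_gradients_def by blast
      then have "(\<lambda>x. a *\<^sub>R q x + b *\<^sub>R w x) = (\<lambda>x. symm (a *\<^sub>R D x + b *\<^sub>R D' x))"
        "H1_inv (\<lambda>x. a *\<^sub>R u x + b *\<^sub>R u' x) (\<lambda>x. a *\<^sub>R D x + b *\<^sub>R D' x)"
        by (simp_all add: linear_add[OF linear_symm] linear_scale[OF linear_symm] H1_inv_combination)
      then show ?thesis
        unfolding sym_gradients_def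
        by (intro CollectI exI[of _ "\<lambda>x. a *\<^sub>R u x + b *\<^sub>R u' x"] exI[of _ "\<lambda>x. a *\<^sub>R D x + b *\<^sub>R D' x"] conjI)
    qed
  qed (use sym_gradients_complete that in blast)+
  obtain u D where H: "H1_inv u D" and pD: "p = (\<lambda>x. symm (D x))" using p unfolding sym_gradients_def by blast
  define s where "s x = f x - p x" for x
  have s: "s \<in> L2_inv" unfolding s_def by (rule L2_inv_diff[OF f sgL[OF p]])
  have ssym: "transpose (s x) = s x" for x
    by (simp add: s_def f_def pD linear_diff[OF linear_transpose] transpose_symm)
  have sm [measurable]: "s \<in> borel_measurable lebesgue" using L2_inv_L2_loc[OF s] by (simp add: L2_loc_def)
  note [measurable] = L2_inv_borel[OF f] L2_inv_borel[OF s]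
  have "s \<in> L2_per_sym g"
    using L2_inv_L2_loc[OF s] L2_inv_periodic[OF s] ssym by (simp add: L2_per_sym_def)
  moreover have "div_per g s v = 0" if v: "v \<in> H1_per g" for v
  proof -
    obtain w E where w: "H1_inv w E" "AE x in lborel. weak_grad v x = E x" using H1_per_representative[OF v] by blast
    have E: "E \<in> L2_inv" using w(1) by (simp add: H1_inv_def)
    have [measurable]: "weak_grad v \<in> borel_measurable lebesgue"
      using weak_grad_works(1)[of v] v by (auto simp: H1_per_def L2_loc_def)
    note [measurable] = L2_inv_borel[OF E]
    have "(LINT y:cell g|lebesgue. s y \<bullet> weak_grad v y) = (LINT y|\<mu>. s y \<bullet> E y)"
    proof (rule set_integral_cell)
      show "AE y in lborel. s y \<bullet> weak_grad v y = s y \<bullet> E y" using w(2) by eventually_elim simp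
    qed measurable
    also have "\<dots> = (LINT y|\<mu>. (f y - p y) \<bullet> symm (E y))"
      using inner_symm[OF ssym] by (simp add: s_def)
    also have "\<dots> = 0" by (rule port) (use w(1) in \<open>auto simp: sym_gradients_def\<close>)
    finally show ?thesis by (simp add: div_per_def)
  qed
  ultimately have "(LINT y:cell g|lebesgue. e y \<bullet> s y) = 0" using orth by blast
  moreover have "(LINT y:cell g|lebesgue. e y \<bullet> s y) = (LINT y|\<mu>. f y \<bullet> s y)"
  proof (rule set_integral_cell)
    show "AE y in lborel. e y \<bullet> s y = f y \<bullet> s y" using ef by eventually_elim simp
  qed measurable
  ultimately have fs: "(LINT y|\<mu>. f y \<bullet> s y) = 0" by simp
  have ps: "(LINT y|\<mu>. p y \<bullet> s y) = 0"
    using port[OF p] by (simp add: s_def inner_commute)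
  have "(LINT y|\<mu>. s y \<bullet> s y) = (LINT y|\<mu>. f y \<bullet> s y - p y \<bullet> s y)"
    by (simp add: s_def inner_diff_left)
  also have "\<dots> = 0"
    using L2_inner_integrable[OF L2_inv_L2[OF f] L2_inv_L2[OF s]] L2_inner_integrable[OF L2_inv_L2[OF sgL[OF p]] L2_inv_L2[OF s]] fs ps
    by simp
  finally have "cell_norm (\<lambda>x. f x - p x) = 0"
    by (simp add: norm2_def power2_norm_eq_inner s_def)
  then have "AE x in lborel. f x = p x" by (rule AE_eq_of_L2_inv[OF f sgL[OF p]])
  with ef have "AE x in lborel. e x = symm (D x)" by eventually_elim (simp add: pD)
  with H that show ?thesis by blast
qed

end

text \<open>The product of a symmetric matrix with a symmetric gradient is its product with the full gradient.\<close>

lemma sym_gradient_orthogonal_to_div_free: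
  assumes e: "e \<in> L2_per_sym g" and v: "v \<in> H1_per g" and ev: "AE x in lebesgue. e x = sym_grad v x"
    and s: "s \<in> L2_per_sym g" and div: "div_per g s v = 0"
    and meas: "cell g \<in> sets lebesgue"
  shows "(LINT y:cell g|lebesgue. e y \<bullet> s y) = 0"
proof -
  have [measurable]: "e \<in> borel_measurable lebesgue" "s \<in> borel_measurable lebesgue" "weak_grad v \<in> borel_measurable lebesgue"
    using e s weak_grad_works(1)[of v] v by (auto simp: L2_per_sym_def L2_loc_def H1_per_def)
  note [measurable] = meas
  have ssym: "AE x in lebesgue. transpose (s x) = s x" using s by (simp add: L2_per_sym_def)
  have "AE y in lebesgue. e y \<bullet> s y = s y \<bullet> weak_grad v y"
    using ev ssym
  proof eventually_elim
    case (elim y)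
    then show ?case using inner_symm[OF elim(2), of "weak_grad v y"] by (simp add: sym_grad_eq_symm inner_commute)
  qed
  then have "(LINT y:cell g|lebesgue. e y \<bullet> s y) = (LINT y:cell g|lebesgue. s y \<bullet> weak_grad v y)"
    unfolding set_lebesgue_integral_def by (intro integral_cong_AE) (measurable, auto)
  then show ?thesis using div by (simp add: div_per_def)
qed

theorem theorem23:
  fixes g :: "3 \<Rightarrow> real^3" and e :: "real^3 \<Rightarrow> real^3^3"
  assumes "inj g" and "independent (range g)"
    and "e \<in> L2_per_sym g"
  shows "(\<exists>v\<in>H1_per0 g. (AE x in lebesgue. e x = sym_grad v x) \<and>
            (\<forall>w\<in>H1_per0 g. (AE x in lebesgue. e x = sym_grad w x) \<longrightarrow>
               (AE x in lebesgue. w x = v x)))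
     \<longleftrightarrow> (\<forall>s\<in>L2_per_sym g. (\<forall>v\<in>H1_per g. div_per g s v = 0) \<longrightarrow>
            (LINT y:cell g|lebesgue. e y \<bullet> s y) = 0)"
proof
  interpret lattice_basis g using assms(1,2) by (rule lattice_basis.intro)
  {
    assume "\<exists>v\<in>H1_per0 g. (AE x in lebesgue. e x = sym_grad v x) \<and>
            (\<forall>w\<in>H1_per0 g. (AE x in lebesgue. e x = sym_grad w x) \<longrightarrow>
               (AE x in lebesgue. w x = v x))"
    then obtain v where v: "v \<in> H1_per g" "AE x in lebesgue. e x = sym_grad v x"
      by (auto simp: H1_per0_def)
    have "cell g \<in> sets lebesgue" using borel_compact[OF compact_cell] by simp
    then show "\<forall>s\<in>L2_per_sym g. (\<forall>v\<in>H1_per g. div_per g s v = 0) \<longrightarrow>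
            (LINT y:cell g|lebesgue. e y \<bullet> s y) = 0"
      using sym_gradient_orthogonal_to_div_free[OF assms(3) v] v(1) by blast
  next
    assume orth: "\<forall>s\<in>L2_per_sym g. (\<forall>v\<in>H1_per g. div_per g s v = 0) \<longrightarrow>
            (LINT y:cell g|lebesgue. e y \<bullet> s y) = 0"
    obtain u D where "H1_inv u D" and eD: "AE x in lborel. e x = symm (D x)"
      using orthogonal_to_div_free_imp_sym_gradient[OF assms(3) orth] .
    then obtain v where v: "H1_inv v D" "(LINT x|\<mu>. v x) = 0" using H1_inv_zero_mean by blast
    have mean: "(LINT y:cell g|lebesgue. w y) = (LINT x|\<mu>. w' x)"
      if "w \<in> H1_per g" "w' \<in> L2_inv" "AE x in lborel. w x = w' x" for w w' :: "real^3 \<Rightarrow> real^3"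
      using that by (intro set_integral_cell L2_inv_borel) (auto simp: H1_per_def H1_loc_def L2_loc_def)
    have vL: "v \<in> L2_inv" using v(1) by (simp add: H1_inv_def)
    have v0: "v \<in> H1_per0 g"
      using mean[OF H1_inv_H1_per(1)[OF v(1)] vL] v H1_inv_H1_per(1) by (simp add: H1_per0_def)
    have ev: "AE x in lebesgue. e x = sym_grad v x"
      unfolding AE_completion_iff sym_grad_eq_symm using eD H1_inv_H1_per(2)[OF v(1)] by eventually_elim simp
    have "AE x in lebesgue. w x = v x" if w: "w \<in> H1_per0 g" and ew: "AE x in lebesgue. e x = sym_grad w x" for w
    proof -
      have wH: "w \<in> H1_per g" using w by (simp add: H1_per0_def)
      obtain w' E where w': "H1_inv w' E" "AE x in lborel. w x = w' x" "AE x in lborel. weak_grad w x = E x"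
        using H1_per_representative[OF wH] .
      have "w' \<in> L2_inv" using w'(1) by (simp add: H1_inv_def)
      then have m: "(LINT x|\<mu>. w' x) = 0"
        using mean[OF wH _ w'(2)] w by (simp add: H1_per0_def)
      have "AE x in lborel. symm (E x) = symm (D x)"
        using ew[unfolded AE_completion_iff sym_grad_eq_symm] eD w'(3) by eventually_elim simp
      from H1_inv_unique[OF w'(1) v(1) m v(2) this] w'(2)
      show ?thesis unfolding AE_completion_iff by eventually_elim simp
    qed
    with v0 ev show "\<exists>v\<in>H1_per0 g. (AE x in lebesgue. e x = sym_grad v x) \<and>
            (\<forall>w\<in>H1_per0 g. (AE x in lebesgue. e x = sym_grad w x) \<longrightarrow>
               (AE x in lebesgue. w x = v x))" by blast
  }
qed

end
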